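(* Let $q,k,k'\in\mathbb{N}$ with $k\le k'$. For every $\delta\in(0,1/2)$ there exists $\alpha_0>0$ such that for every $\alpha\in(0,\alpha_0]$ and $T\in\mathbb{N}$ there exist $n_0\in\mathbb{N}$ and $\tau\in(0,1)$ such that the following holds: for every choice of injections $\phi_1,\dots,\phi_T:[k]\to[k']$ and one-wise uniform distributions $\mathcal{Y}_1,\dots,\mathcal{Y}_T$ on $\mathbb{Z}_q^k$, and every $n\ge n_0$ (with $m=\alpha n$), any protocol for the DIHP communication problem with these parameters that succeeds with advantage $\delta$ has communication cost at least $\tau n$.
   Context: $\mathbb{Z}_q$ denotes integers mod $q$. A distribution on $\mathbb{Z}_q^k$ is one-wise uniform if each coordinate's marginal is uniform on $\mathbb{Z}_q$; for such $\mathcal{Y}$, $\mathcal{Y}^{\otimes m}$ is the distribution of an $m\times k$ matrix whose rows are i.i.d. samples of $\mathcal{Y}$. $\mathrm{PHM}(m,k,n)$ is the set of matrices $M\in[n]^{m\times k}$ all of whose columns have distinct entries ($k$-partite hypermatchings). For an injection $\phi:[k]\to[k']$ and $M\in\mathrm{PHM}(m,k,n)$, define $\Pi^\phi_M:\mathbb{Z}_q^{n\times k'}\to\mathbb{Z}_q^{m\times k}$ by $(\Pi^\phi_M X)_{j,\ell}=X_{M_{j,\ell},\phi(\ell)}$. The DIHP problem: there are $T$ players speaking once each in order $1,\dots,T$, writing messages on a shared blackboard visible to all later players; player $t$ receives $M_t\in\mathrm{PHM}(m,k,n)$ and $Z_t\in\mathbb{Z}_q^{m\times k}$, and the last player outputs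 a bit. In both input distributions the $M_t$ are independent and uniform. In the NO distribution the $Z_t$ are independent and uniform. In the YES distribution, sample $X^*\in\mathbb{Z}_q^{n\times k'}$ uniformly, and for each $t$ independently $Y_t\sim\mathcal{Y}_t^{\otimes m}$, and set $Z_t=\Pi^{\phi_t}_{M_t}X^*-Y_t$. Each player also reveals its hypermatching $M_t$ at no cost; the communication cost is the worst-case total number of bits of all messages. A protocol succeeds with advantage $\delta$ if the probabilities that it outputs YES under the YES and NO distributions differ by at least $\delta$. *)

theory Defs
  imports "HOL-Probability.Probability" "HOL-Library.Extended_Real"
begin

text \<open>
  Index sets \<open>[n]\<close> are rendered as \<open>{..<n}\<close> and players are numbered \<open>0, \<dots>, T - 1\<close>.
  Residues modulo \<open>q\<close> are represented by \<open>0, \<dots>, q - 1\<close>.  Vectors and matrices are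
  extensional functions (\<open>undefined\<close> outside their index range), so that each mathematical
  object has exactly one representative and uniform distributions are counted correctly.
\<close>

type_synonym hypermatching = "nat \<Rightarrow> nat \<Rightarrow> nat"
type_synonym zmat = "nat \<Rightarrow> nat \<Rightarrow> int"
type_synonym player_input = "hypermatching \<times> zmat"

definition Zq :: "nat \<Rightarrow> int set" where
  "Zq q = {0..<int q}"

definition Zq_mat :: "nat \<Rightarrow> nat \<Rightarrow> nat \<Rightarrow> zmat set" where
  "Zq_mat q m k = {..<m} \<rightarrow>\<^sub>E ({..<k} \<rightarrow>\<^sub>E Zq q)"

definition PHM :: "nat \<Rightarrow> nat \<Rightarrow> nat \<Rightarrow> hypermatching set" where
  "PHM m k n = {M \<in> {..<m} \<rightarrow>\<^sub>E ({..<k} \<rightarrow>\<^sub>E {..<n}). \<forall>l<k. inj_on (\<lambda>j. M j l) {..<m}}"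

definition one_wise_uniform :: "nat \<Rightarrow> nat \<Rightarrow> (nat \<Rightarrow> int) pmf \<Rightarrow> bool" where
  "one_wise_uniform q k Y \<longleftrightarrow>
     set_pmf Y \<subseteq> ({..<k} \<rightarrow>\<^sub>E Zq q) \<and>
     (\<forall>l<k. map_pmf (\<lambda>y. y l) Y = pmf_of_set (Zq q))"

definition iid_rows :: "nat \<Rightarrow> (nat \<Rightarrow> int) pmf \<Rightarrow> zmat pmf" where
  "iid_rows m Y = Pi_pmf {..<m} undefined (\<lambda>_. Y)"

definition hm_proj :: "nat \<Rightarrow> nat \<Rightarrow> (nat \<Rightarrow> nat) \<Rightarrow> hypermatching \<Rightarrow> zmat \<Rightarrow> zmat" where
  "hm_proj m k \<phi> M X = (\<lambda>j\<in>{..<m}. \<lambda>l\<in>{..<k}. X (M j l) (\<phi> l))"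

definition Zq_mat_diff :: "nat \<Rightarrow> nat \<Rightarrow> nat \<Rightarrow> zmat \<Rightarrow> zmat \<Rightarrow> zmat" where
  "Zq_mat_diff q m k A B = (\<lambda>j\<in>{..<m}. \<lambda>l\<in>{..<k}. (A j l - B j l) mod int q)"

definition dihp_no :: "nat \<Rightarrow> nat \<Rightarrow> nat \<Rightarrow> nat \<Rightarrow> nat \<Rightarrow> (nat \<Rightarrow> player_input) pmf" where
  "dihp_no q k T m n =
     Pi_pmf {..<T} undefined
       (\<lambda>_. pair_pmf (pmf_of_set (PHM m k n)) (pmf_of_set (Zq_mat q m k)))"

definition dihp_yes ::
  "nat \<Rightarrow> nat \<Rightarrow> nat \<Rightarrow> nat \<Rightarrow> nat \<Rightarrow> nat \<Rightarrow> (nat \<Rightarrow> nat \<Rightarrow> nat) \<Rightarrow>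
     (nat \<Rightarrow> (nat \<Rightarrow> int) pmf) \<Rightarrow> (nat \<Rightarrow> player_input) pmf" where
  "dihp_yes q k k' T m n \<phi> \<Y> =
     bind_pmf (pmf_of_set (Zq_mat q n k'))
       (\<lambda>X. Pi_pmf {..<T} undefined
          (\<lambda>t. map_pmf (\<lambda>(M, Y). (M, Zq_mat_diff q m k (hm_proj m k (\<phi> t) M X) Y))
                 (pair_pmf (pmf_of_set (PHM m k n)) (iid_rows m (\<Y> t)))))"

text \<open>
  The blackboard lists, for the players that have already spoken, the freely revealed
  hypermatching together with the message.
\<close>

type_synonym blackboard = "(hypermatching \<times> bool list) list"

datatype det_protocol =
  Protocol (message: "nat \<Rightarrow> blackboard \<Rightarrow> player_input \<Rightarrow> bool list")
           (decision: "blackboard \<Rightarrow> player_input \<Rightarrow> bool")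

primrec board :: "det_protocol \<Rightarrow> (nat \<Rightarrow> player_input) \<Rightarrow> nat \<Rightarrow> blackboard" where
  "board p I 0 = []"
| "board p I (Suc t) = board p I t @ [(fst (I t), message p t (board p I t) (I t))]"

text \<open>
  The last player decides from its own input and the final blackboard.  All \<open>T\<close> messages are
  charged, the output bit is not (a last player who only decides writes the empty message).
\<close>

definition final_output :: "nat \<Rightarrow> det_protocol \<Rightarrow> (nat \<Rightarrow> player_input) \<Rightarrow> bool" where
  "final_output T p I = decision p (board p I T) (I (T - 1))"

definition total_bits :: "nat \<Rightarrow> det_protocol \<Rightarrow> (nat \<Rightarrow> player_input) \<Rightarrow> nat" where
  "total_bits T p I = (\<Sum>(M, w)\<leftarrow>board p I T. length w)"

text \<open>
  A protocol is a distribution over deterministic protocols, i.e. the players may use shared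
  randomness.  Deterministic protocols are the point masses, and private coins are the case in
  which the coins of different players are independent.
\<close>

type_synonym protocol = "det_protocol pmf"

definition dihp_inputs :: "nat \<Rightarrow> nat \<Rightarrow> nat \<Rightarrow> nat \<Rightarrow> nat \<Rightarrow> (nat \<Rightarrow> player_input) set" where
  "dihp_inputs q k T m n = {..<T} \<rightarrow>\<^sub>E (PHM m k n \<times> Zq_mat q m k)"

definition comm_cost :: "nat \<Rightarrow> nat \<Rightarrow> nat \<Rightarrow> nat \<Rightarrow> nat \<Rightarrow> protocol \<Rightarrow> enat" where
  "comm_cost q k T m n P =
     (SUP p\<in>set_pmf P. SUP I\<in>dihp_inputs q k T m n. enat (total_bits T p I))"

definition prob_yes :: "nat \<Rightarrow> protocol \<Rightarrow> (nat \<Rightarrow> player_input) pmf \<Rightarrow> real" where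
  "prob_yes T P D = pmf (bind_pmf P (\<lambda>p. map_pmf (final_output T p) D)) True"

definition succeeds_with_advantage ::
  "nat \<Rightarrow> nat \<Rightarrow> nat \<Rightarrow> nat \<Rightarrow> nat \<Rightarrow> nat \<Rightarrow> (nat \<Rightarrow> nat \<Rightarrow> nat) \<Rightarrow>
     (nat \<Rightarrow> (nat \<Rightarrow> int) pmf) \<Rightarrow> protocol \<Rightarrow> real \<Rightarrow> bool" where
  "succeeds_with_advantage q k k' T m n \<phi> \<Y> P \<delta> \<longleftrightarrow>
     \<delta> \<le> \<bar>prob_yes T P (dihp_yes q k k' T m n \<phi> \<Y>) - prob_yes T P (dihp_no q k T m n)\<bar>"

end

theory Submission
  imports Defs
begin

text \<open>
  For a transcript \<open>R\<close> let \<open>u\<^sub>R X\<close> be the probability of the messages of \<open>R\<close> given the hidden matrix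
  \<open>X\<close>.  Given the hypermatchings, \<open>R\<close> has YES probability the Fourier coefficient of \<open>u\<^sub>R\<close> at \<open>0\<close>, so it
  suffices to follow how one round changes this coefficient.  A round convolves the transform of
  \<open>u\<^sub>R\<close> with the transform of a message set, transported along the random hypermatching, and
  one-wise uniformity leaves only frequencies that meet each hyperedge in no or at least two vertices.
  A set of \<open>d\<close> vertices is covered in this way with probability \<open>O(d/n)\<^bsup>d/2\<^esup>\<close>.

  The quantity that survives the iteration is the \<open>L\<^sup>1\<close> norm of the transform on each level
  \<open>w \<le> \<sigma> n\<close>, averaged over transcripts and bounded by \<open>(\<theta> n/w)\<^bsup>w/2\<^esup>\<close>.  Low frequencies are handled
  by the level inequality for message sets (a \<open>2p\<close>-th moment, counted combinatorially) and by the
  fact that weight is lost only where the hypermatching pairs up vertices of the support.  High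
  frequencies are handled by Cauchy--Schwarz and Parseval: the frequency must drop by \<open>\<Omega>(n)\<close>, which
  is exponentially unlikely once \<open>k m / n\<close> is below an absolute constant.  This is the only
  constraint on \<open>\<alpha>\<close>, while the loss of a constant factor per round is absorbed by \<open>\<tau>\<close>.
\<close>

subsection \<open>Fourier analysis on matrices over residues\<close>

text \<open>The L1 norm is chosen because it is submultiplicative under convolution and can be
  summed over all messages at once, at the cost of only a 2p-th root of their number. It is
  controlled at low weight only. At high weight each transcript and each target frequency is bounded
  separately, so a bound exp(-\<Omega>(\<sigma> n)) must pay for the number of transcripts and for
  the number of frequencies in the next window \<sigma>'. The latter is at most exp(\<sigma>' n / z
  + O(z n)) for every z > 0, whence \<sigma>' of order \<sigma>^2; the former forces \<tau> of order
  \<sigma> / T for the last \<sigma>. Since \<theta> grows geometrically and must still be small at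
  round T, parameters are chosen backwards from \<delta> and T. Two scales stay apart: the true
  message length \<tau> n, and a larger \<open>c\<close> of order n up to which the level inequality
  must hold. YES and NO are compared by a hybrid argument: in each round the term of frequency 0 is
  exactly the message probability for uniform Z times the old coefficient at 0, and all other terms
  count as error.\<close>

definition ez :: "nat \<Rightarrow> int \<Rightarrow> complex" where
  "ez q x = cis (2 * pi * real_of_int x / real q)"

lemma ez_0 [simp]: "ez q 0 = 1"
  by (simp add: ez_def)

lemma ez_add: "ez q (x + y) = ez q x * ez q y"
  by (simp add: ez_def cis_mult ring_distribs add_divide_distrib)

lemma norm_ez [simp]: "cmod (ez q x) = 1"
  by (simp add: ez_def)

lemma cnj_ez: "cnj (ez q x) = ez q (- x)"
  by (simp add: ez_def cis_cnj)

lemma ez_period: "ez q (int q * x) = 1"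
proof (cases "q = 0")
  case False
  have "2 * pi * real_of_int (int q * x) / real q = 2 * pi * real_of_int x"
    using False by simp
  then show ?thesis
    unfolding ez_def by (metis Ints_of_int cis_multiple_2pi)
qed (simp add: ez_def)

lemma ez_cong:
  assumes "int q dvd x - y"
  shows "ez q x = ez q y"
proof -
  from assms obtain z where "x - y = int q * z" by (elim dvdE)
  then have "x = y + int q * z" by simp
  then show ?thesis by (simp add: ez_add ez_period)
qed

lemma ez_sum: "ez q (\<Sum>i\<in>A. f i) = (\<Prod>i\<in>A. ez q (f i))"
  by (induction A rule: infinite_finite_induct) (auto simp: ez_add)

lemma ez_eq_1_iff:
  assumes "q > 0"
  shows "ez q x = 1 \<longleftrightarrow> int q dvd x"
proof
  assume "ez q x = 1"
  then have "cos (2 * pi * real_of_int x / real q) = 1"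
    by (simp add: ez_def complex_eq_iff)
  then obtain n :: int where "2 * pi * real_of_int x / real q = of_int n * 2 * pi"
    by (auto simp: cos_one_2pi_int)
  then have "real_of_int x = of_int n * real q"
    using assms by (simp add: field_simps)
  then have "x = n * int q"
    by (metis of_int_eq_iff of_int_mult of_int_of_nat_eq)
  then show "int q dvd x" by simp
next
  assume "int q dvd x"
  then show "ez q x = 1" by (auto simp: ez_period elim!: dvdE)
qed

lemma sum_ez:
  assumes "q > 0"
  shows "(\<Sum>c\<in>Zq q. ez q (c * d)) = (if int q dvd d then of_nat q else 0)"
proof -
  have "Zq q = int ` {..<q}"
    by (auto simp: Zq_def image_iff intro!: bexI[of _ "nat _"])
  then have "(\<Sum>c\<in>Zq q. ez q (c * d)) = (\<Sum>i<q. ez q (int i * d))"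
    by (simp add: sum.reindex)
  also have "\<dots> = (\<Sum>i<q. ez q d ^ i)"
  proof (rule sum.cong)
    fix i assume "i \<in> {..<q}"
    show "ez q (int i * d) = ez q d ^ i"
      by (induction i) (auto simp: ez_add ring_distribs)
  qed simp
  also have "\<dots> = (if int q dvd d then of_nat q else 0)"
  proof (cases "int q dvd d")
    case True
    then show ?thesis using ez_eq_1_iff[OF assms, of d] by simp
  next
    case False
    then have ne: "ez q d \<noteq> 1" using ez_eq_1_iff[OF assms, of d] by simp
    have "ez q d ^ q = ez q (int q * d)"
    proof -
      have "ez q (int i * d) = ez q d ^ i" for i
        by (induction i) (auto simp: ez_add ring_distribs)
      then show ?thesis by simp
    qed
    then show ?thesis using False ne by (simp add: geometric_sum ez_period)
  qed
  finally show ?thesis .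
qed

section \<open>Residue matrices, their characters and the discrete Fourier transform\<close>

lemma finite_Zq [simp]: "finite (Zq q)" and card_Zq [simp]: "card (Zq q) = q"
  by (auto simp: Zq_def)

lemma finite_Zq_mat [simp]: "finite (Zq_mat q m k)"
  by (auto simp: Zq_mat_def intro!: finite_PiE)

lemma card_Zq_mat: "card (Zq_mat q m k) = q ^ (m * k)"
  by (simp add: Zq_mat_def card_PiE power_mult mult.commute)

lemma Zq_matD: "Z \<in> Zq_mat q m k \<Longrightarrow> j < m \<Longrightarrow> l < k \<Longrightarrow> Z j l \<in> Zq q"
  unfolding Zq_mat_def by (meson PiE_mem lessThan_iff)

lemma Zq_mat_eqI:
  assumes "A \<in> Zq_mat q m k" "B \<in> Zq_mat q m k"
    and "\<And>j l. j < m \<Longrightarrow> l < k \<Longrightarrow> int q dvd A j l - B j l"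
  shows "A = B"
proof (rule PiE_ext[of A "{..<m}" "\<lambda>_. {..<k} \<rightarrow>\<^sub>E Zq q"])
  fix j assume j: "j \<in> {..<m}"
  show "A j = B j"
  proof (rule PiE_ext[of _ "{..<k}" "\<lambda>_. Zq q"])
    fix l assume l: "l \<in> {..<k}"
    have "A j l \<in> Zq q" "B j l \<in> Zq q" using j l assms by (auto intro: Zq_matD)
    with assms(3)[of j l] j l show "A j l = B j l"
      unfolding Zq_def atLeastLessThan_iff by (metis lessThan_iff mod_eq_dvd_iff mod_pos_pos_trivial)
  qed (use assms j in \<open>auto simp: Zq_mat_def\<close>)
qed (use assms in \<open>auto simp: Zq_mat_def\<close>)

lemma restrict_mod_in_Zq_mat:
  assumes "q > 0"
  shows "(\<lambda>j\<in>{..<m}. \<lambda>l\<in>{..<k}. f j l mod int q) \<in> Zq_mat q m k"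
  using assms by (auto simp: Zq_mat_def Zq_def)

text \<open>Both arguments may be arbitrary integer matrices, as only residues matter. Objects such
  as \<open>adj\<close> can thus be formed over the integers and reduced later.\<close>

definition chr :: "nat \<Rightarrow> nat \<Rightarrow> nat \<Rightarrow> zmat \<Rightarrow> zmat \<Rightarrow> complex" where
  "chr q m k a Z = (\<Prod>j<m. \<Prod>l<k. ez q (a j l * Z j l))"

lemma chr_commute: "chr q m k a Z = chr q m k Z a"
  by (simp add: chr_def mult.commute)

lemma norm_chr [simp]: "cmod (chr q m k a Z) = 1"
  by (simp add: chr_def prod_norm[symmetric])

lemma chr_add: "chr q m k a (\<lambda>j l. Y j l + Z j l) = chr q m k a Y * chr q m k a Z"
  by (simp add: chr_def ez_add ring_distribs prod.distrib)

lemma cnj_chr: "cnj (chr q m k a Z) = chr q m k a (\<lambda>j l. - Z j l)"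
  by (simp add: chr_def cnj_ez)

lemma chr_cong:
  assumes "\<And>j l. j < m \<Longrightarrow> l < k \<Longrightarrow> int q dvd Y j l - Z j l"
  shows "chr q m k a Y = chr q m k a Z"
  unfolding chr_def using assms
  by (intro prod.cong refl ez_cong) (simp add: right_diff_distrib[symmetric])

text \<open>Orthogonality: the sum over matrices is a product of one geometric sum per entry, each
  of which is \<open>q\<close> or 0.\<close>

lemma sum_chr:
  assumes "q > 0"
  shows "(\<Sum>a\<in>Zq_mat q m k. chr q m k a D) =
    (if \<forall>j<m. \<forall>l<k. int q dvd D j l then of_nat (q ^ (m * k)) else 0)"
proof -
  have "(\<Sum>a\<in>Zq_mat q m k. chr q m k a D) =
      (\<Prod>j<m. \<Sum>r\<in>{..<k} \<rightarrow>\<^sub>E Zq q. \<Prod>l<k. ez q (r l * D j l))"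
    unfolding Zq_mat_def chr_def
    by (subst prod_sum_PiE) (auto intro!: finite_PiE)
  also have "\<dots> = (\<Prod>j<m. \<Prod>l<k. \<Sum>c\<in>Zq q. ez q (c * D j l))"
    by (subst prod_sum_PiE) auto
  also have "\<dots> = (\<Prod>j<m. \<Prod>l<k. if int q dvd D j l then of_nat q else 0)"
    using assms by (simp add: sum_ez)
  also have "\<dots> = (if \<forall>j<m. \<forall>l<k. int q dvd D j l then of_nat (q ^ (m * k)) else 0)"
  proof (cases "\<forall>j<m. \<forall>l<k. int q dvd D j l")
    case True
    then show ?thesis by (simp add: power_mult mult.commute)
  next
    case False
    then obtain j l where "j < m" "l < k" "\<not> int q dvd D j l" by blast
    then have "(\<Prod>l<k. if int q dvd D j l then of_nat q else (0::complex)) = 0"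
      by (intro prod_zero) auto
    with \<open>j < m\<close> have "(\<Prod>j<m. \<Prod>l<k. if int q dvd D j l then of_nat q else (0::complex)) = 0"
      by (intro prod_zero) blast+
    then show ?thesis unfolding if_not_P[OF False] .
  qed
  finally show ?thesis .
qed

lemma sum_chr_cnj:
  assumes "q > 0" "Y \<in> Zq_mat q m k" "Z \<in> Zq_mat q m k"
  shows "(\<Sum>a\<in>Zq_mat q m k. chr q m k a Y * cnj (chr q m k a Z)) =
    (if Y = Z then of_nat (q ^ (m * k)) else 0)"
proof -
  have "(\<Sum>a\<in>Zq_mat q m k. chr q m k a Y * cnj (chr q m k a Z)) =
      (\<Sum>a\<in>Zq_mat q m k. chr q m k a (\<lambda>j l. Y j l - Z j l))"
    by (simp add: cnj_chr chr_add[symmetric])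
  also have "\<dots> = (if \<forall>j<m. \<forall>l<k. int q dvd Y j l - Z j l then of_nat (q ^ (m * k)) else 0)"
    by (rule sum_chr) fact
  also have "(\<forall>j<m. \<forall>l<k. int q dvd Y j l - Z j l) \<longleftrightarrow> Y = Z"
    using Zq_mat_eqI[OF assms(2,3)] by auto
  finally show ?thesis .
qed

text \<open>The mean is taken on the side of \<open>Z\<close>, and frequencies carry counting
  measure: the coefficient at 0 is the mean of \<open>f\<close>, and L1 sums over frequencies need
  no normalisation.\<close>

definition ft :: "nat \<Rightarrow> nat \<Rightarrow> nat \<Rightarrow> (zmat \<Rightarrow> complex) \<Rightarrow> zmat \<Rightarrow> complex" where
  "ft q m k f a = (\<Sum>Z\<in>Zq_mat q m k. f Z * cnj (chr q m k a Z)) / of_nat (q ^ (m * k))"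

lemma ft_inversion:
  assumes "q > 0" "Z \<in> Zq_mat q m k"
  shows "f Z = (\<Sum>a\<in>Zq_mat q m k. ft q m k f a * chr q m k a Z)"
proof -
  have "(\<Sum>a\<in>Zq_mat q m k. ft q m k f a * chr q m k a Z) =
    (\<Sum>a\<in>Zq_mat q m k. \<Sum>Y\<in>Zq_mat q m k. f Y * (chr q m k a Z * cnj (chr q m k a Y))) / of_nat (q ^ (m * k))"
    unfolding ft_def times_divide_eq_left sum_distrib_right sum_divide_distrib[symmetric]
    by (intro arg_cong2[where f = "(/)"] sum.cong refl) (simp add: mult_ac)
  also have "\<dots> = (\<Sum>Y\<in>Zq_mat q m k. f Y * (\<Sum>a\<in>Zq_mat q m k. chr q m k a Z * cnj (chr q m k a Y))) / of_nat (q ^ (m * k))"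
    by (subst sum.swap) (simp add: sum_distrib_left)
  also have "\<dots> = (\<Sum>Y\<in>Zq_mat q m k. if Y = Z then f Y * of_nat (q ^ (m * k)) else 0) / of_nat (q ^ (m * k))"
    using assms by (intro arg_cong2[where f = "(/)"] sum.cong refl) (auto simp: sum_chr_cnj)
  also have "\<dots> = f Z" using assms by simp
  finally show ?thesis by simp
qed

lemma parseval:
  assumes "q > 0"
  shows "(\<Sum>a\<in>Zq_mat q m k. (cmod (ft q m k f a))\<^sup>2) =
    (\<Sum>Z\<in>Zq_mat q m k. (cmod (f Z))\<^sup>2) / real (q ^ (m * k))"
proof -
  let ?V = "Zq_mat q m k" and ?c = "chr q m k" and ?N = "of_nat (q ^ (m * k)) :: complex"
  have "complex_of_real (\<Sum>a\<in>?V. (cmod (ft q m k f a))\<^sup>2) = (\<Sum>a\<in>?V. ft q m k f a * cnj (ft q m k f a))"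
    by (simp add: complex_norm_square[symmetric])
  also have "\<dots> = (\<Sum>a\<in>?V. ft q m k f a * (\<Sum>Z\<in>?V. cnj (f Z) * ?c a Z)) / ?N"
    by (simp add: ft_def[of q m k f] sum_divide_distrib sum_distrib_left)
  also have "(\<Sum>a\<in>?V. ft q m k f a * (\<Sum>Z\<in>?V. cnj (f Z) * ?c a Z)) =
      (\<Sum>a\<in>?V. \<Sum>Z\<in>?V. cnj (f Z) * (ft q m k f a * ?c a Z))"
    by (simp add: sum_distrib_left mult_ac)
  also have "\<dots> = (\<Sum>Z\<in>?V. cnj (f Z) * (\<Sum>a\<in>?V. ft q m k f a * ?c a Z))"
    by (subst sum.swap) (simp add: sum_distrib_left)
  also have "\<dots> = (\<Sum>Z\<in>?V. cnj (f Z) * f Z)"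
    using assms by (intro sum.cong refl) (simp add: ft_inversion[symmetric])
  also have "\<dots> = (\<Sum>Z\<in>?V. complex_of_real ((cmod (f Z))\<^sup>2))"
    by (intro sum.cong refl) (simp only: complex_norm_square mult.commute)
  finally have "complex_of_real (\<Sum>a\<in>?V. (cmod (ft q m k f a))\<^sup>2) =
     complex_of_real ((\<Sum>Z\<in>?V. (cmod (f Z))\<^sup>2) / real (q ^ (m * k)))" by simp
  then show ?thesis by (simp only: of_real_eq_iff)
qed

lemma norm_ft_le:
  assumes "q > 0" "\<And>Z. Z \<in> Zq_mat q m k \<Longrightarrow> cmod (f Z) \<le> g Z"
  shows "cmod (ft q m k f a) \<le> (\<Sum>Z\<in>Zq_mat q m k. g Z) / real (q ^ (m * k))"
proof -
  have "cmod (\<Sum>Z\<in>Zq_mat q m k. f Z * cnj (chr q m k a Z)) \<le> (\<Sum>Z\<in>Zq_mat q m k. g Z)"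
    by (rule sum_norm_le) (simp add: norm_mult assms)
  then show ?thesis using assms(1) by (simp add: ft_def norm_divide norm_power divide_right_mono)
qed

subsection \<open>Covering a vertex set by a random hypermatching\<close>

text \<open>A weak form of Stirling's bound: a single term of the series of exp(r) is at most
  exp(r), and e is at most 3.\<close>

lemma power_self_le_fact: "real r ^ r \<le> 3 ^ r * fact r"
proof -
  have "real r ^ r /\<^sub>R fact r \<le> exp (real r)"
    unfolding exp_def
    by (rule order_trans[OF _ sum_le_suminf[OF summable_exp_generic, of "{r}"]]) auto
  also have "exp (real r) = exp 1 ^ r"
    by (simp add: exp_of_nat_mult[symmetric])
  also have "\<dots> \<le> 3 ^ r"
    by (rule power_mono) (use exp_le in auto)
  finally show ?thesis by (simp add: field_simps)
qed

section \<open>Prescribing entries of a random hypermatching\<close>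

lemma finite_PHM [simp]: "finite (PHM m k n)"
  unfolding PHM_def by (rule finite_subset[of _ "{..<m} \<rightarrow>\<^sub>E ({..<k} \<rightarrow>\<^sub>E {..<n})"])
    (auto intro!: finite_PiE)

lemma PHM_less: "M \<in> PHM m k n \<Longrightarrow> j < m \<Longrightarrow> l < k \<Longrightarrow> M j l < n"
  unfolding PHM_def by (auto dest!: PiE_mem)

lemma PHM_inj: "M \<in> PHM m k n \<Longrightarrow> l < k \<Longrightarrow> i < m \<Longrightarrow> j < m \<Longrightarrow> M i l = M j l \<longleftrightarrow> i = j"
  unfolding PHM_def by (auto dest: inj_onD)

lemma PHM_nonempty:
  assumes "m \<le> n"
  shows "PHM m k n \<noteq> {}"
proof -
  have "(\<lambda>j\<in>{..<m}. \<lambda>l\<in>{..<k}. j) \<in> PHM m k n"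
    using assms by (auto simp: PHM_def inj_on_def)
  then show ?thesis by blast
qed

text \<open>A switching argument that releases one constraint at a time. If \<open>v\<close> sits in
  its prescribed place, transposing \<open>v\<close> in that column with any \<open>v'\<close> that
  no remaining constraint of the column demands keeps the other constraints. There are at least n -
  m such \<open>v'\<close>, and the new matching shows \<open>v'\<close> in the released place, so
  the switch can be undone.\<close>

lemma card_PHM_constrained:
  fixes g :: "nat \<times> nat \<Rightarrow> nat" and lay :: "nat \<times> nat \<Rightarrow> nat"
  assumes "finite D" "\<And>x. x \<in> D \<Longrightarrow> g x < m \<and> lay x < k"
    and "inj_on (\<lambda>x. (fst x, lay x)) D" and "m \<le> n"
  shows "card {M \<in> PHM m k n. \<forall>x\<in>D. M (g x) (lay x) = fst x} * (n - m) ^ card D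
    \<le> card (PHM m k n)"
  using assms
proof (induction D rule: finite_induct)
  case empty
  then show ?case by simp
next
  case (insert x D)
  define A where "A = {M \<in> PHM m k n. \<forall>x\<in>insert x D. M (g x) (lay x) = fst x}"
  define B where "B = {M \<in> PHM m k n. \<forall>x\<in>D. M (g x) (lay x) = fst x}"
  define j l v where "j = g x" and "l = lay x" and "v = fst x"
  have jl: "j < m" "l < k" using insert.prems by (auto simp: j_def l_def)
  have fin: "finite A" "finite B" by (auto simp: A_def B_def)
  have "card A * (n - m) \<le> card B"
  proof (cases "A = {}")
    case False
    then obtain M0 where M0: "M0 \<in> A" by blast
    define F where "F = fst ` {y \<in> D. lay y = l}"
    define G where "G = {..<n} - F"
    have "F \<subseteq> (\<lambda>i. M0 i l) ` {..<m}"
      using M0 insert.prems by (force simp: F_def A_def)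
    then have "finite F" "card F \<le> m"
      using surj_card_le[of "{..<m}" F "\<lambda>i. M0 i l"] by (auto intro: finite_subset)
    have "n - m \<le> card G"
    proof -
      have "card {..<n} - card F \<le> card G"
        unfolding G_def by (rule diff_card_le_card_Diff) fact
      then show ?thesis using \<open>card F \<le> m\<close> by simp
    qed
    have vF: "v \<notin> F"
    proof
      assume "v \<in> F"
      then obtain y where y: "y \<in> D" "lay y = l" "fst y = v" by (auto simp: F_def)
      with insert.prems(2) have "y = x"
        by (auto simp: inj_on_def l_def v_def)
      with y insert.hyps show False by simp
    qed
    have vn: "v < n"
      using M0 jl PHM_less[of M0 m k n j l] by (auto simp: A_def j_def l_def v_def)
    \<comment> \<open>The transposition acts on the whole column \<open>l\<close>, which keeps the
      column injective; the guard \<open>i < m\<close> keeps the matrix extensional.\<close>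
    define \<tau> where "\<tau> = (\<lambda>(M :: hypermatching, v'). \<lambda>i l'.
      if i < m \<and> l' = l then Transposition.transpose v v' (M i l') else M i l')"
    have \<tau>_mem: "\<tau> (M, v') \<in> B" if "M \<in> A" "v' \<in> G" for M v'
    proof -
      have MP: "M \<in> PHM m k n" using that by (simp add: A_def)
      have "\<tau> (M, v') \<in> PHM m k n"
        unfolding PHM_def
      proof (rule CollectI, rule conjI)
        have ext: "M i = undefined" if "\<not> i < m" for i
          using MP that by (auto simp: PHM_def PiE_def extensional_def)
        have ext2: "M i l' = undefined" if "i < m" "\<not> l' < k" for i l'
          using MP that by (auto simp: PHM_def PiE_def extensional_def Pi_def)
        show "\<tau> (M, v') \<in> {..<m} \<rightarrow>\<^sub>E ({..<k} \<rightarrow>\<^sub>E {..<n})"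
        proof (rule PiE_I)
          fix i assume i: "i \<in> {..<m}"
          show "\<tau> (M, v') i \<in> {..<k} \<rightarrow>\<^sub>E {..<n}"
          proof (rule PiE_I)
            fix l' assume "l' \<in> {..<k}"
            then have "M i l' < n" using MP i by (auto intro: PHM_less)
            then show "\<tau> (M, v') i l' \<in> {..<n}"
              using vn \<open>v' \<in> G\<close> by (auto simp: \<tau>_def Transposition.transpose_def G_def)
          next
            fix l' assume "l' \<notin> {..<k}"
            then show "\<tau> (M, v') i l' = undefined"
              using ext2[of i l'] i jl by (auto simp: \<tau>_def)
          qed
        qed (auto simp: \<tau>_def ext)
        show "\<forall>l<k. inj_on (\<lambda>j. \<tau> (M, v') j l) {..<m}"
        proof (intro allI impI inj_onI)
          fix l' i i' assume "l' < k" "i \<in> {..<m}" "i' \<in> {..<m}" "\<tau> (M, v') i l' = \<tau> (M, v') i' l'"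
          then have "M i l' = M i' l'"
            by (auto simp: \<tau>_def dest: injD[OF Transposition.inj_transpose] split: if_splits)
          with PHM_inj[OF MP, of l' i i'] show "i = i'"
            using \<open>l' < k\<close> \<open>i \<in> _\<close> \<open>i' \<in> _\<close> by simp
        qed
      qed
      moreover have "\<tau> (M, v') (g y) (lay y) = fst y" if "y \<in> D" for y
      proof -
        have eq: "M (g y) (lay y) = fst y" using \<open>M \<in> A\<close> that by (auto simp: A_def)
        show ?thesis
        proof (cases "lay y = l")
          case True
          then have "fst y \<in> F" using that by (auto simp: F_def)
          then have "fst y \<noteq> v" "fst y \<noteq> v'" using vF \<open>v' \<in> G\<close> by (auto simp: G_def)
          then show ?thesis using eq by (auto simp: \<tau>_def)
        qed (use eq in \<open>auto simp: \<tau>_def\<close>)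
      qed
      ultimately show ?thesis by (auto simp: B_def)
    qed
    have "inj_on \<tau> (A \<times> G)"
    proof (rule inj_onI, clarsimp)
      fix M1 v1 M2 v2
      assume *: "M1 \<in> A" "M2 \<in> A" "\<tau> (M1, v1) = \<tau> (M2, v2)"
      have "M1 j l = v" "M2 j l = v" using * by (auto simp: A_def j_def l_def v_def)
      moreover have "\<tau> (M1, v1) j l = \<tau> (M2, v2) j l" using * by simp
      ultimately have v: "v1 = v2" using jl by (simp add: \<tau>_def)
      have "M1 i l' = M2 i l'" for i l'
      proof -
        have "\<tau> (M1, v1) i l' = \<tau> (M2, v2) i l'" using * by simp
        then show ?thesis unfolding v
          by (auto simp: \<tau>_def dest: injD[OF Transposition.inj_transpose] split: if_splits)
      qed
      with v show "M1 = M2 \<and> v1 = v2" by auto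
    qed
    then have "card (A \<times> G) \<le> card B"
      by (rule card_inj_on_le) (use \<tau>_mem fin in auto)
    then have "card A * card G \<le> card B" by (simp add: card_cartesian_product)
    with \<open>n - m \<le> card G\<close> show ?thesis
      by (meson le_trans mult_le_mono2)
  qed simp
  then have "card A * (n - m) * (n - m) ^ card D \<le> card B * (n - m) ^ card D"
    by (rule mult_le_mono1)
  also have "\<dots> \<le> card (PHM m k n)"
    unfolding B_def by (rule insert.IH) (use insert.prems in \<open>auto simp: inj_on_insert\<close>)
  finally show ?case
    using insert.hyps unfolding A_def by (simp add: mult_ac)
qed

text \<open>
  One-wise uniformity of the noise kills every frequency with a singleton row, so the vertex sets
  that a round can change are those whose members share their hyperedge with another member.
\<close>

definition paired :: "nat \<Rightarrow> nat \<Rightarrow> (nat \<Rightarrow> nat) \<Rightarrow> hypermatching \<Rightarrow> (nat \<times> nat) set \<Rightarrow> bool" where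
  "paired m k \<phi> M D \<longleftrightarrow>
     (\<forall>x\<in>D. \<exists>j<m. \<exists>l<k. \<exists>l'<k. l \<noteq> l' \<and> x = (M j l, \<phi> l) \<and> (M j l', \<phi> l') \<in> D)"

text \<open>Every such map takes its values in some set of exactly \<open>min r m\<close> rows, and
  a union bound over these sets gives the count. The minimum guarantees that sets of that size
  exist.\<close>

lemma card_maps_small_image:
  assumes "finite D"
  shows "card {g \<in> D \<rightarrow>\<^sub>E {..<m}. card (g ` D) \<le> r} \<le> (m choose min r m) * min r m ^ card D"
proof -
  define \<U> where "\<U> = {U. U \<subseteq> {..<m} \<and> card U = min r m}"
  have fin: "finite \<U>" by (simp add: \<U>_def)
  have "{g \<in> D \<rightarrow>\<^sub>E {..<m}. card (g ` D) \<le> r} \<subseteq> (\<Union>U\<in>\<U>. D \<rightarrow>\<^sub>E U)"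
  proof safe
    fix g assume g: "g \<in> D \<rightarrow>\<^sub>E {..<m}" "card (g ` D) \<le> r"
    have sub: "g ` D \<subseteq> {..<m}" using g by auto
    then have "card (g ` D) \<le> m" using card_mono[of "{..<m}" "g ` D"] by simp
    then obtain U where "g ` D \<subseteq> U" "U \<subseteq> {..<m}" "card U = min r m"
      using exists_subset_between[of "g ` D" "min r m" "{..<m}"] g sub by auto
    then show "g \<in> (\<Union>U\<in>\<U>. D \<rightarrow>\<^sub>E U)"
      using g by (auto simp: \<U>_def PiE_iff intro!: bexI[of _ U])
  qed
  then have "card {g \<in> D \<rightarrow>\<^sub>E {..<m}. card (g ` D) \<le> r} \<le> card (\<Union>U\<in>\<U>. D \<rightarrow>\<^sub>E U)"
    by (rule card_mono[rotated])
      (use fin assms in \<open>auto intro!: finite_PiE simp: \<U>_def intro: finite_subset\<close>)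
  also have "\<dots> \<le> (\<Sum>U\<in>\<U>. card (D \<rightarrow>\<^sub>E U))"
    by (rule card_UN_le) (rule fin)
  also have "\<dots> = (\<Sum>U\<in>\<U>. min r m ^ card D)"
    by (rule sum.cong) (auto simp: \<U>_def card_PiE assms)
  also have "\<dots> = (m choose min r m) * min r m ^ card D"
    by (simp add: \<U>_def n_subsets)
  finally show ?thesis .
qed

text \<open>The usual bound (3 m / r)^r on the binomial coefficient, in a form without division that
  covers r = 0.\<close>

lemma choose_power_le: "real (m choose r) * real r ^ r \<le> 3 ^ r * real m ^ r"
proof -
  have "real (m choose r) * real r ^ r \<le> real (m choose r) * (3 ^ r * fact r)"
    by (intro mult_left_mono power_self_le_fact) auto
  also have "\<dots> = 3 ^ r * real ((m choose r) * fact r)" by simp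
  also have "\<dots> \<le> 3 ^ r * real (m ^ r)"
    by (intro mult_left_mono, subst of_nat_le_iff) (auto intro: binomial_fact_pow)
  finally show ?thesis by simp
qed

text \<open>A hyperedge that meets a paired set \<open>D\<close> meets it at least twice, so the map
  from \<open>D\<close> to rows has at most card D / 2 values. A union bound over these maps, each
  realised with probability at most (n - m)^(- card D), leaves (m choose r) r^d / (n - m)^d with r
  at most d / 2, which is of order (d / n)^(d / 2).\<close>

lemma card_paired_le:
  assumes fin: "finite D" and inj: "inj_on \<phi> {..<k}" and mn: "2 * m \<le> n" "0 < n"
  shows "real (card {M \<in> PHM m k n. paired m k \<phi> M D}) \<le>
    real (card (PHM m k n)) * (4 * sqrt (real (card D) / real n)) ^ card D"
proof (cases "{M \<in> PHM m k n. paired m k \<phi> M D} = {}")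
  case False
  define lay where "lay x = inv_into {..<k} \<phi> (snd x)" for x :: "nat \<times> nat"
  have lay_eq: "lay (v, \<phi> l) = l" if "l < k" for v l
    using that inj by (simp add: lay_def)
  define r where "r = min (card D div 2) m"
  define \<G> where "\<G> = {g \<in> D \<rightarrow>\<^sub>E {..<m}. card (g ` D) \<le> card D div 2}"
  define C where "C g = {M \<in> PHM m k n. \<forall>x\<in>D. M (g x) (lay x) = fst x}" for g
  \<comment> \<open>The witness shows that every member of \<open>D\<close> lies in a layer of the
    range of \<open>\<phi>\<close>, so \<open>lay\<close> really inverts \<open>\<phi>\<close> on
    \<open>D\<close>.\<close>
  from False obtain M0 where M0: "M0 \<in> PHM m k n" "paired m k \<phi> M0 D" by blast
  have D: "lay x < k \<and> \<phi> (lay x) = snd x" if "x \<in> D" for x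
    using M0(2) that lay_eq unfolding paired_def by fastforce
  have inj2: "inj_on (\<lambda>x. (fst x, lay x)) D"
    by (rule inj_onI) (metis D prod.collapse prod.inject)
  have \<G>: "finite \<G>" "card \<G> \<le> (m choose r) * r ^ card D"
    using card_maps_small_image[OF fin, of m "card D div 2"] fin
    by (auto simp: \<G>_def r_def intro!: finite_PiE)
  have C: "card (C g) * (n - m) ^ card D \<le> card (PHM m k n)" if "g \<in> \<G>" for g
    unfolding C_def using that D inj2 mn
    by (intro card_PHM_constrained fin) (auto simp: \<G>_def PiE_iff)
  have "{M \<in> PHM m k n. paired m k \<phi> M D} \<subseteq> (\<Union>g\<in>\<G>. C g)"
  proof safe
    fix M assume M: "M \<in> PHM m k n" "paired m k \<phi> M D"
    have "\<forall>x\<in>D. \<exists>j. j < m \<and> M j (lay x) = fst x"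
      using M(2) lay_eq unfolding paired_def by fastforce
    then obtain g0 where g0: "\<And>x. x \<in> D \<Longrightarrow> g0 x < m \<and> M (g0 x) (lay x) = fst x"
      by metis
    define g where "g = restrict g0 D"
    have g: "g x < m" "M (g x) (lay x) = fst x" if "x \<in> D" for x
      using that g0 by (auto simp: g_def)
    \<comment> \<open>Columns are injective, so the row through a given vertex of a layer is
      unique.\<close>
    have grow: "g (M j l, \<phi> l) = j" if "(M j l, \<phi> l) \<in> D" "j < m" "l < k" for j l
      using g[OF that(1)] that PHM_inj[OF M(1), of l "g (M j l, \<phi> l)" j] by (simp add: lay_eq)
    have two: "2 \<le> card {x \<in> D. g x = j}" if "j \<in> g ` D" for j
    proof -
      from that obtain x where x: "x \<in> D" "j = g x" by auto
      from M(2) x obtain j' l l' where *: "j' < m" "l < k" "l' < k" "l \<noteq> l'"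
        "x = (M j' l, \<phi> l)" "(M j' l', \<phi> l') \<in> D"
        unfolding paired_def by blast
      then have "j' = j" using grow x by simp
      then have "{x, (M j' l', \<phi> l')} \<subseteq> {x \<in> D. g x = j}"
        using x * grow by auto
      moreover have "x \<noteq> (M j' l', \<phi> l')"
        using * inj by (auto dest: inj_onD)
      ultimately show ?thesis
        using card_mono[of "{x \<in> D. g x = j}" "{x, (M j' l', \<phi> l')}"] fin by simp
    qed
    have "card D = (\<Sum>j\<in>g ` D. card {x \<in> D. g x = j})"
      using sum.image_gen[OF fin, of "\<lambda>_. 1::nat" g] by simp
    also have "\<dots> \<ge> (\<Sum>j\<in>g ` D. 2)"
      by (rule sum_mono) (rule two)
    finally have "card (g ` D) \<le> card D div 2" by simp
    then have "g \<in> \<G>" using g by (auto simp: \<G>_def g_def)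
    moreover have "M \<in> C g" using M g by (auto simp: C_def)
    ultimately show "M \<in> (\<Union>g\<in>\<G>. C g)" by blast
  qed
  then have "card {M \<in> PHM m k n. paired m k \<phi> M D} \<le> card (\<Union>g\<in>\<G>. C g)"
    by (rule card_mono[rotated]) (use \<G> in \<open>auto simp: C_def\<close>)
  also have "\<dots> \<le> (\<Sum>g\<in>\<G>. card (C g))"
    by (rule card_UN_le) fact
  finally have "real (card {M \<in> PHM m k n. paired m k \<phi> M D}) * real (n - m) ^ card D
      \<le> real ((\<Sum>g\<in>\<G>. card (C g)) * (n - m) ^ card D)"
    by (simp add: mult_right_mono flip: of_nat_sum)
  also have "\<dots> \<le> real (card \<G> * card (PHM m k n))"
    unfolding of_nat_le_iff sum_distrib_right
    by (rule order_trans[OF sum_mono[OF C]]) auto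
  also have "\<dots> \<le> real (card (PHM m k n)) * (real (m choose r) * real r ^ card D)"
    using \<G>(2) by (simp add: mult.commute mult_left_mono flip: of_nat_mult of_nat_power)
  finally have main: "real (card {M \<in> PHM m k n. paired m k \<phi> M D}) * real (n - m) ^ card D
     \<le> real (card (PHM m k n)) * (real (m choose r) * real r ^ card D)" .
  define d where "d = card D"
  have r: "2 * r \<le> d" "r \<le> m" by (auto simp: r_def d_def)
  have "real (m choose r) * real r ^ d = (real (m choose r) * real r ^ r) * real r ^ (d - r)"
    using r by (simp flip: power_add)
  also have "\<dots> \<le> (3 ^ r * real m ^ r) * real r ^ (d - r)"
    by (intro mult_right_mono choose_power_le) auto
  also have "\<dots> \<le> (2 ^ d * real n ^ r) * real r ^ (d - r)"
  proof (intro mult_right_mono mult_mono power_mono)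
    have "(3::real) ^ r \<le> (2 ^ 2) ^ r" by (rule power_mono) auto
    also have "\<dots> = 2 ^ (2 * r)" by (simp add: power_mult)
    also have "\<dots> \<le> 2 ^ d" using r by (intro power_increasing) auto
    finally show "(3::real) ^ r \<le> 2 ^ d" .
  qed (use mn in auto)
  also have "\<dots> = 2 ^ d * real n ^ d * (real r / real n) ^ (d - r)"
    using r mn by (simp add: power_divide field_simps flip: power_add)
  \<comment> \<open>The exponent 2 (d - r) is at least d and the base is at most 1, so it may be
    lowered to d.\<close>
  also have "(real r / real n) ^ (d - r) = sqrt (real r / real n) ^ (2 * (d - r))"
    by (simp add: power_mult)
  also have "\<dots> \<le> sqrt (real r / real n) ^ d"
    using r mn by (intro power_decreasing) auto
  also have "\<dots> \<le> sqrt (real d / real n) ^ d"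
    using r mn by (intro power_mono real_sqrt_le_mono divide_right_mono) auto
  finally have A: "real (m choose r) * real r ^ d \<le> 2 ^ d * real n ^ d * sqrt (real d / real n) ^ d"
    by (simp add: mult_left_mono)
  \<comment> \<open>The constant 4 of the lemma is 2 * 2: one factor comes from 3^r \<le> 2^d above,
    the other from n \<le> 2 (n - m) here.\<close>
  have B: "real n ^ d \<le> 2 ^ d * real (n - m) ^ d"
    unfolding power_mult_distrib[symmetric] using mn by (intro power_mono) auto
  have "real (card {M \<in> PHM m k n. paired m k \<phi> M D}) * real (n - m) ^ d
     \<le> real (card (PHM m k n)) * (2 ^ d * (2 ^ d * real (n - m) ^ d) * sqrt (real d / real n) ^ d)"
    using main unfolding d_def[symmetric]
    by (rule order_trans) (intro mult_left_mono order_trans[OF A] mult_right_mono B, auto)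
  also have "\<dots> = (real (card (PHM m k n)) * (4 * sqrt (real d / real n)) ^ d) * real (n - m) ^ d"
    using power_mult_distrib[of "2::real" 2 d] by (simp add: power_mult_distrib mult_ac)
  finally show ?thesis
    using mn by (simp add: d_def)
next
  case True
  then show ?thesis unfolding True by simp
qed

text \<open>A paired set lies inside the k m cells of the hypermatching. Larger sets are never
  covered, so covering bounds have to be supplied only for sizes up to k m.\<close>

lemma paired_card_le:
  assumes "paired m k \<phi> M D"
  shows "card D \<le> k * m"
proof -
  have "D \<subseteq> (\<lambda>(j, l). (M j l, \<phi> l)) ` ({..<m} \<times> {..<k})"
    using assms unfolding paired_def by force
  then have "card D \<le> card ({..<m} \<times> {..<k})"
    by (rule surj_card_le[rotated]) auto
  then show ?thesis by (simp add: mult.commute)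
qed

subsection \<open>A level inequality for messages\<close>

text \<open>Jensen's inequality; an even exponent makes the power convex on the whole line.\<close>

lemma power_sum_le:
  fixes x :: "'a \<Rightarrow> real"
  assumes "finite I" "even p" "0 < p"
  shows "((\<Sum>i\<in>I. x i) / real (card I)) ^ p \<le> (\<Sum>i\<in>I. x i ^ p) / real (card I)"
proof (cases "I = {}")
  case False
  with assms have c: "real (card I) > 0" by (simp add: card_gt_0_iff)
  have "(\<Sum>i\<in>I. (1 / real (card I)) *\<^sub>R x i) ^ p \<le> (\<Sum>i\<in>I. (1 / real (card I)) * x i ^ p)"
    using assms False c by (intro convex_on_sum[OF _ _ convex_power_even]) (auto simp: field_simps)
  then show ?thesis by (simp add: sum_divide_distrib)
next
  case True
  then show ?thesis using assms by (simp add: zero_power)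
qed

text \<open>\<open>J\<close> is a set of rows on which the frequency is frozen, later the rows that
  touch the support of the current frequency on vertices. Only the other rows count.\<close>

definition off_rows :: "nat \<Rightarrow> nat \<Rightarrow> nat set \<Rightarrow> zmat \<Rightarrow> nat set" where
  "off_rows m k J a = {j. j < m \<and> j \<notin> J \<and> (\<exists>l<k. a j l \<noteq> 0)}"

lemma finite_off_rows [simp]: "finite (off_rows m k J a)"
  by (simp add: off_rows_def)

text \<open>With the rows of \<open>J\<close> prescribed, a frequency is determined by its
  \<open>r\<close> nonzero rows outside \<open>J\<close>: choose their places inside
  \<open>U\<close>, then fill each in one of q^k ways.\<close>

lemma card_rows_in_le:
  assumes "q > 0" "finite U" "S \<subseteq> Zq_mat q m k"
    and S: "\<And>a. a \<in> S \<Longrightarrow> (\<forall>j<m. j \<in> J \<longrightarrow> a j = a1 j) \<and> card (off_rows m k J a) = r"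
  shows "card {a \<in> S. off_rows m k J a \<subseteq> U} \<le> (card U choose r) * (q ^ k) ^ r"
proof -
  define \<R> where "\<R> = {R. R \<subseteq> U \<and> card R = r}"
  define C where "C R = {a \<in> S. off_rows m k J a = R}" for R
  have finS: "finite S" using assms(3) finite_Zq_mat finite_subset by blast
  have fin: "finite \<R>" using assms by (simp add: \<R>_def)
  have "card (C R) \<le> (q ^ k) ^ r" if "R \<in> \<R>" for R
  proof -
    have finR: "finite R" "card R = r" using that assms by (auto simp: \<R>_def intro: finite_subset)
    have "inj_on (\<lambda>a. restrict a R) (C R)"
    proof (rule inj_onI)
      fix a b assume ab: "a \<in> C R" "b \<in> C R" "restrict a R = restrict b R"
      then have V: "a \<in> Zq_mat q m k" "b \<in> Zq_mat q m k" using assms by (auto simp: C_def)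
      show "a = b"
      proof (rule Zq_mat_eqI[OF V])
        fix j l assume jl: "j < m" "l < k"
        have "a j l = b j l"
        proof (cases "j \<in> J")
          case True
          then show ?thesis using S[of a] S[of b] ab jl by (simp add: C_def)
        next
          case J: False
          show ?thesis
          proof (cases "j \<in> R")
            case True
            then show ?thesis using ab(3) by (metis restrict_apply')
          next
            case False
            then have "j \<notin> off_rows m k J a" "j \<notin> off_rows m k J b" using ab by (auto simp: C_def)
            then show ?thesis using J jl by (auto simp: off_rows_def)
          qed
        qed
        then show "int q dvd a j l - b j l" by simp
      qed
    qed
    moreover have "(\<lambda>a. restrict a R) ` C R \<subseteq> R \<rightarrow>\<^sub>E ({..<k} \<rightarrow>\<^sub>E Zq q)"
    proof (clarsimp simp: C_def)
      fix a i assume "a \<in> S" "i \<in> off_rows m k J a"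
      then show "a i \<in> {..<k} \<rightarrow>\<^sub>E Zq q"
        using assms(3) by (auto simp: Zq_mat_def off_rows_def)
    qed
    ultimately have "card (C R) \<le> card (R \<rightarrow>\<^sub>E ({..<k} \<rightarrow>\<^sub>E Zq q))"
      by (rule card_inj_on_le) (auto intro!: finite_PiE finR)
    then show ?thesis using finR by (simp add: card_PiE)
  qed
  note * = this
  have "{a \<in> S. off_rows m k J a \<subseteq> U} \<subseteq> (\<Union>R\<in>\<R>. C R)"
    using S by (auto simp: \<R>_def C_def)
  then have "card {a \<in> S. off_rows m k J a \<subseteq> U} \<le> card (\<Union>R\<in>\<R>. C R)"
    by (rule card_mono[rotated]) (use fin finS in \<open>auto simp: C_def\<close>)
  also have "\<dots> \<le> (\<Sum>R\<in>\<R>. card (C R))" by (rule card_UN_le) fact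
  also have "\<dots> \<le> (\<Sum>R\<in>\<R>. (q ^ k) ^ r)" by (rule sum_mono) (rule *)
  also have "\<dots> = (card U choose r) * (q ^ k) ^ r"
    using assms by (simp add: \<R>_def n_subsets)
  finally show ?thesis .
qed

text \<open>
  In a vanishing signed sum of \<open>2p\<close> vectors every row that is touched at all is touched twice,
  so that at most \<open>p r\<close> rows are touched.
\<close>

lemma card_vanishing_tuples_le:
  fixes \<epsilon> :: "nat \<Rightarrow> int"
  assumes q: "q > 0" and SV: "S \<subseteq> Zq_mat q m k"
    and S: "\<And>a. a \<in> S \<Longrightarrow> (\<forall>j<m. j \<in> J \<longrightarrow> a j = a1 j) \<and> card (off_rows m k J a) = r"
    and \<epsilon>: "\<And>i. \<bar>\<epsilon> i\<bar> = 1" and pr: "p * r \<le> m"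
  shows "card {c \<in> {..<2 * p} \<rightarrow>\<^sub>E S. \<forall>j<m. \<forall>l<k. int q dvd (\<Sum>i<2 * p. \<epsilon> i * c i j l)}
    \<le> (m choose (p * r)) * (((p * r) choose r) * (q ^ k) ^ r) ^ (2 * p)"
proof -
  define T where "T = {c \<in> {..<2 * p} \<rightarrow>\<^sub>E S. \<forall>j<m. \<forall>l<k. int q dvd (\<Sum>i<2 * p. \<epsilon> i * c i j l)}"
  define \<U> where "\<U> = {U. U \<subseteq> {..<m} \<and> card U = p * r}"
  define SU where "SU U = {a \<in> S. off_rows m k J a \<subseteq> U}" for U
  have finS: "finite S" using SV finite_Zq_mat finite_subset by blast
  have fin: "finite \<U>" by (simp add: \<U>_def)
  have "T \<subseteq> (\<Union>U\<in>\<U>. {..<2 * p} \<rightarrow>\<^sub>E SU U)"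
  proof
    fix c assume "c \<in> T"
    then have c: "c \<in> {..<2 * p} \<rightarrow>\<^sub>E S"
      and dvd: "\<And>j l. j < m \<Longrightarrow> l < k \<Longrightarrow> int q dvd (\<Sum>i<2 * p. \<epsilon> i * c i j l)"
      by (auto simp: T_def)
    define rows where "rows i = off_rows m k J (c i)" for i
    define R where "R = (\<Union>i<2 * p. rows i)"
    have cS: "c i \<in> S" if "i < 2 * p" for i using c that by auto
    have RJ: "R \<subseteq> {..<m}" by (auto simp: R_def rows_def off_rows_def)
    have "2 \<le> card {i \<in> {..<2 * p}. j \<in> rows i}" if "j \<in> R" for j
    proof (rule ccontr)
      assume "\<not> 2 \<le> card {i \<in> {..<2 * p}. j \<in> rows i}"
      moreover from \<open>j \<in> R\<close> obtain i0 where i0: "i0 < 2 * p" "j \<in> rows i0" by (auto simp: R_def)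
      ultimately have one: "{i \<in> {..<2 * p}. j \<in> rows i} = {i0}"
        by (intro card_seteq[symmetric]) (auto simp: not_le)
      from i0 obtain l where l: "j < m" "j \<notin> J" "l < k" "c i0 j l \<noteq> 0"
        by (auto simp: rows_def off_rows_def)
      have z: "c i j l = 0" if "i < 2 * p" "i \<noteq> i0" for i
      proof -
        have "j \<notin> rows i" using one that by auto
        then show ?thesis using l by (auto simp: rows_def off_rows_def)
      qed
      \<comment> \<open>A row touched once leaves a single term, so \<open>q\<close> would divide an
        entry strictly between 0 and \<open>q\<close>.\<close>
      have "(\<Sum>i<2 * p. \<epsilon> i * c i j l) = (\<Sum>i\<in>{i0}. \<epsilon> i * c i j l)"
        using i0 z by (intro sum.mono_neutral_right) auto
      then have "int q dvd \<epsilon> i0 * c i0 j l" using dvd[of j l] l by simp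
      then have "int q dvd c i0 j l"
        using \<epsilon>[of i0] by (metis abs_dvd_iff abs_mult dvd_abs_iff mult_1)
      moreover have "c i0 j l \<in> Zq q" using cS[OF i0(1)] SV l by (auto intro: Zq_matD)
      ultimately show False using l by (auto simp: Zq_def dest: zdvd_imp_le)
    qed
    \<comment> \<open>Incidences of touched rows with vectors are counted twice: at least two for
      each row, exactly \<open>r\<close> for each of the 2p vectors.\<close>
    then have "(\<Sum>j\<in>R. 2) \<le> (\<Sum>j\<in>R. card {i \<in> {..<2 * p}. j \<in> rows i})"
      by (rule sum_mono)
    also have "\<dots> = (\<Sum>i<2 * p. card {j \<in> R. j \<in> rows i})"
      by (rule sum_multicount_gen[symmetric]) (use RJ in \<open>auto intro: finite_subset\<close>)
    also have "\<dots> = (\<Sum>i<2 * p. r)"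
    proof (rule sum.cong)
      fix i assume "i \<in> {..<2 * p}"
      then have "{j \<in> R. j \<in> rows i} = rows i" by (auto simp: R_def)
      then show "card {j \<in> R. j \<in> rows i} = r" using S[of "c i"] cS \<open>i \<in> _\<close> by (simp add: rows_def)
    qed simp
    finally have "card R \<le> p * r" by simp
    then obtain U where U: "R \<subseteq> U" "U \<subseteq> {..<m}" "card U = p * r"
      using exists_subset_between[of R "p * r" "{..<m}"] RJ pr by auto
    then have "c \<in> {..<2 * p} \<rightarrow>\<^sub>E SU U"
      using c by (auto simp: SU_def PiE_iff R_def rows_def)
    with U show "c \<in> (\<Union>U\<in>\<U>. {..<2 * p} \<rightarrow>\<^sub>E SU U)" by (auto simp: \<U>_def)
  qed
  then have "card T \<le> card (\<Union>U\<in>\<U>. {..<2 * p} \<rightarrow>\<^sub>E SU U)"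
    by (rule card_mono[rotated]) (use fin finS in \<open>auto simp: SU_def intro!: finite_PiE\<close>)
  also have "\<dots> \<le> (\<Sum>U\<in>\<U>. card ({..<2 * p} \<rightarrow>\<^sub>E SU U))" by (rule card_UN_le) fact
  also have "\<dots> \<le> (\<Sum>U\<in>\<U>. (((p * r) choose r) * (q ^ k) ^ r) ^ (2 * p))"
  proof (rule sum_mono)
    fix U assume "U \<in> \<U>"
    then have "card (SU U) \<le> ((p * r) choose r) * (q ^ k) ^ r"
      using card_rows_in_le[OF q _ SV S, of U] unfolding SU_def \<U>_def
      by (auto intro: finite_subset)
    then show "card ({..<2 * p} \<rightarrow>\<^sub>E SU U) \<le> (((p * r) choose r) * (q ^ k) ^ r) ^ (2 * p)"
      by (simp add: card_PiE power_mono)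
  qed
  also have "\<dots> = (m choose (p * r)) * (((p * r) choose r) * (q ^ k) ^ r) ^ (2 * p)"
    by (simp add: \<U>_def n_subsets)
  finally show ?thesis unfolding T_def .
qed

lemma chr_sum:
  "chr q m k (\<lambda>j l. \<Sum>i\<in>I. f i j l) Z = (\<Prod>i\<in>I. chr q m k (f i) Z)"
  unfolding chr_def sum_distrib_right ez_sum
  by (simp only: prod.swap[where B = I])

text \<open>The 2p-th power of the modulus is p factors \<open>P\<close> times p factors of its
  conjugate. After expansion, averaging over \<open>Z\<close> keeps exactly the tuples whose signed
  sum vanishes modulo \<open>q\<close>, with coefficients of modulus at most 1. The first p signs
  are -1 because \<open>P\<close> contains conjugated characters.\<close>

lemma moment_le_vanishing_tuples:
  fixes p :: nat
  assumes q: "q > 0" and SV: "S \<subseteq> Zq_mat q m k" and \<xi>: "\<And>a. cmod (\<xi> a) \<le> 1"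
  defines "P \<equiv> \<lambda>Z. \<Sum>a\<in>S. \<xi> a * cnj (chr q m k a Z)"
  defines "\<epsilon> \<equiv> \<lambda>i. if i < p then - 1 else 1 :: int"
  shows "(\<Sum>Z\<in>Zq_mat q m k. cmod (P Z) ^ (2 * p)) / real (q ^ (m * k)) \<le>
    real (card {c \<in> {..<2 * p} \<rightarrow>\<^sub>E S. \<forall>j<m. \<forall>l<k. int q dvd (\<Sum>i<2 * p. \<epsilon> i * c i j l)})"
proof -
  let ?V = "Zq_mat q m k" and ?N = "of_nat (q ^ (m * k)) :: complex"
  define T where "T = {..<2 * p} \<rightarrow>\<^sub>E S"
  define cc where "cc c = (\<Prod>i<2 * p. if i < p then \<xi> (c i) else cnj (\<xi> (c i)))" for c
  have finS: "finite S" using SV finite_Zq_mat finite_subset by blast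
  then have finT: "finite T" by (auto simp: T_def intro!: finite_PiE)
  have expand: "complex_of_real (cmod (P Z) ^ (2 * p)) =
      (\<Sum>c\<in>T. cc c * chr q m k (\<lambda>j l. \<Sum>i<2 * p. \<epsilon> i * c i j l) Z)" for Z
  proof -
    have "complex_of_real (cmod (P Z) ^ (2 * p)) = (P Z * cnj (P Z)) ^ p"
      by (simp only: power_mult of_real_power[of _ p] complex_norm_square)
    also have "\<dots> = (\<Prod>i<2 * p. if i < p then P Z else cnj (P Z))"
    proof -
      have "{..<2 * p} = {..<p} \<union> {p..<2 * p}" by auto
      then show ?thesis by (simp add: prod.union_disjoint ivl_disj_int power_mult_distrib)
    qed
    also have "\<dots> = (\<Prod>i<2 * p. \<Sum>a\<in>S. if i < p then \<xi> a * cnj (chr q m k a Z) else cnj (\<xi> a) * chr q m k a Z)"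
      by (intro prod.cong) (auto simp: P_def)
    also have "\<dots> = (\<Sum>c\<in>T. \<Prod>i<2 * p. if i < p then \<xi> (c i) * cnj (chr q m k (c i) Z) else cnj (\<xi> (c i)) * chr q m k (c i) Z)"
      unfolding T_def using finS by (intro prod_sum_PiE) auto
    also have "\<dots> = (\<Sum>c\<in>T. cc c * (\<Prod>i<2 * p. chr q m k (\<lambda>j l. \<epsilon> i * c i j l) Z))"
      unfolding cc_def prod.distrib[symmetric]
      by (intro sum.cong prod.cong) (auto simp: \<epsilon>_def chr_def cnj_ez)
    finally show ?thesis by (simp add: chr_sum)
  qed
  have "complex_of_real ((\<Sum>Z\<in>?V. cmod (P Z) ^ (2 * p)) / real (q ^ (m * k))) =
     (\<Sum>Z\<in>?V. \<Sum>c\<in>T. cc c * chr q m k (\<lambda>j l. \<Sum>i<2 * p. \<epsilon> i * c i j l) Z) / ?N"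
    by (simp flip: expand)
  also have "\<dots> = (\<Sum>c\<in>T. cc c * (\<Sum>Z\<in>?V. chr q m k Z (\<lambda>j l. \<Sum>i<2 * p. \<epsilon> i * c i j l))) / ?N"
    by (subst sum.swap) (simp add: sum_distrib_left chr_commute)
  also have "\<dots> = (\<Sum>c\<in>T. if \<forall>j<m. \<forall>l<k. int q dvd (\<Sum>i<2 * p. \<epsilon> i * c i j l) then cc c else 0)"
    unfolding sum_divide_distrib using q by (intro sum.cong) (auto simp: sum_chr)
  also have "\<dots> = (\<Sum>c\<in>{c \<in> T. \<forall>j<m. \<forall>l<k. int q dvd (\<Sum>i<2 * p. \<epsilon> i * c i j l)}. cc c)"
    by (rule sum.inter_filter[symmetric]) (rule finT)
  finally have "(\<Sum>Z\<in>?V. cmod (P Z) ^ (2 * p)) / real (q ^ (m * k)) =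
      cmod (\<Sum>c\<in>{c \<in> T. \<forall>j<m. \<forall>l<k. int q dvd (\<Sum>i<2 * p. \<epsilon> i * c i j l)}. cc c)"
    by (metis (no_types, lifting) norm_of_real abs_of_nonneg divide_nonneg_nonneg norm_ge_zero of_nat_0_le_iff sum_nonneg zero_le_power)
  also have "\<dots> \<le> (\<Sum>c\<in>{c \<in> T. \<forall>j<m. \<forall>l<k. int q dvd (\<Sum>i<2 * p. \<epsilon> i * c i j l)}. 1)"
    unfolding cc_def using \<xi> by (intro sum_norm_le) (auto simp: prod_norm[symmetric] intro!: prod_le_1)
  finally show ?thesis by (simp add: T_def)
qed

definition msg_ft :: "nat \<Rightarrow> nat \<Rightarrow> nat \<Rightarrow> (zmat \<Rightarrow> 'w) \<Rightarrow> 'w \<Rightarrow> zmat \<Rightarrow> complex" where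
  "msg_ft q m k h w a = ft q m k (\<lambda>Z. if h Z = w then 1 else 0) a"

text \<open>After each coefficient is multiplied by its conjugate phase, the double sum is the mean
  over \<open>Z\<close> of one polynomial \<open>P (h Z) Z\<close>, since each \<open>Z\<close>
  sends a single message. Its 2p-th moment is at most the sum of the moments over all messages, and
  the root reduces the factor card W \<le> 2^(p r) to 2^(r / 2).\<close>

lemma level_inequality:
  fixes h :: "zmat \<Rightarrow> 'w"
  assumes q: "q > 0" and SV: "S \<subseteq> Zq_mat q m k"
    and S: "\<And>a. a \<in> S \<Longrightarrow> (\<forall>j<m. j \<in> J \<longrightarrow> a j = a1 j) \<and> card (off_rows m k J a) = r"
    and W: "finite W" "\<And>Z. Z \<in> Zq_mat q m k \<Longrightarrow> h Z \<in> W" "card W \<le> 2 ^ (p * r)"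
    and pr: "p * r \<le> m" "0 < p" "0 < r"
  shows "(\<Sum>a\<in>S. \<Sum>w\<in>W. cmod (msg_ft q m k h w a)) \<le>
    sqrt (54 * real (q ^ k) ^ 2 * real m * real p / real r) ^ r"
proof -
  let ?V = "Zq_mat q m k" and ?N = "real (q ^ (m * k))"
  define \<xi> where "\<xi> w a = cnj (sgn (msg_ft q m k h w a))" for w a
  define P where "P w Z = (\<Sum>a\<in>S. \<xi> w a * cnj (chr q m k a Z))" for w Z
  define \<epsilon> where "\<epsilon> i = (if i < p then - 1 else 1 :: int)" for i
  define Tn where "Tn = card {c \<in> {..<2 * p} \<rightarrow>\<^sub>E S. \<forall>j<m. \<forall>l<k. int q dvd (\<Sum>i<2 * p. \<epsilon> i * c i j l)}"
  have \<xi>: "cmod (\<xi> w a) \<le> 1" for w a by (simp add: \<xi>_def norm_sgn)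
  have phase: "complex_of_real (cmod z) = cnj (sgn z) * z" for z
  proof (cases "z = 0")
    case False
    have "cnj (sgn z) * z = (z * cnj z) / of_real (cmod z)"
      by (simp add: sgn_div_norm scaleR_conv_of_real field_simps)
    then show ?thesis using False
      by (simp add: complex_norm_square[symmetric] power2_eq_square)
  qed simp
  have "complex_of_real (\<Sum>a\<in>S. \<Sum>w\<in>W. cmod (msg_ft q m k h w a)) =
      (\<Sum>a\<in>S. \<Sum>w\<in>W. \<xi> w a * msg_ft q m k h w a)"
    by (simp add: phase \<xi>_def)
  also have "\<dots> = (\<Sum>a\<in>S. \<Sum>w\<in>W. \<Sum>Z\<in>?V. if h Z = w then \<xi> w a * cnj (chr q m k a Z) else 0) / of_nat (q ^ (m * k))"
    unfolding msg_ft_def ft_def sum_distrib_left sum_divide_distrib times_divide_eq_right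
    by (intro sum.cong refl) auto
  also have "(\<Sum>a\<in>S. \<Sum>w\<in>W. \<Sum>Z\<in>?V. if h Z = w then \<xi> w a * cnj (chr q m k a Z) else 0) =
      (\<Sum>Z\<in>?V. \<Sum>a\<in>S. \<Sum>w\<in>W. if h Z = w then \<xi> w a * cnj (chr q m k a Z) else 0)"
    by (simp only: sum.swap[where B = "?V"])
  \<comment> \<open>Only the message actually sent on \<open>Z\<close> survives in the inner
    sum.\<close>
  also have "\<dots> = (\<Sum>Z\<in>?V. P (h Z) Z)"
    unfolding P_def using W by (intro sum.cong refl) simp
  finally have "(\<Sum>a\<in>S. \<Sum>w\<in>W. cmod (msg_ft q m k h w a)) = cmod ((\<Sum>Z\<in>?V. P (h Z) Z) / of_nat (q ^ (m * k)))"
    by (metis (no_types, lifting) norm_of_real abs_of_nonneg norm_ge_zero sum_nonneg)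
  also have "\<dots> \<le> (\<Sum>Z\<in>?V. cmod (P (h Z) Z)) / ?N"
    by (simp add: norm_divide norm_power divide_right_mono sum_norm_le)
  finally have 1: "(\<Sum>a\<in>S. \<Sum>w\<in>W. cmod (msg_ft q m k h w a)) \<le> (\<Sum>Z\<in>?V. cmod (P (h Z) Z)) / ?N" .
  have "(\<Sum>a\<in>S. \<Sum>w\<in>W. cmod (msg_ft q m k h w a)) ^ (2 * p) \<le> ((\<Sum>Z\<in>?V. cmod (P (h Z) Z)) / ?N) ^ (2 * p)"
    by (intro power_mono 1 sum_nonneg) auto
  also have "\<dots> \<le> (\<Sum>Z\<in>?V. cmod (P (h Z) Z) ^ (2 * p)) / ?N"
    using power_sum_le[of ?V "2 * p" "\<lambda>Z. cmod (P (h Z) Z)"] pr by (simp add: card_Zq_mat)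
  \<comment> \<open>The polynomial depends on \<open>Z\<close> through the message; adding the terms
    of all other messages removes this dependence.\<close>
  also have "\<dots> \<le> (\<Sum>Z\<in>?V. \<Sum>w\<in>W. cmod (P w Z) ^ (2 * p)) / ?N"
    using W by (intro divide_right_mono sum_mono member_le_sum) auto
  also have "\<dots> = (\<Sum>w\<in>W. (\<Sum>Z\<in>?V. cmod (P w Z) ^ (2 * p)) / ?N)"
    by (subst sum.swap) (simp add: sum_divide_distrib)
  also have "\<dots> \<le> (\<Sum>w\<in>W. real Tn)"
    unfolding P_def Tn_def \<epsilon>_def by (intro sum_mono moment_le_vanishing_tuples q SV \<xi>)
  also have "\<dots> = real (card W * Tn)" by simp
  also have "\<dots> \<le> 2 ^ (p * r) * real ((m choose (p * r)) * (((p * r) choose r) * (q ^ k) ^ r) ^ (2 * p))"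
  proof -
    have "card W * Tn \<le> 2 ^ (p * r) * ((m choose (p * r)) * (((p * r) choose r) * (q ^ k) ^ r) ^ (2 * p))"
      unfolding Tn_def using card_vanishing_tuples_le[OF q SV S, of \<epsilon> p] W pr
      by (intro mult_le_mono) (auto simp: \<epsilon>_def)
    then show ?thesis by (metis of_nat_le_iff of_nat_mult of_nat_power of_nat_numeral)
  qed
  \<comment> \<open>The constant 54 is 2 * 3 * 9: from the number of messages, from the choice of
    the p r rows, and from the square of the bound 3 p for the rows of one vector.\<close>
  also have "\<dots> \<le> (2 * (3 * real m / real (p * r)) * (3 * real p * real (q ^ k)) ^ 2) ^ (p * r)"
  proof -
    have a: "real (m choose (p * r)) \<le> (3 * real m / real (p * r)) ^ (p * r)"
      using choose_power_le[of m "p * r"] pr by (simp add: power_divide power_mult_distrib field_simps)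
    have "real ((p * r) choose r) * real r ^ r \<le> (3 * real p) ^ r * real r ^ r"
      using choose_power_le[of "p * r" r] by (simp add: power_mult_distrib mult_ac)
    then have b: "real ((p * r) choose r) \<le> (3 * real p) ^ r" using pr by simp
    have "real ((m choose (p * r)) * (((p * r) choose r) * (q ^ k) ^ r) ^ (2 * p)) =
        real (m choose (p * r)) * (real ((p * r) choose r) * real (q ^ k) ^ r) ^ (2 * p)" by simp
    also have "\<dots> \<le> (3 * real m / real (p * r)) ^ (p * r) * ((3 * real p) ^ r * real (q ^ k) ^ r) ^ (2 * p)"
      by (intro mult_mono a power_mono b) auto
    also have "((3 * real p) ^ r * real (q ^ k) ^ r) ^ (2 * p) = ((3 * real p * real (q ^ k)) ^ 2) ^ (p * r)"
      by (simp only: power_mult_distrib[symmetric] power_mult[symmetric]) (simp add: mult_ac)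
    finally have "2 ^ (p * r) * real ((m choose (p * r)) * (((p * r) choose r) * (q ^ k) ^ r) ^ (2 * p))
        \<le> 2 ^ (p * r) * ((3 * real m / real (p * r)) ^ (p * r) * ((3 * real p * real (q ^ k)) ^ 2) ^ (p * r))"
      by (rule mult_left_mono) simp
    then show ?thesis by (simp only: power_mult_distrib[symmetric] mult.assoc)
  qed
  also have "2 * (3 * real m / real (p * r)) * (3 * real p * real (q ^ k)) ^ 2 =
      54 * real (q ^ k) ^ 2 * real m * real p / real r"
    using pr by (simp add: field_simps power2_eq_square)
  also have "(54 * real (q ^ k) ^ 2 * real m * real p / real r) ^ (p * r) =
      (sqrt (54 * real (q ^ k) ^ 2 * real m * real p / real r) ^ 2) ^ (p * r)"
    by (subst real_sqrt_pow2) auto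
  also have "\<dots> = (sqrt (54 * real (q ^ k) ^ 2 * real m * real p / real r) ^ r) ^ (2 * p)"
    by (simp only: power_mult[symmetric] mult_ac)
  finally show ?thesis
    using pr by (subst (asm) power_mono_iff) (auto intro!: sum_nonneg)
qed

section \<open>From rows to weights: the level inequality per number of nonzero entries\<close>

definition supp :: "nat \<Rightarrow> nat \<Rightarrow> zmat \<Rightarrow> (nat \<times> nat) set" where
  "supp m k s = {(j, l). j < m \<and> l < k \<and> s j l \<noteq> 0}"

lemma finite_supp [simp]: "finite (supp m k s)"
  by (rule finite_subset[of _ "{..<m} \<times> {..<k}"]) (auto simp: supp_def)

definition no_singleton_row :: "nat \<Rightarrow> nat \<Rightarrow> zmat \<Rightarrow> bool" where
  "no_singleton_row m k a \<longleftrightarrow>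
     (\<forall>j<m. \<forall>l<k. a j l \<noteq> 0 \<longrightarrow> (\<exists>l'<k. l' \<noteq> l \<and> a j l' \<noteq> 0))"

definition off_supp :: "nat \<Rightarrow> nat \<Rightarrow> nat set \<Rightarrow> zmat \<Rightarrow> (nat \<times> nat) set" where
  "off_supp m k J a = {(j, l). j < m \<and> l < k \<and> j \<notin> J \<and> a j l \<noteq> 0}"

lemma finite_off_supp [simp]: "finite (off_supp m k J a)"
  by (rule finite_subset[of _ "{..<m} \<times> {..<k}"]) (auto simp: off_supp_def)

text \<open>Without singleton rows a nonzero row carries at least two nonzero entries. This halving
  produces the exponent w / 2 of the envelope.\<close>

lemma card_off_rows_le:
  assumes "no_singleton_row m k a"
  shows "2 * card (off_rows m k J a) \<le> card (off_supp m k J a)"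
proof -
  have "off_supp m k J a = (SIGMA j:off_rows m k J a. {l. l < k \<and> a j l \<noteq> 0})"
    by (auto simp: off_supp_def off_rows_def)
  then have "card (off_supp m k J a) = (\<Sum>j\<in>off_rows m k J a. card {l. l < k \<and> a j l \<noteq> 0})"
    by simp
  also have "\<dots> \<ge> (\<Sum>j\<in>off_rows m k J a. 2)"
  proof (rule sum_mono)
    fix j assume "j \<in> off_rows m k J a"
    then obtain l where l: "j < m" "l < k" "a j l \<noteq> 0" by (auto simp: off_rows_def)
    with assms obtain l' where "l' < k" "l' \<noteq> l" "a j l' \<noteq> 0"
      unfolding no_singleton_row_def by blast
    then show "2 \<le> card {l. l < k \<and> a j l \<noteq> 0}"
      using l card_mono[of "{l. l < k \<and> a j l \<noteq> 0}" "{l, l'}"] by auto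
  qed
  finally show ?thesis by simp
qed

lemma card_off_supp_eq_0: "card (off_supp m k J a) = 0 \<longleftrightarrow> off_rows m k J a = {}"
  using finite_off_supp[of m k J a] unfolding card_eq_0_iff
  by (auto simp: off_supp_def off_rows_def)

text \<open>A coefficient of an indicator is at most the density of its set, and the message classes
  partition the matrices.\<close>

lemma sum_msg_ft_le_1:
  assumes "q > 0" "finite W" "\<And>Z. Z \<in> Zq_mat q m k \<Longrightarrow> h Z \<in> W"
  shows "(\<Sum>w\<in>W. cmod (msg_ft q m k h w a)) \<le> 1"
proof -
  have "(\<Sum>w\<in>W. cmod (msg_ft q m k h w a)) \<le>
      (\<Sum>w\<in>W. (\<Sum>Z\<in>Zq_mat q m k. if h Z = w then 1 else 0) / real (q ^ (m * k)))"
    unfolding msg_ft_def by (intro sum_mono norm_ft_le assms) auto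
  also have "\<dots> = (\<Sum>Z\<in>Zq_mat q m k. \<Sum>w\<in>W. if h Z = w then 1 else 0) / real (q ^ (m * k))"
    by (subst sum.swap) (simp add: sum_divide_distrib)
  also have "\<dots> = (\<Sum>Z\<in>Zq_mat q m k. 1) / real (q ^ (m * k))"
    using assms by (intro arg_cong2[where f = "(/)"] sum.cong) auto
  also have "\<dots> = 1" using assms by (simp add: card_Zq_mat)
  finally show ?thesis .
qed

text \<open>
  With \<open>x = \<theta> n\<close> this is \<open>(\<theta> n / w)\<^bsup>w/2\<^esup>\<close> up to a factor \<open>2\<^bsup>O(w)\<^esup>\<close>, the \<open>L\<^sup>1\<close> form of the level
  inequality for a message of linear length about a matching; the factorial makes convolutions of
  envelopes binomial sums.
\<close>

definition envelope :: "real \<Rightarrow> nat \<Rightarrow> real" where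
  "envelope x w = sqrt (x ^ w / fact w)"

text \<open>Consecutive terms have ratio x / (s + 1), which is at least 1 as long as s + 1 does not
  exceed x.\<close>

lemma power_div_fact_mono:
  fixes x :: real
  assumes "r \<le> s" "real s \<le> x"
  shows "x ^ r / fact r \<le> x ^ s / fact s"
  using assms
proof (induction s rule: dec_induct)
  case (step s)
  have "x ^ r / fact r \<le> x ^ s / fact s" using step by simp
  also have "\<dots> = x ^ s * real (Suc s) / (fact s * real (Suc s))" by simp
  also have "\<dots> \<le> x ^ s * x / (fact s * real (Suc s))"
    using step by (intro divide_right_mono mult_left_mono) auto
  also have "\<dots> = x ^ Suc s / fact (Suc s)" by (simp add: mult_ac)
  finally show ?case .
qed simp

text \<open>Passage from a count of rows to a count of entries: (2 h)! \<le> 4^h (h!)^2 turns the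
  square of x^h / h! into a term of index 2 h, and a second 4^h absorbs the factor \<open>h\<close>,
  the number of possible row counts.\<close>

lemma half_level_le_envelope:
  assumes "real v \<le> x" "h = v div 2"
  shows "real h * (x ^ h / fact h) \<le> envelope (4 * x) v"
proof -
  have x0: "0 \<le> x" using assms by (rule_tac order_trans[of _ "real v"]) auto
  have f: "(fact (2 * h) :: real) \<le> 4 ^ h * (fact h)\<^sup>2"
  proof -
    have "fact h * fact h * (2 * h choose h) = (fact (2 * h) :: nat)"
      using binomial_fact_lemma[of h "2 * h"] by (simp add: mult_2)
    then have "(fact (2 * h) :: nat) \<le> fact h * fact h * 2 ^ (2 * h)"
      by (metis binomial_le_pow2 mult_le_mono2)
    then have "real (fact (2 * h)) \<le> real (fact h * fact h * 2 ^ (2 * h))"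
      by (simp only: of_nat_le_iff)
    moreover have "(2::real) ^ (2 * h) = 4 ^ h" by (simp add: power_mult)
    ultimately show ?thesis by (simp add: power2_eq_square mult_ac)
  qed
  have h2: "(real h)\<^sup>2 \<le> 4 ^ h"
  proof -
    have "real h \<le> 2 ^ h" by (simp add: less_imp_le)
    then have "(real h)\<^sup>2 \<le> (2 ^ h)\<^sup>2" by (intro power_mono) auto
    also have "\<dots> = (4::real) ^ h" by (simp add: power_mult[symmetric] mult.commute[of h] power_mult[of 2 2 h])
    finally show ?thesis .
  qed
  have "(real h * (x ^ h / fact h))\<^sup>2 = (real h)\<^sup>2 * (x ^ (2 * h) / (fact h)\<^sup>2)"
    by (simp add: power_mult_distrib power_divide power_mult[symmetric] mult.commute)
  also have "\<dots> \<le> 4 ^ h * (x ^ (2 * h) / (fact h)\<^sup>2)"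
    using h2 x0 by (intro mult_right_mono) auto
  also have "\<dots> \<le> 4 ^ h * (4 ^ h * x ^ (2 * h) / fact (2 * h))"
  proof (rule mult_left_mono)
    have "x ^ (2 * h) / (fact h)\<^sup>2 = 4 ^ h * x ^ (2 * h) / (4 ^ h * (fact h)\<^sup>2)" by simp
    also have "\<dots> \<le> 4 ^ h * x ^ (2 * h) / fact (2 * h)"
      using f x0 by (intro divide_left_mono) auto
    finally show "x ^ (2 * h) / (fact h)\<^sup>2 \<le> 4 ^ h * x ^ (2 * h) / fact (2 * h)" .
  qed simp
  also have "\<dots> = (4 * x) ^ (2 * h) / fact (2 * h)"
  proof -
    have "(4::real) ^ (2 * h) = 4 ^ h * 4 ^ h" by (simp add: mult_2 power_add)
    then show ?thesis by (simp add: power_mult_distrib)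
  qed
  \<comment> \<open>For odd \<open>v\<close> the index 2 h is v - 1, and monotonicity of the terms
    closes the gap.\<close>
  also have "\<dots> \<le> (4 * x) ^ v / fact v"
    using assms x0 by (intro power_div_fact_mono) auto
  finally show ?thesis unfolding envelope_def by (rule real_le_rsqrt)
qed

text \<open>For positive \<open>v\<close> the number r of nonzero rows outside \<open>J\<close> lies
  between 1 and v / 2. The level inequality is applied for each r, with a moment p that depends on r
  so that p r is close to \<open>c\<close>.\<close>

lemma level_weight_le:
  fixes h :: "zmat \<Rightarrow> 'w" and J :: "nat set" and a1 :: zmat
  assumes q: "q > 0"
    and W: "finite W" "\<And>Z. Z \<in> Zq_mat q m k \<Longrightarrow> h Z \<in> W" "card W \<le> 2 ^ c"
    and c: "v \<le> c" "2 * c \<le> m"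
    and x: "x = sqrt (108 * real (q ^ k) ^ 2 * real m * real c)"
  defines "S \<equiv> {a \<in> Zq_mat q m k. (\<forall>j<m. j \<in> J \<longrightarrow> a j = a1 j) \<and> no_singleton_row m k a \<and>
                  card (off_supp m k J a) = v}"
  shows "(\<Sum>a\<in>S. \<Sum>w\<in>W. cmod (msg_ft q m k h w a)) \<le> envelope (4 * x) v"
proof (cases "v = 0")
  case True
  \<comment> \<open>At level 0 the rows of \<open>J\<close> are prescribed and all others vanish, so
    at most one frequency remains.\<close>
  have "card {a \<in> S. off_rows m k J a \<subseteq> {}} \<le> (card ({} :: nat set) choose 0) * (q ^ k) ^ 0"
    by (rule card_rows_in_le[where J = J and ?a1.0 = a1 and m = m])
      (use q True in \<open>auto simp: S_def card_off_supp_eq_0 simp del: card_eq_0_iff\<close>)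
  moreover have "{a \<in> S. off_rows m k J a \<subseteq> {}} = S"
    using True by (auto simp: S_def card_off_supp_eq_0 simp del: card_eq_0_iff)
  ultimately have S1: "card S \<le> 1" by simp
  have "(\<Sum>a\<in>S. \<Sum>w\<in>W. cmod (msg_ft q m k h w a)) \<le> (\<Sum>a\<in>S. 1)"
    by (intro sum_mono sum_msg_ft_le_1 q W)
  also have "\<dots> \<le> 1" using S1 by simp
  finally show ?thesis using True by (simp add: envelope_def)
next
  case False
  define H where "H = v div 2"
  have finS: "finite S" by (simp add: S_def)
  have Q1: "1 \<le> real (q ^ k)" using q by (simp add: Suc_leI)
  have cx: "real c \<le> x"
  proof -
    have "(real c)\<^sup>2 \<le> 108 * 1 * real m * real c"
      using c by (simp add: power2_eq_square mult_right_mono)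
    also have "\<dots> \<le> 108 * real (q ^ k) ^ 2 * real m * real c"
      using Q1 by (intro mult_right_mono mult_left_mono) auto
    finally show ?thesis unfolding x by (rule real_le_rsqrt)
  qed
  have x0: "0 \<le> x" using cx by linarith
  have bound: "(\<Sum>a\<in>{a \<in> S. card (off_rows m k J a) = r}. \<Sum>w\<in>W. cmod (msg_ft q m k h w a)) \<le> x ^ H / fact H"
    if r: "r \<in> {1..H}" for r
  proof -
    \<comment> \<open>The ceiling of c / r: the least p with c \<le> p r, so that 2^(p r) bounds the
      number of messages, while p r < 2 c \<le> m leaves room for p r rows.\<close>
    define p where "p = (c + r - 1) div r"
    have rc: "0 < r" "r \<le> c" using r c by (auto simp: H_def)
    have p1: "p * r \<le> c + r - 1" unfolding p_def by (rule div_times_less_eq_dividend)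
    have p2: "c \<le> p * r"
    proof -
      have "c + r - 1 < p * r + r"
        using mod_less_divisor[OF rc(1), of "c + r - 1"] div_mult_mod_eq[of "c + r - 1" r]
        unfolding p_def by linarith
      then show ?thesis using rc by linarith
    qed
    have p0: "0 < p" using p2 rc by (cases p) auto
    have "p * r \<le> m" using p1 rc c by linarith
    moreover have "card W \<le> 2 ^ (p * r)"
      using W(3) p2 by (meson le_trans one_le_numeral power_increasing)
    ultimately have "(\<Sum>a\<in>{a \<in> S. card (off_rows m k J a) = r}. \<Sum>w\<in>W. cmod (msg_ft q m k h w a))
        \<le> sqrt (54 * real (q ^ k) ^ 2 * real m * real p / real r) ^ r"
      by (intro level_inequality[where J = J and ?a1.0 = a1] q W p0 rc) (auto simp: S_def)
    also have "\<dots> \<le> (x / real r) ^ r"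
    proof (rule power_mono)
      have "real p * real r \<le> 2 * real c"
      proof -
        have "p * r \<le> 2 * c" using p1 rc by linarith
        then show ?thesis by (metis of_nat_le_iff of_nat_mult of_nat_numeral)
      qed
      \<comment> \<open>The estimate p r \<le> 2 c doubles 54 to the constant 108 in
        \<open>x\<close>.\<close>
      then have "real p / real r \<le> 2 * real c / real r ^ 2"
        using rc by (simp add: field_simps power2_eq_square)
      then have "54 * real (q ^ k) ^ 2 * real m * (real p / real r) \<le>
          54 * real (q ^ k) ^ 2 * real m * (2 * real c / real r ^ 2)"
        by (rule mult_left_mono) auto
      also have "\<dots> = (x / real r) ^ 2"
        unfolding x power_divide by (subst real_sqrt_pow2) auto
      finally show "sqrt (54 * real (q ^ k) ^ 2 * real m * real p / real r) \<le> x / real r"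
        using x0 by (intro real_le_lsqrt) auto
    qed auto
    also have "\<dots> = x ^ r / real r ^ r" by (simp add: power_divide)
    also have "\<dots> \<le> x ^ r / fact r"
    proof (rule divide_left_mono)
      show "(fact r :: real) \<le> real r ^ r"
        using fact_le_power[of r, where ?'a = real] by simp
    qed (use x0 rc in auto)
    also have "\<dots> \<le> x ^ H / fact H"
      using r cx c by (intro power_div_fact_mono) (auto simp: H_def)
    finally show ?thesis .
  qed
  have "S = (\<Union>r\<in>{1..H}. {a \<in> S. card (off_rows m k J a) = r})"
  proof (intro equalityI subsetI)
    fix a assume a: "a \<in> S"
    then have "2 * card (off_rows m k J a) \<le> v" using card_off_rows_le[of m k a J] by (auto simp: S_def)
    moreover have "off_rows m k J a \<noteq> {}" using a False card_off_supp_eq_0[of m k J a] by (auto simp: S_def)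
    then have "1 \<le> card (off_rows m k J a)" by (simp add: Suc_le_eq card_gt_0_iff)
    ultimately show "a \<in> (\<Union>r\<in>{1..H}. {a \<in> S. card (off_rows m k J a) = r})"
      using a by (simp add: H_def)
  qed auto
  then have "(\<Sum>a\<in>S. \<Sum>w\<in>W. cmod (msg_ft q m k h w a)) =
     (\<Sum>a\<in>(\<Union>r\<in>{1..H}. {a \<in> S. card (off_rows m k J a) = r}). \<Sum>w\<in>W. cmod (msg_ft q m k h w a))"
    by simp
  also have "\<dots> = (\<Sum>r\<in>{1..H}. \<Sum>a\<in>{a \<in> S. card (off_rows m k J a) = r}. \<Sum>w\<in>W. cmod (msg_ft q m k h w a))"
    by (rule sum.UNION_disjoint) (use finS in auto)
  also have "\<dots> \<le> (\<Sum>r\<in>{1..H}. x ^ H / fact H)"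
    by (rule sum_mono) (rule bound)
  also have "\<dots> = real H * (x ^ H / fact H)" by simp
  also have "\<dots> \<le> envelope (4 * x) v"
    using cx c by (intro half_level_le_envelope) (auto simp: H_def)
  finally show ?thesis .
qed

subsection \<open>One round of the protocol\<close>

text \<open>The adjoint of \<open>hm_proj\<close>: a frequency on hyperedges is transported to the
  vertices. Writing it as a sum avoids inverting the matching; at most one term is nonzero because
  distinct slots are distinct cells. Values are not reduced modulo \<open>q\<close>.\<close>

definition adj :: "nat \<Rightarrow> nat \<Rightarrow> (nat \<Rightarrow> nat) \<Rightarrow> hypermatching \<Rightarrow> zmat \<Rightarrow> zmat" where
  "adj m k \<phi> M a v l' = (\<Sum>j<m. \<Sum>l<k. if M j l = v \<and> \<phi> l = l' then a j l else 0)"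

definition Zq_mat_add :: "nat \<Rightarrow> nat \<Rightarrow> nat \<Rightarrow> zmat \<Rightarrow> zmat \<Rightarrow> zmat" where
  "Zq_mat_add q m k A B = (\<lambda>j\<in>{..<m}. \<lambda>l\<in>{..<k}. (A j l + B j l) mod int q)"

lemma chr_adj:
  assumes "M \<in> PHM m k n" "\<phi> \<in> {..<k} \<rightarrow> {..<k'}"
  shows "chr q n k' (adj m k \<phi> M a) X = chr q m k a (hm_proj m k \<phi> M X)"
proof -
  have "chr q n k' (adj m k \<phi> M a) X =
    (\<Prod>v<n. \<Prod>l'<k'. \<Prod>j<m. \<Prod>l<k. ez q (if M j l = v \<and> \<phi> l = l' then a j l * X v l' else 0))"
    unfolding chr_def adj_def sum_distrib_right ez_sum
    by (intro prod.cong refl) auto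
  also have "\<dots> = (\<Prod>j<m. \<Prod>l<k. \<Prod>v<n. \<Prod>l'<k'. ez q (if M j l = v \<and> \<phi> l = l' then a j l * X v l' else 0))"
    by (simp only: prod.swap[where B = "{..<m}"] prod.swap[where A = "{..<k'}" and B = "{..<k}"]
          prod.swap[where A = "{..<n}" and B = "{..<k}"])
  also have "\<dots> = (\<Prod>j<m. \<Prod>l<k. ez q (a j l * X (M j l) (\<phi> l)))"
  proof (intro prod.cong refl)
    fix j l assume jl: "j \<in> {..<m}" "l \<in> {..<k}"
    have "(\<Prod>v<n. \<Prod>l'<k'. ez q (if M j l = v \<and> \<phi> l = l' then a j l * X v l' else 0)) =
       (\<Prod>v<n. if v = M j l then ez q (a j l * X v (\<phi> l)) else 1)"
    proof (intro prod.cong refl)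
      fix v
      have "(\<Prod>l'<k'. ez q (if M j l = v \<and> \<phi> l = l' then a j l * X v l' else 0)) =
         (\<Prod>l'<k'. if l' = \<phi> l then (if v = M j l then ez q (a j l * X v (\<phi> l)) else 1) else 1)"
        by (intro prod.cong) auto
      also have "\<dots> = (if v = M j l then ez q (a j l * X v (\<phi> l)) else 1)"
        using assms(2) jl by (simp add: Pi_iff)
      finally show "(\<Prod>l'<k'. ez q (if M j l = v \<and> \<phi> l = l' then a j l * X v l' else 0)) =
         (if v = M j l then ez q (a j l * X v (\<phi> l)) else 1)" .
    qed
    also have "\<dots> = ez q (a j l * X (M j l) (\<phi> l))"
      using PHM_less[OF assms(1), of j l] jl by simp
    finally show "(\<Prod>v<n. \<Prod>l'<k'. ez q (if M j l = v \<and> \<phi> l = l' then a j l * X v l' else 0)) =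
      ez q (a j l * X (M j l) (\<phi> l))" .
  qed
  also have "\<dots> = chr q m k a (hm_proj m k \<phi> M X)"
    unfolding chr_def hm_proj_def by (intro prod.cong) auto
  finally show ?thesis .
qed

lemma chr_diff:
  "chr q m k a (Zq_mat_diff q m k A B) = chr q m k a A * cnj (chr q m k a B)"
proof -
  have "chr q m k a (Zq_mat_diff q m k A B) = chr q m k a (\<lambda>j l. A j l + - B j l)"
    by (rule chr_cong) (auto simp: Zq_mat_diff_def mod_eq_dvd_iff[symmetric])
  then show ?thesis by (simp add: chr_add cnj_chr del: add_uminus_conv_diff)
qed

lemma Zq_mat_diff_in [simp]: "q > 0 \<Longrightarrow> Zq_mat_diff q m k A B \<in> Zq_mat q m k"
  unfolding Zq_mat_diff_def by (rule restrict_mod_in_Zq_mat)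

lemma Zq_mat_add_in [simp]: "q > 0 \<Longrightarrow> Zq_mat_add q m k A B \<in> Zq_mat q m k"
  unfolding Zq_mat_add_def by (rule restrict_mod_in_Zq_mat)

section \<open>Fourier expansion of the message probabilities of one player\<close>

locale hidden_partition_step =
  fixes q k k' n m :: nat and \<phi> :: "nat \<Rightarrow> nat" and \<Y> :: "(nat \<Rightarrow> int) pmf"
  assumes q: "q > 0" and mn: "2 * m \<le> n" and n: "0 < n"
    and \<phi>: "\<phi> \<in> {..<k} \<rightarrow> {..<k'}" and inj: "inj_on \<phi> {..<k}"
    and \<Y>: "one_wise_uniform q k \<Y>"
begin

definition noise_ft :: "zmat \<Rightarrow> complex" where
  "noise_ft a = measure_pmf.expectation (iid_rows m \<Y>) (\<lambda>Y. cnj (chr q m k a Y))"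

lemma finite_set_Y: "finite (set_pmf \<Y>)"
  using \<Y> unfolding one_wise_uniform_def
  by (auto intro!: finite_PiE intro: finite_subset)

lemma finite_set_iid: "finite (set_pmf (iid_rows m \<Y>))"
proof -
  have "set_pmf (iid_rows m \<Y>) \<subseteq> PiE_dflt {..<m} undefined (\<lambda>_. set_pmf \<Y>)"
    unfolding iid_rows_def using set_Pi_pmf_subset'[of "{..<m}" undefined "\<lambda>_. \<Y>"]
    by (simp add: comp_def)
  moreover have "finite (PiE_dflt {..<m} (undefined :: nat \<Rightarrow> int) (\<lambda>_. set_pmf \<Y>))"
    by (rule finite_PiE_dflt) (auto simp: finite_set_Y)
  ultimately show ?thesis by (rule finite_subset)
qed

lemma norm_noise_ft_le_1: "cmod (noise_ft a) \<le> 1"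
proof -
  have "cmod (noise_ft a) \<le> measure_pmf.expectation (iid_rows m \<Y>) (\<lambda>Y. cmod (cnj (chr q m k a Y)))"
    unfolding noise_ft_def by (rule integral_norm_bound)
  then show ?thesis by simp
qed

text \<open>Rows are independent, so the transform factors over rows. A row with a single nonzero
  entry sees only the marginal of that coordinate, which is uniform, and a nontrivial character
  averages to 0.\<close>

lemma noise_ft_eq_0:
  assumes a: "a \<in> Zq_mat q m k" and "\<not> no_singleton_row m k a"
  shows "noise_ft a = 0"
proof -
  from assms obtain j l where jl: "j < m" "l < k" "a j l \<noteq> 0"
    and un: "\<And>l'. l' < k \<Longrightarrow> l' \<noteq> l \<Longrightarrow> a j l' = 0"
    unfolding no_singleton_row_def by blast
  let ?f = "\<lambda>i r. \<Prod>l<k. ez q (a i l * - r l)"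
  have "noise_ft a = measure_pmf.expectation (iid_rows m \<Y>) (\<lambda>Y. \<Prod>i<m. ?f i (Y i))"
    unfolding noise_ft_def cnj_chr unfolding chr_def ..
  also have "\<dots> = (\<Prod>i<m. measure_pmf.expectation (iid_rows m \<Y>) (\<lambda>Y. ?f i (Y i)))"
  proof (rule prob_space.indep_vars_lebesgue_integral[OF measure_pmf.prob_space_axioms])
    show "prob_space.indep_vars (iid_rows m \<Y>) (\<lambda>_. borel) (\<lambda>i Y. ?f i (Y i)) {..<m}"
      unfolding iid_rows_def
      by (rule prob_space.indep_vars_compose2[OF measure_pmf.prob_space_axioms indep_vars_Pi_pmf]) auto
  qed (auto intro!: integrable_measure_pmf_finite finite_set_iid)
  also have "\<dots> = (\<Prod>i<m. measure_pmf.expectation \<Y> (?f i))"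
  proof (rule prod.cong[OF refl])
    fix i assume "i \<in> {..<m}"
    then have eq: "map_pmf (\<lambda>Y. Y i) (iid_rows m \<Y>) = \<Y>"
      unfolding iid_rows_def by (subst Pi_pmf_component) auto
    have "measure_pmf.expectation (map_pmf (\<lambda>Y. Y i) (iid_rows m \<Y>)) (?f i) =
        measure_pmf.expectation (iid_rows m \<Y>) (\<lambda>Y. ?f i (Y i))"
      by (rule integral_map_pmf)
    then show "measure_pmf.expectation (iid_rows m \<Y>) (\<lambda>Y. ?f i (Y i)) = measure_pmf.expectation \<Y> (?f i)"
      unfolding eq by (rule sym)
  qed
  also have "measure_pmf.expectation \<Y> (?f j) = 0"
  proof -
    have "?f j r = ez q (r l * - a j l)" for r
    proof -
      have "?f j r = (\<Prod>l'\<in>{l}. ez q (a j l' * - r l'))"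
        by (rule prod.mono_neutral_right) (use jl un in auto)
      then show ?thesis by (simp add: mult.commute)
    qed
    then have "measure_pmf.expectation \<Y> (?f j) = measure_pmf.expectation (map_pmf (\<lambda>y. y l) \<Y>) (\<lambda>c. ez q (c * - a j l))"
      by simp
    also have "map_pmf (\<lambda>y. y l) \<Y> = pmf_of_set (Zq q)"
      using \<Y> jl unfolding one_wise_uniform_def by blast
    also have "measure_pmf.expectation (pmf_of_set (Zq q)) (\<lambda>c. ez q (c * - a j l)) =
        (\<Sum>c\<in>Zq q. ez q (c * - a j l)) / of_nat q"
    proof -
      have "Zq q \<noteq> {}" using q by (simp add: Zq_def)
      then show ?thesis
        by (subst integral_measure_pmf[of "Zq q"])
          (auto simp: scaleR_conv_of_real sum_divide_distrib)
    qed
    also have "(\<Sum>c\<in>Zq q. ez q (c * - a j l)) = 0"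
    proof -
      have "a j l \<in> Zq q" using a jl by (auto intro: Zq_matD)
      then have "\<not> int q dvd a j l" using jl by (auto simp: Zq_def dest: zdvd_imp_le)
      then show ?thesis by (simp only: sum_ez[OF q]) simp
    qed
    finally show ?thesis by simp
  qed
  then have "(\<Prod>i<m. measure_pmf.expectation \<Y> (?f i)) = 0"
    using jl by (intro prod_zero) auto
  finally show ?thesis .
qed

definition transition :: "hypermatching \<Rightarrow> zmat \<Rightarrow> zmat pmf" where
  "transition M X = map_pmf (\<lambda>Y. Zq_mat_diff q m k (hm_proj m k \<phi> M X) Y) (iid_rows m \<Y>)"

definition msg_prob :: "hypermatching \<Rightarrow> (zmat \<Rightarrow> 'w) \<Rightarrow> 'w \<Rightarrow> zmat \<Rightarrow> real" where
  "msg_prob M h w X = measure_pmf.prob (transition M X) {Z. h Z = w}"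

text \<open>The indicator of the message is expanded by inversion. The character of signal minus
  noise splits; the noise factor averages to \<open>noise_ft\<close>, and adjointness moves the
  signal factor to \<open>X\<close>.\<close>

lemma msg_prob_fourier:
  assumes "M \<in> PHM m k n"
  shows "complex_of_real (msg_prob M h w X) =
    (\<Sum>a\<in>Zq_mat q m k. msg_ft q m k h w a * noise_ft a * chr q n k' (adj m k \<phi> M a) X)"
proof -
  let ?V = "Zq_mat q m k" and ?H = "hm_proj m k \<phi> M X"
  have "msg_prob M h w X = measure_pmf.expectation (transition M X) (indicator {Z. h Z = w})"
    unfolding msg_prob_def by (subst Bochner_Integration.integral_indicator) simp
  then have "complex_of_real (msg_prob M h w X) =
      complex_of_real (measure_pmf.expectation (transition M X) (indicator {Z. h Z = w}))"
    by (rule arg_cong)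
  also have "\<dots> = measure_pmf.expectation (transition M X) (\<lambda>Z. complex_of_real (indicator {Z. h Z = w} Z))"
    by (rule integral_complex_of_real[symmetric])
  also have "\<dots> = measure_pmf.expectation (iid_rows m \<Y>)
      (\<lambda>Y. complex_of_real (indicator {Z. h Z = w} (Zq_mat_diff q m k ?H Y)))"
    unfolding transition_def by (rule integral_map_pmf)
  also have "\<dots> = measure_pmf.expectation (iid_rows m \<Y>)
      (\<lambda>Y. \<Sum>a\<in>?V. msg_ft q m k h w a * chr q m k a ?H * cnj (chr q m k a Y))"
  proof (rule Bochner_Integration.integral_cong[OF refl])
    fix Y
    let ?Z = "Zq_mat_diff q m k ?H Y"
    have "complex_of_real (indicator {Z. h Z = w} ?Z) = (if h ?Z = w then 1 else 0)"
      by (simp add: indicator_def)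
    also have "\<dots> = (\<Sum>a\<in>?V. msg_ft q m k h w a * chr q m k a ?Z)"
      unfolding msg_ft_def using ft_inversion[of q ?Z m k "\<lambda>Z. if h Z = w then 1 else 0"] q by simp
    finally show "complex_of_real (indicator {Z. h Z = w} ?Z) =
      (\<Sum>a\<in>?V. msg_ft q m k h w a * chr q m k a ?H * cnj (chr q m k a Y))"
      by (simp add: chr_diff mult_ac)
  qed
  also have "\<dots> = (\<Sum>a\<in>?V. measure_pmf.expectation (iid_rows m \<Y>)
      (\<lambda>Y. msg_ft q m k h w a * chr q m k a ?H * cnj (chr q m k a Y)))"
    by (rule Bochner_Integration.integral_sum)
      (auto intro!: integrable_measure_pmf_finite finite_set_iid)
  also have "\<dots> = (\<Sum>a\<in>?V. msg_ft q m k h w a * noise_ft a * chr q n k' (adj m k \<phi> M a) X)"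
    unfolding noise_ft_def chr_adj[OF assms \<phi>] by (intro sum.cong) (auto simp: mult_ac)
  finally show ?thesis .
qed

lemma sum_msg_prob:
  assumes "finite W" "\<And>Z. Z \<in> Zq_mat q m k \<Longrightarrow> h Z \<in> W"
  shows "(\<Sum>w\<in>W. msg_prob M h w X) = 1"
proof -
  have "(\<Sum>w\<in>W. msg_prob M h w X) = measure_pmf.prob (transition M X) (\<Union>w\<in>W. {Z. h Z = w})"
    unfolding msg_prob_def
    by (rule measure_pmf.finite_measure_finite_Union[symmetric])
      (auto simp: assms disjoint_family_on_def)
  also have "\<dots> = 1"
    using assms q by (intro measure_pmf.prob_eq_1[THEN iffD2])
      (auto simp: AE_measure_pmf_iff transition_def)
  finally show ?thesis .
qed

abbreviation ftX :: "(zmat \<Rightarrow> complex) \<Rightarrow> zmat \<Rightarrow> complex" where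
  "ftX \<equiv> ft q n k'"

text \<open>A product becomes a convolution along the transported frequencies, and terms with a
  singleton row vanish together with the noise transform.\<close>

lemma ft_mult_msg_prob:
  assumes "M \<in> PHM m k n"
  shows "ftX (\<lambda>X. u X * of_real (msg_prob M h w X)) s =
    (\<Sum>a\<in>{a \<in> Zq_mat q m k. no_singleton_row m k a}.
       msg_ft q m k h w a * noise_ft a * ftX u (Zq_mat_diff q n k' s (adj m k \<phi> M a)))"
proof -
  let ?V = "Zq_mat q m k" and ?N = "of_nat (q ^ (n * k')) :: complex"
  have "ftX (\<lambda>X. u X * of_real (msg_prob M h w X)) s =
    (\<Sum>X\<in>Zq_mat q n k'. \<Sum>a\<in>?V. msg_ft q m k h w a * noise_ft a *
       (u X * cnj (chr q n k' (Zq_mat_diff q n k' s (adj m k \<phi> M a)) X))) / ?N"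
    unfolding ft_def
  proof (intro arg_cong2[where f = "(/)"] sum.cong refl)
    fix X
    have "cnj (chr q n k' (Zq_mat_diff q n k' s (adj m k \<phi> M a)) X) =
        chr q n k' (adj m k \<phi> M a) X * cnj (chr q n k' s X)" for a
      by (subst (1 2 3) chr_commute) (simp add: chr_diff)
    then show "u X * of_real (msg_prob M h w X) * cnj (chr q n k' s X) =
      (\<Sum>a\<in>?V. msg_ft q m k h w a * noise_ft a *
       (u X * cnj (chr q n k' (Zq_mat_diff q n k' s (adj m k \<phi> M a)) X)))"
      by (simp add: msg_prob_fourier[OF assms] sum_distrib_left sum_distrib_right mult_ac)
  qed
  also have "\<dots> = (\<Sum>a\<in>?V. msg_ft q m k h w a * noise_ft a * ftX u (Zq_mat_diff q n k' s (adj m k \<phi> M a)))"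
    unfolding ft_def by (subst sum.swap) (simp add: sum_distrib_left sum_divide_distrib)
  also have "\<dots> = (\<Sum>a\<in>{a \<in> ?V. no_singleton_row m k a}.
       msg_ft q m k h w a * noise_ft a * ftX u (Zq_mat_diff q n k' s (adj m k \<phi> M a)))"
    by (rule sum.mono_neutral_right) (auto simp: noise_ft_eq_0)
  finally show ?thesis .
qed

end

text \<open>Only \<open>s\<close> has to be a reduced representative; \<open>b\<close> will be an
  unreduced \<open>adj\<close>.\<close>

lemma Zq_mat_diff_add_cancel:
  assumes "s \<in> Zq_mat q n k"
  shows "Zq_mat_add q n k (Zq_mat_diff q n k s b) b = s"
    and "Zq_mat_diff q n k (Zq_mat_add q n k s b) b = s"
proof -
  have r: "s j l mod int q = s j l" if "j < n" "l < k" for j l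
    using Zq_matD[OF assms that] by (simp add: Zq_def)
  have *: "(\<lambda>j\<in>{..<n}. \<lambda>l\<in>{..<k}. s j l mod int q) = s"
  proof
    fix j
    show "(\<lambda>j\<in>{..<n}. \<lambda>l\<in>{..<k}. s j l mod int q) j = s j"
    proof (cases "j < n")
      case True
      then have "s j \<in> {..<k} \<rightarrow>\<^sub>E Zq q" using assms by (auto simp: Zq_mat_def)
      then show ?thesis using True r by (auto simp: fun_eq_iff PiE_def extensional_def)
    next
      case False
      then show ?thesis using assms by (auto simp: Zq_mat_def PiE_def extensional_def)
    qed
  qed
  show "Zq_mat_add q n k (Zq_mat_diff q n k s b) b = s"
    by (subst (2) *[symmetric]) (auto simp: Zq_mat_add_def Zq_mat_diff_def fun_eq_iff mod_simps)
  show "Zq_mat_diff q n k (Zq_mat_add q n k s b) b = s"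
    by (subst (2) *[symmetric]) (auto simp: Zq_mat_add_def Zq_mat_diff_def fun_eq_iff mod_simps)
qed

lemma Zq_mat_dvd_iff:
  assumes "s \<in> Zq_mat q n k" "j < n" "l < k"
  shows "int q dvd s j l \<longleftrightarrow> s j l = 0"
  using Zq_matD[OF assms] by (auto simp: Zq_def dest: zdvd_imp_le)

section \<open>Change of the weight of a frequency in one round\<close>

context hidden_partition_step
begin

abbreviation "VX \<equiv> Zq_mat q n k'"
abbreviation "VZ \<equiv> {a \<in> Zq_mat q m k. no_singleton_row m k a}"
abbreviation "PM \<equiv> PHM m k n"
abbreviation cell :: "hypermatching \<Rightarrow> nat \<Rightarrow> nat \<Rightarrow> nat \<times> nat" where
  "cell M j l \<equiv> (M j l, \<phi> l)"
abbreviation "wt s \<equiv> card (supp n k' s)"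
abbreviation minus_adj :: "zmat \<Rightarrow> hypermatching \<Rightarrow> zmat \<Rightarrow> zmat" where
  "minus_adj s M a \<equiv> Zq_mat_diff q n k' s (adj m k \<phi> M a)"
abbreviation plus_adj :: "zmat \<Rightarrow> hypermatching \<Rightarrow> zmat \<Rightarrow> zmat" where
  "plus_adj s M a \<equiv> Zq_mat_add q n k' s (adj m k \<phi> M a)"

lemma cell_inj:
  assumes "M \<in> PM" "i < m" "j < m" "l < k" "l' < k"
  shows "cell M i l = cell M j l' \<longleftrightarrow> i = j \<and> l = l'"
  using assms inj PHM_inj[OF assms(1)] by (auto dest: inj_onD)

lemma adj_cell:
  assumes "M \<in> PM" "j < m" "l < k"
  shows "adj m k \<phi> M a (M j l) (\<phi> l) = a j l"
proof -
  have "adj m k \<phi> M a (M j l) (\<phi> l) = (\<Sum>i<m. \<Sum>l'<k. if i = j then (if l' = l then a j l else 0) else 0)"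
    unfolding adj_def using cell_inj[OF assms(1)] assms by (intro sum.cong refl) auto
  also have "\<dots> = (\<Sum>i<m. if i = j then a j l else 0)"
    using assms by (intro sum.cong refl) auto
  finally show ?thesis using assms by simp
qed

lemma adj_not_cell:
  assumes "\<And>j l. j < m \<Longrightarrow> l < k \<Longrightarrow> (v, l') \<noteq> cell M j l"
  shows "adj m k \<phi> M a v l' = 0"
  unfolding adj_def using assms by (intro sum.neutral ballI) auto

lemma cell_bounds:
  assumes "M \<in> PM" "j < m" "l < k"
  shows "M j l < n" "\<phi> l < k'"
  using PHM_less[OF assms] \<phi> assms by auto

lemma supp_plus_adj:
  assumes "M \<in> PM" "s \<in> VX" "j < m" "l < k"
  shows "cell M j l \<in> supp n k' (plus_adj s M a) \<longleftrightarrow> \<not> int q dvd s (M j l) (\<phi> l) + a j l"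
  using cell_bounds[OF assms(1,3,4)] adj_cell[OF assms(1,3,4)]
  by (auto simp: supp_def Zq_mat_add_def dvd_eq_mod_eq_0)

text \<open>The largest \<open>paired\<close> subset of the support of \<open>s\<close>: the part
  whose vertices share a hyperedge with another support vertex.\<close>

definition multi :: "hypermatching \<Rightarrow> zmat \<Rightarrow> (nat \<times> nat) set" where
  "multi M s = {x \<in> supp n k' s. \<exists>j<m. \<exists>l<k. \<exists>l'<k. l \<noteq> l' \<and> x = cell M j l \<and> cell M j l' \<in> supp n k' s}"

definition touched :: "hypermatching \<Rightarrow> zmat \<Rightarrow> nat set" where
  "touched M s = {j. j < m \<and> (\<exists>l<k. cell M j l \<in> supp n k' s)}"

lemma paired_multi: "paired m k \<phi> M (multi M s)"
  unfolding paired_def multi_def by blast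

text \<open>
  A row that touches the support of \<open>s\<close> in one vertex replaces that vertex by at least one new one.
  Hence the weight can drop only through \<open>multi\<close>, a set that the hypermatching is unlikely to cover.
\<close>

lemma weight_plus_adj:
  assumes M: "M \<in> PM" and s: "s \<in> VX" and a: "a \<in> VZ"
  shows "wt s + card (off_supp m k (touched M s) a) \<le> wt (plus_adj s M a) + card (multi M s)"
proof -
  define t where "t = plus_adj s M a"
  define off where "off = (\<lambda>(j, l). cell M j l) ` off_supp m k (touched M s) a"
  define A where "A = supp n k' s - multi M s"
  have sz: "int q dvd s v l' \<longleftrightarrow> s v l' = 0" if "v < n" "l' < k'" for v l'
    using Zq_mat_dvd_iff[OF s that] .
  have az: "int q dvd a j l \<longleftrightarrow> a j l = 0" if "j < m" "l < k" for j l
    using Zq_mat_dvd_iff[of a q m k j l] a that by simp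
  have off_t: "off \<subseteq> supp n k' t"
  proof (clarsimp simp: off_def off_supp_def)
    fix j l assume jl: "j < m" "l < k" "j \<notin> touched M s" "a j l \<noteq> 0"
    then have "s (M j l) (\<phi> l) = 0"
      using cell_bounds[OF M, of j l] by (auto simp: touched_def supp_def)
    then show "cell M j l \<in> supp n k' t"
      using supp_plus_adj[OF M s, of j l a] jl az by (simp add: t_def)
  qed
  have card_off: "card off = card (off_supp m k (touched M s) a)"
    unfolding off_def using cell_inj[OF M] by (intro card_image) (auto simp: inj_on_def off_supp_def)
  have off_s: "x \<notin> supp n k' s" if "x \<in> off" for x
    using that by (auto simp: off_def off_supp_def touched_def)
  \<comment> \<open>A vanishing vertex must be cancelled by a nonzero entry of \<open>a\<close>. Its
    row has a second nonzero entry, and since the vertex is not in \<open>multi\<close>, that entry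
    falls on a cell where \<open>s\<close> is 0.\<close>
  have "\<exists>y. y \<in> supp n k' t \<and> y \<notin> supp n k' s \<and>
      (\<exists>j<m. \<exists>l<k. \<exists>l'<k. x = cell M j l \<and> y = cell M j l')"
    if x: "x \<in> A" "x \<notin> supp n k' t" for x
  proof -
    obtain v l0 where xe [simp]: "x = (v, l0)" by (cases x)
    have xs: "v < n" "l0 < k'" "s v l0 \<noteq> 0" "(v, l0) \<notin> multi M s"
      using x by (auto simp: A_def supp_def)
    have "\<exists>j<m. \<exists>l<k. (v, l0) = cell M j l"
    proof (rule ccontr)
      assume "\<not> ?thesis"
      then have "adj m k \<phi> M a v l0 = 0" by (intro adj_not_cell) blast
      then have "t v l0 = s v l0 mod int q" using xs by (simp add: t_def Zq_mat_add_def)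
      then show False using x(2) xs sz by (auto simp: supp_def dvd_eq_mod_eq_0)
    qed
    then obtain j l where jl: "j < m" "l < k" "(v, l0) = cell M j l" by blast
    have "int q dvd s (M j l) (\<phi> l) + a j l"
      using supp_plus_adj[OF M s jl(1,2), of a] x(2) jl by (simp add: t_def)
    then have "a j l \<noteq> 0" using xs jl sz by auto
    then obtain l' where l': "l' < k" "l' \<noteq> l" "a j l' \<noteq> 0"
      using a jl unfolding no_singleton_row_def by blast
    have "cell M j l' \<notin> supp n k' s"
    proof
      assume "cell M j l' \<in> supp n k' s"
      moreover have "(v, l0) \<in> supp n k' s" using xs by (simp add: supp_def)
      ultimately have "(v, l0) \<in> multi M s"
        unfolding multi_def using jl l' by (smt (verit, ccfv_threshold) mem_Collect_eq)
      then show False using xs by simp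
    qed
    moreover from this have "s (M j l') (\<phi> l') = 0"
      using cell_bounds[OF M jl(1) l'(1)] by (simp add: supp_def)
    then have "cell M j l' \<in> supp n k' t"
      using supp_plus_adj[OF M s jl(1) l'(1), of a] l' az jl by (simp add: t_def)
    ultimately show ?thesis using jl l'(1) unfolding xe by blast
  qed
  then obtain g where g: "\<And>x. x \<in> A \<Longrightarrow> x \<notin> supp n k' t \<Longrightarrow> g x \<in> supp n k' t \<and> g x \<notin> supp n k' s \<and>
      (\<exists>j<m. \<exists>l<k. \<exists>l'<k. x = cell M j l \<and> g x = cell M j l')"
    by metis
  \<comment> \<open>Surviving vertices stay fixed and each lost one moves to a new vertex of its
    row. This is injective, as the row of a vertex outside \<open>multi\<close> contains no other
    support vertex of \<open>s\<close>.\<close>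
  define f where "f x = (if x \<in> supp n k' t then x else g x)" for x
  have As: "x \<in> supp n k' s" if "x \<in> A" for x using that by (simp add: A_def)
  have "inj_on f A"
  proof (rule inj_onI)
    fix x y assume xy: "x \<in> A" "y \<in> A" "f x = f y"
    show "x = y"
    proof (cases "x \<in> supp n k' t \<or> y \<in> supp n k' t")
      case True
      then show ?thesis using xy g[of x] g[of y] As by (auto simp: f_def split: if_splits)
    next
      case False
      then obtain i j l1 l1' l2 l2' where *: "i < m" "l1 < k" "l1' < k" "x = cell M i l1" "g x = cell M i l1'"
        "j < m" "l2 < k" "l2' < k" "y = cell M j l2" "g y = cell M j l2'"
        using g[of x] g[of y] xy by metis
      then have "i = j" using cell_inj[OF M, of i j l1' l2'] xy False by (auto simp: f_def)
      moreover have "x \<notin> multi M s" using xy by (simp add: A_def)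
      ultimately show ?thesis
        using * As[OF xy(1)] As[OF xy(2)] unfolding multi_def by blast
    qed
  qed
  \<comment> \<open>The images either belong to the support of \<open>s\<close> or lie in touched
    rows, so the vertices created off the touched rows are counted in addition.\<close>
  moreover have "f ` A \<subseteq> supp n k' t - off"
  proof (rule image_subsetI, rule ccontr)
    fix x assume x: "x \<in> A" "\<not> f x \<in> supp n k' t - off"
    have "f x \<in> supp n k' t" using g x by (auto simp: f_def)
    with x have fo: "f x \<in> off" by simp
    have "x \<notin> supp n k' t" using fo off_s[of x] As[OF x(1)] by (auto simp: f_def)
    moreover from this have "f x = g x" by (simp add: f_def)
    ultimately obtain j l l' where *: "j < m" "l < k" "l' < k" "x = cell M j l" "f x = cell M j l'"
      using g[OF x(1)] by metis
    have "j \<in> touched M s" using As[OF x(1)] * by (auto simp: touched_def)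
    then show False using fo * cell_inj[OF M] by (auto simp: off_def off_supp_def)
  qed
  ultimately have "card A \<le> card (supp n k' t - off)"
    by (rule card_inj_on_le) simp
  moreover have "card A = wt s - card (multi M s)"
    unfolding A_def by (rule card_Diff_subset) (auto simp: multi_def)
  moreover have "card (supp n k' t - off) = wt t - card off"
    using off_t by (intro card_Diff_subset) (auto intro: finite_subset)
  moreover have "card off \<le> wt t" using off_t by (intro card_mono) auto
  ultimately show ?thesis unfolding card_off t_def by linarith
qed

lemma card_touched_le:
  assumes "M \<in> PM"
  shows "card (touched M s) \<le> wt s"
proof -
  define \<rho> where "\<rho> x = (SOME j. j < m \<and> (\<exists>l<k. x = cell M j l))" for x
  have "\<rho> (cell M j l) = j" if "j < m" "l < k" for j l
    unfolding \<rho>_def using that cell_inj[OF assms] by (intro some_equality) blast+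
  then have "touched M s \<subseteq> \<rho> ` supp n k' s"
    unfolding touched_def by force
  then show ?thesis by (rule surj_card_le[rotated]) simp
qed

text \<open>\<open>multi M s\<close> is itself a paired subset of the support, so a union bound over
  the at most 2^(wt s) subsets of size at least \<open>e\<close> suffices. The smallness assumption
  allows each exponent to be lowered to \<open>e\<close>.\<close>

lemma card_multi_ge_le:
  assumes "4 * sqrt (real (wt s) / real n) \<le> 1"
  shows "real (card {M \<in> PM. e \<le> card (multi M s)}) \<le>
    real (card PM) * (2 ^ wt s * (4 * sqrt (real (wt s) / real n)) ^ e)"
proof -
  define \<D> where "\<D> = {D. D \<subseteq> supp n k' s \<and> e \<le> card D}"
  have fin: "finite \<D>" by (simp add: \<D>_def)
  have "card \<D> \<le> card (Pow (supp n k' s))" by (rule card_mono) (auto simp: \<D>_def)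
  then have cD: "card \<D> \<le> 2 ^ wt s" by (simp add: card_Pow)
  have "{M \<in> PM. e \<le> card (multi M s)} \<subseteq> (\<Union>D\<in>\<D>. {M \<in> PM. paired m k \<phi> M D})"
  proof clarify
    fix M assume "M \<in> PM" "e \<le> card (multi M s)"
    moreover from this have "multi M s \<in> \<D>" by (auto simp: \<D>_def multi_def)
    ultimately show "M \<in> (\<Union>D\<in>\<D>. {M \<in> PM. paired m k \<phi> M D})"
      using paired_multi[of M s] by blast
  qed
  then have "card {M \<in> PM. e \<le> card (multi M s)} \<le> card (\<Union>D\<in>\<D>. {M \<in> PM. paired m k \<phi> M D})"
    by (rule card_mono[rotated]) (use fin in auto)
  also have "\<dots> \<le> (\<Sum>D\<in>\<D>. card {M \<in> PM. paired m k \<phi> M D})" by (rule card_UN_le) fact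
  finally have "real (card {M \<in> PM. e \<le> card (multi M s)}) \<le> (\<Sum>D\<in>\<D>. real (card {M \<in> PM. paired m k \<phi> M D}))"
    by (simp flip: of_nat_sum)
  also have "\<dots> \<le> (\<Sum>D\<in>\<D>. real (card PM) * (4 * sqrt (real (wt s) / real n)) ^ e)"
  proof (rule sum_mono)
    fix D assume D: "D \<in> \<D>"
    then have D': "D \<subseteq> supp n k' s" "e \<le> card D" "finite D" by (auto simp: \<D>_def intro: finite_subset)
    have "real (card {M \<in> PM. paired m k \<phi> M D}) \<le> real (card PM) * (4 * sqrt (real (card D) / real n)) ^ card D"
      by (rule card_paired_le[OF D'(3) inj mn n])
    also have "\<dots> \<le> real (card PM) * (4 * sqrt (real (wt s) / real n)) ^ card D"
      using D' card_mono[OF finite_supp D'(1)]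
      by (intro mult_left_mono power_mono real_sqrt_le_mono divide_right_mono) auto
    also have "\<dots> \<le> real (card PM) * (4 * sqrt (real (wt s) / real n)) ^ e"
      using assms D' by (intro mult_left_mono power_decreasing) auto
    finally show "real (card {M \<in> PM. paired m k \<phi> M D}) \<le> real (card PM) * (4 * sqrt (real (wt s) / real n)) ^ e" .
  qed
  also have "\<dots> = real (card \<D>) * (real (card PM) * (4 * sqrt (real (wt s) / real n)) ^ e)" by simp
  also have "\<dots> \<le> 2 ^ wt s * (real (card PM) * (4 * sqrt (real (wt s) / real n)) ^ e)"
  proof (rule mult_right_mono)
    show "real (card \<D>) \<le> 2 ^ wt s" using cD by (metis of_nat_le_iff of_nat_numeral of_nat_power)
  qed auto
  finally show ?thesis by (simp add: mult_ac)
qed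

end

text \<open>One round with the earlier blackboard frozen, so that the message depends on
  \<open>M\<close> and \<open>Z\<close> only. The leading 4 of \<open>x\<close> is the factor in the
  argument of the envelope in \<open>level_weight_le\<close>.\<close>

locale message_step = hidden_partition_step +
  fixes W :: "'w set" and h :: "hypermatching \<Rightarrow> zmat \<Rightarrow> 'w" and c :: nat and x :: real
  assumes finW: "finite W" and hW: "\<And>M Z. M \<in> PHM m k n \<Longrightarrow> Z \<in> Zq_mat q m k \<Longrightarrow> h M Z \<in> W"
    and cardW: "card W \<le> 2 ^ c" and cm: "2 * c \<le> m"
    and x: "x = 4 * sqrt (108 * real (q ^ k) ^ 2 * real m * real c)"
begin

definition msg_weight :: "hypermatching \<Rightarrow> zmat \<Rightarrow> real" where
  "msg_weight M a = (\<Sum>w\<in>W. cmod (msg_ft q m k (h M) w a))"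

lemma msg_weight_nonneg [simp]: "0 \<le> msg_weight M a"
  by (simp add: msg_weight_def sum_nonneg)

lemma msg_weight_le_1: "M \<in> PM \<Longrightarrow> msg_weight M a \<le> 1"
  unfolding msg_weight_def using q finW hW by (intro sum_msg_ft_le_1) auto

lemma envelope_nonneg [simp]: "0 \<le> envelope x v"
  unfolding envelope_def x by simp

text \<open>The frequencies are grouped by their restriction to the touched rows, for which there
  are at most (q^k)^(wt s) choices, and by the number v of new vertices elsewhere; each group obeys
  \<open>level_weight_le\<close>. By \<open>weight_plus_adj\<close>, ending at weight \<omega>
  forces wt s + v - \<omega> vertices into \<open>multi\<close>, a condition that the truncated
  subtraction drops when it is void.\<close>

lemma sum_msg_weight_le:
  assumes M: "M \<in> PM" and s: "s \<in> VX" and \<omega>: "\<omega> \<le> c"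
  shows "(\<Sum>a\<in>{a \<in> VZ. wt (plus_adj s M a) = \<omega>}. msg_weight M a) \<le>
    real (q ^ k) ^ wt s *
      (\<Sum>v\<le>\<omega>. envelope x v * (if wt s - (\<omega> - v) \<le> card (multi M s) then 1 else 0))"
proof -
  define J where "J = touched M s"
  define A where "A = {a \<in> VZ. wt (plus_adj s M a) = \<omega>}"
  define key where "key a = (restrict a J, card (off_supp m k J a))" for a
  define R where "R = J \<rightarrow>\<^sub>E ({..<k} \<rightarrow>\<^sub>E Zq q)"
  define I where "I = {v. v \<le> \<omega> \<and> wt s - (\<omega> - v) \<le> card (multi M s)}"
  have Jm: "J \<subseteq> {..<m}" by (auto simp: J_def touched_def)
  then have finJ: "finite J" by (rule finite_subset) simp
  have finR: "finite R" unfolding R_def by (intro finite_PiE finJ) (auto intro!: finite_PiE)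
  have finI: "finite I" by (rule finite_subset[of _ "{..\<omega>}"]) (auto simp: I_def)
  have finA: "finite A" by (simp add: A_def)
  have key_in: "key a \<in> R \<times> I" if "a \<in> A" for a
  proof -
    have "a \<in> VZ" "wt (plus_adj s M a) = \<omega>" using that by (auto simp: A_def)
    then have "wt s + card (off_supp m k J a) \<le> \<omega> + card (multi M s)"
      using weight_plus_adj[OF M s, of a] by (simp add: J_def)
    moreover have "card (off_supp m k J a) \<le> \<omega>"
    proof -
      have "(\<lambda>(j, l). cell M j l) ` off_supp m k J a \<subseteq> supp n k' (plus_adj s M a)"
      proof (clarsimp simp: off_supp_def J_def)
        fix j l assume jl: "j < m" "l < k" "j \<notin> touched M s" "a j l \<noteq> 0"
        then have "s (M j l) (\<phi> l) = 0"
          using cell_bounds[OF M, of j l] by (auto simp: touched_def supp_def)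
        then show "cell M j l \<in> supp n k' (plus_adj s M a)"
          using supp_plus_adj[OF M s, of j l a] jl Zq_mat_dvd_iff[of a q m k j l] \<open>a \<in> VZ\<close> by simp
      qed
      moreover have "inj_on (\<lambda>(j, l). cell M j l) (off_supp m k J a)"
        using cell_inj[OF M] by (auto simp: inj_on_def off_supp_def)
      ultimately show ?thesis
        using card_inj_on_le[of "\<lambda>(j, l). cell M j l" "off_supp m k J a" "supp n k' (plus_adj s M a)"]
          \<open>wt (plus_adj s M a) = \<omega>\<close> by simp
    qed
    moreover have "restrict a J \<in> R"
      using \<open>a \<in> VZ\<close> Jm by (auto simp: R_def Zq_mat_def)
    ultimately show ?thesis by (auto simp: key_def I_def)
  qed
  have "(\<Sum>a\<in>A. msg_weight M a) = (\<Sum>y\<in>R \<times> I. \<Sum>a\<in>{a \<in> A. key a = y}. msg_weight M a)"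
    by (rule sum.group[symmetric]) (use finA finR finI key_in in blast)+
  also have "\<dots> \<le> (\<Sum>y\<in>R \<times> I. envelope x (snd y))"
  proof (rule sum_mono, clarify)
    fix a1 v assume "a1 \<in> R" "v \<in> I"
    define B where "B = {a \<in> Zq_mat q m k. (\<forall>j<m. j \<in> J \<longrightarrow> a j = a1 j) \<and> no_singleton_row m k a \<and>
                  card (off_supp m k J a) = v}"
    have "{a \<in> A. key a = (a1, v)} \<subseteq> B"
    proof clarify
      fix a assume "a \<in> A" "key a = (a1, v)"
      moreover from this have "a j = a1 j" if "j \<in> J" for j
        using that by (auto simp: key_def restrict_apply)
      ultimately show "a \<in> B" by (auto simp: A_def B_def key_def)
    qed
    then have "(\<Sum>a\<in>{a \<in> A. key a = (a1, v)}. msg_weight M a) \<le> (\<Sum>a\<in>B. msg_weight M a)"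
      by (intro sum_mono2) (auto simp: B_def)
    also have "\<dots> \<le> envelope x v"
      unfolding B_def msg_weight_def x
      by (rule level_weight_le[OF q finW hW[OF M] cardW _ cm refl]) (use \<open>v \<in> I\<close> \<omega> in \<open>auto simp: I_def\<close>)
    finally show "(\<Sum>a\<in>{a \<in> A. key a = (a1, v)}. msg_weight M a) \<le> envelope x (snd (a1, v))" by simp
  qed
  also have "\<dots> = real (card R) * (\<Sum>v\<in>I. envelope x v)"
    by (simp add: sum.cartesian_product')
  also have "\<dots> \<le> real (q ^ k) ^ wt s * (\<Sum>v\<in>I. envelope x v)"
  proof (rule mult_right_mono)
    have "card R = (q ^ k) ^ card J" using finJ by (simp add: R_def card_PiE)
    also have "\<dots> \<le> (q ^ k) ^ wt s"
      using card_touched_le[OF M, of s] q by (intro power_increasing) (auto simp: J_def Suc_le_eq)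
    finally show "real (card R) \<le> real (q ^ k) ^ wt s"
      by (metis of_nat_le_iff of_nat_power)
  qed (auto intro: sum_nonneg)
  also have "(\<Sum>v\<in>I. envelope x v) =
      (\<Sum>v\<le>\<omega>. envelope x v * (if wt s - (\<omega> - v) \<le> card (multi M s) then 1 else 0))"
    by (rule sum.mono_neutral_cong_left) (auto simp: I_def)
  finally show ?thesis unfolding A_def .
qed

text \<open>Averaging over \<open>M\<close> turns the indicator for a large \<open>multi\<close>
  into its probability.\<close>

lemma average_msg_weight_le:
  assumes s: "s \<in> VX" and \<omega>: "\<omega> \<le> c" and small: "4 * sqrt (real (wt s) / real n) \<le> 1"
  shows "(\<Sum>M\<in>PM. \<Sum>a\<in>{a \<in> VZ. wt (plus_adj s M a) = \<omega>}. msg_weight M a) \<le>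
    real (card PM) * ((2 * real (q ^ k)) ^ wt s *
      (\<Sum>v\<le>\<omega>. envelope x v * (4 * sqrt (real (wt s) / real n)) ^ (wt s - (\<omega> - v))))"
proof -
  have "(\<Sum>M\<in>PM. \<Sum>a\<in>{a \<in> VZ. wt (plus_adj s M a) = \<omega>}. msg_weight M a) \<le>
    (\<Sum>M\<in>PM. real (q ^ k) ^ wt s *
      (\<Sum>v\<le>\<omega>. envelope x v * (if wt s - (\<omega> - v) \<le> card (multi M s) then 1 else 0)))"
    by (intro sum_mono sum_msg_weight_le s \<omega>)
  also have "\<dots> = real (q ^ k) ^ wt s *
      (\<Sum>v\<le>\<omega>. envelope x v * (\<Sum>M\<in>PM. if wt s - (\<omega> - v) \<le> card (multi M s) then 1 else 0))"
    by (simp only: sum_distrib_left[symmetric] sum.swap[where B = "{..\<omega>}" and A = PM])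
  also have "\<dots> = real (q ^ k) ^ wt s *
      (\<Sum>v\<le>\<omega>. envelope x v * real (card {M \<in> PM. wt s - (\<omega> - v) \<le> card (multi M s)}))"
    by (simp add: sum.inter_filter[symmetric])
  also have "\<dots> \<le> real (q ^ k) ^ wt s *
      (\<Sum>v\<le>\<omega>. envelope x v * (real (card PM) * (2 ^ wt s * (4 * sqrt (real (wt s) / real n)) ^ (wt s - (\<omega> - v)))))"
    by (intro mult_left_mono sum_mono card_multi_ge_le small) auto
  also have "\<dots> = real (card PM) * ((2 * real (q ^ k)) ^ wt s *
      (\<Sum>v\<le>\<omega>. envelope x v * (4 * sqrt (real (wt s) / real n)) ^ (wt s - (\<omega> - v))))"
    by (simp add: sum_distrib_left power_mult_distrib mult_ac)
  finally show ?thesis .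
qed

end

section \<open>Low and high frequencies in one round\<close>

context message_step
begin

definition next_state :: "hypermatching \<Rightarrow> 'w \<Rightarrow> (zmat \<Rightarrow> complex) \<Rightarrow> zmat \<Rightarrow> complex" where
  "next_state M w u = (\<lambda>X. u X * of_real (msg_prob M (h M) w X))"

definition level_norm :: "nat \<Rightarrow> (zmat \<Rightarrow> complex) \<Rightarrow> real" where
  "level_norm \<omega> u = (\<Sum>s\<in>{s \<in> VX. wt s = \<omega>}. cmod (ftX u s))"

lemma minus_adj_supp:
  assumes M: "M \<in> PM" and s: "s \<in> VX" and a: "a \<in> VZ"
  shows "supp n k' (Zq_mat_diff q n k' s (minus_adj s M a)) = (\<lambda>(j, l). cell M j l) ` supp m k a"
proof -
  have az: "int q dvd a j l \<longleftrightarrow> a j l = 0" if "j < m" "l < k" for j l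
    using Zq_mat_dvd_iff[of a q m k j l] a that by simp
  have *: "Zq_mat_diff q n k' s (minus_adj s M a) v l' = adj m k \<phi> M a v l' mod int q" if "v < n" "l' < k'" for v l'
    using that by (simp add: Zq_mat_diff_def mod_simps)
  show ?thesis
  proof (intro equalityI subsetI)
    fix y assume "y \<in> supp n k' (Zq_mat_diff q n k' s (minus_adj s M a))"
    then obtain v l' where y: "y = (v, l')" "v < n" "l' < k'" "adj m k \<phi> M a v l' mod int q \<noteq> 0"
      using * by (auto simp: supp_def)
    then have "adj m k \<phi> M a v l' \<noteq> 0" by auto
    then obtain j l where jl: "j < m" "l < k" "(v, l') = cell M j l" using adj_not_cell by blast
    then have "a j l \<noteq> 0" using adj_cell[OF M jl(1,2), of a] y by auto
    then show "y \<in> (\<lambda>(j, l). cell M j l) ` supp m k a"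
      using jl y by (auto simp: supp_def)
  next
    fix y assume "y \<in> (\<lambda>(j, l). cell M j l) ` supp m k a"
    then obtain j l where jl: "j < m" "l < k" "a j l \<noteq> 0" "y = cell M j l" by (auto simp: supp_def)
    have "\<not> int q dvd a j l" using az jl by simp
    then show "y \<in> supp n k' (Zq_mat_diff q n k' s (minus_adj s M a))"
      using * cell_bounds[OF M jl(1,2)] adj_cell[OF M jl(1,2), of a] jl
      by (auto simp: supp_def dvd_eq_mod_eq_0)
  qed
qed

text \<open>The difference of the two frequencies is a copy of \<open>a\<close> on the cells of
  \<open>M\<close>, so the absence of singleton rows becomes the pairing condition.\<close>

lemma paired_minus_adj:
  assumes M: "M \<in> PM" and s: "s \<in> VX" and a: "a \<in> VZ"
  shows "paired m k \<phi> M (supp n k' (Zq_mat_diff q n k' s (minus_adj s M a)))"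
  unfolding minus_adj_supp[OF assms] paired_def
proof clarify
  fix x y j l assume "(j, l) \<in> supp m k a"
  then have jl: "j < m" "l < k" "a j l \<noteq> 0" by (auto simp: supp_def)
  then obtain l' where l': "l' < k" "l' \<noteq> l" "a j l' \<noteq> 0"
    using a unfolding no_singleton_row_def by blast
  then have "cell M j l' \<in> (\<lambda>(j, l). cell M j l) ` supp m k a"
    using jl by (force simp: supp_def)
  then show "\<exists>i<m. \<exists>l1<k. \<exists>l2<k. l1 \<noteq> l2 \<and> cell M j l = cell M i l1 \<and>
      cell M i l2 \<in> (\<lambda>(j, l). cell M j l) ` supp m k a"
    using jl l' by blast
qed

lemma inj_on_minus_adj:
  assumes M: "M \<in> PM"
  shows "inj_on (minus_adj s M) VZ"
proof (rule inj_onI)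
  fix a b assume a: "a \<in> VZ" and b: "b \<in> VZ" and eq: "minus_adj s M a = minus_adj s M b"
  show "a = b"
  proof (rule Zq_mat_eqI)
    fix j l assume jl: "j < m" "l < k"
    have "minus_adj s M a (M j l) (\<phi> l) = minus_adj s M b (M j l) (\<phi> l)" using eq by simp
    then have "(s (M j l) (\<phi> l) - a j l) mod int q = (s (M j l) (\<phi> l) - b j l) mod int q"
      using cell_bounds[OF M jl] adj_cell[OF M jl] by (simp add: Zq_mat_diff_def)
    then have "int q dvd (s (M j l) (\<phi> l) - b j l) - (s (M j l) (\<phi> l) - a j l)"
      by (metis mod_eq_dvd_iff)
    then show "int q dvd a j l - b j l" by simp
  qed (use a b in auto)
qed

text \<open>For fixed \<open>M\<close> the source frequency determines \<open>a\<close>, and it can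
  occur only if its difference from \<open>s\<close> is covered by \<open>M\<close>. Exchanging the
  sums then counts the matchings that cover a fixed difference.\<close>

lemma sum_minus_adj_le:
  assumes s: "s \<in> VX" and g: "\<And>s'. 0 \<le> g s'"
  shows "(\<Sum>M\<in>PM. \<Sum>a\<in>{a \<in> VZ. Q (minus_adj s M a)}. g (minus_adj s M a)) \<le>
    (\<Sum>s'\<in>{s' \<in> VX. Q s'}. g s' * real (card {M \<in> PM. paired m k \<phi> M (supp n k' (Zq_mat_diff q n k' s s'))}))"
proof -
  have "(\<Sum>M\<in>PM. \<Sum>a\<in>{a \<in> VZ. Q (minus_adj s M a)}. g (minus_adj s M a)) \<le>
      (\<Sum>M\<in>PM. \<Sum>s'\<in>{s' \<in> VX. Q s'}. if paired m k \<phi> M (supp n k' (Zq_mat_diff q n k' s s')) then g s' else 0)"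
  proof (rule sum_mono)
    fix M assume M: "M \<in> PM"
    have inj': "inj_on (minus_adj s M) {a \<in> VZ. Q (minus_adj s M a)}"
      by (rule inj_on_subset[OF inj_on_minus_adj[OF M]]) auto
    have "(\<Sum>a\<in>{a \<in> VZ. Q (minus_adj s M a)}. g (minus_adj s M a)) =
        (\<Sum>s'\<in>minus_adj s M ` {a \<in> VZ. Q (minus_adj s M a)}. g s')"
      by (simp only: sum.reindex[OF inj'] comp_def)
    also have "\<dots> \<le> (\<Sum>s'\<in>{s' \<in> VX. Q s' \<and> paired m k \<phi> M (supp n k' (Zq_mat_diff q n k' s s'))}. g s')"
      using paired_minus_adj[OF M s] q g by (intro sum_mono2) auto
    also have "\<dots> = (\<Sum>s'\<in>{s' \<in> VX. Q s'}. if paired m k \<phi> M (supp n k' (Zq_mat_diff q n k' s s')) then g s' else 0)"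
      by (subst sum.inter_filter[symmetric]) (auto intro!: sum.cong)
    finally show "(\<Sum>a\<in>{a \<in> VZ. Q (minus_adj s M a)}. g (minus_adj s M a)) \<le>
      (\<Sum>s'\<in>{s' \<in> VX. Q s'}. if paired m k \<phi> M (supp n k' (Zq_mat_diff q n k' s s')) then g s' else 0)" .
  qed
  also have "\<dots> = (\<Sum>s'\<in>{s' \<in> VX. Q s'}. g s' * real (card {M \<in> PM. paired m k \<phi> M (supp n k' (Zq_mat_diff q n k' s s'))}))"
    by (subst sum.swap) (simp add: sum.inter_filter[symmetric] mult.commute)
  finally show ?thesis .
qed

lemma supp_subset_diff:
  assumes "s' \<in> VX"
  shows "supp n k' s' \<subseteq> supp n k' s \<union> supp n k' (Zq_mat_diff q n k' s s')"
proof
  fix y assume y: "y \<in> supp n k' s'"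
  then obtain v l where vl: "y = (v, l)" "v < n" "l < k'" "s' v l \<noteq> 0" by (auto simp: supp_def)
  then have "\<not> int q dvd s' v l" using Zq_mat_dvd_iff[OF assms, of v l] by simp
  then show "y \<in> supp n k' s \<union> supp n k' (Zq_mat_diff q n k' s s')"
    using vl by (cases "s v l = 0") (auto simp: supp_def Zq_mat_diff_def dvd_eq_mod_eq_0[symmetric])
qed

lemma sum_sq_ftX_le_1:
  assumes "\<And>X. X \<in> VX \<Longrightarrow> cmod (u X) \<le> 1"
  shows "(\<Sum>s\<in>VX. (cmod (ftX u s))\<^sup>2) \<le> 1"
proof -
  have "(\<Sum>X\<in>VX. (cmod (u X))\<^sup>2) \<le> (\<Sum>X\<in>VX. 1)"
    using assms by (intro sum_mono) (simp add: power_le_one)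
  then show ?thesis using q by (simp add: parseval card_Zq_mat)
qed

text \<open>
  Contribution of the frequencies of weight above \<open>S\<close>: Cauchy--Schwarz and Parseval leave the
  probability that the difference of the two frequencies, which has large support, is covered by
  the random hypermatching.
\<close>

lemma high_frequencies_le:
  assumes s: "s \<in> VX" and u: "\<And>X. X \<in> VX \<Longrightarrow> cmod (u X) \<le> 1" and \<eta>: "0 \<le> \<eta>"
    and cov: "\<And>d. S - real (wt s) < real d \<Longrightarrow> d \<le> k * m \<Longrightarrow> (4 * sqrt (real d / real n)) ^ d \<le> \<eta>\<^sup>2"
  shows "(\<Sum>M\<in>PM. \<Sum>w\<in>W. cmod (\<Sum>a\<in>{a \<in> VZ. S < real (wt (minus_adj s M a))}.
      msg_ft q m k (h M) w a * noise_ft a * ftX u (minus_adj s M a))) \<le> real (card PM) * (real (card W) * \<eta>)"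
proof -
  define H where "H M = {a \<in> VZ. S < real (wt (minus_adj s M a))}" for M
  define B where "B M = sqrt (\<Sum>a\<in>H M. (cmod (ftX u (minus_adj s M a)))\<^sup>2)" for M
  have finH: "finite (H M)" for M by (simp add: H_def)
  \<comment> \<open>Each message is bounded separately here. The resulting factor
    \<open>card W\<close> is affordable because \<eta> will be exponentially small in n.\<close>
  have cs: "cmod (\<Sum>a\<in>H M. msg_ft q m k (h M) w a * noise_ft a * ftX u (minus_adj s M a)) \<le> B M" for M w
  proof -
    have "cmod (\<Sum>a\<in>H M. msg_ft q m k (h M) w a * noise_ft a * ftX u (minus_adj s M a)) \<le>
        (\<Sum>a\<in>H M. \<bar>cmod (msg_ft q m k (h M) w a)\<bar> * \<bar>cmod (ftX u (minus_adj s M a))\<bar>)"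
    proof (rule sum_norm_le)
      fix a
      show "cmod (msg_ft q m k (h M) w a * noise_ft a * ftX u (minus_adj s M a)) \<le>
          \<bar>cmod (msg_ft q m k (h M) w a)\<bar> * \<bar>cmod (ftX u (minus_adj s M a))\<bar>"
        using mult_left_mono[OF norm_noise_ft_le_1[of a], of "cmod (msg_ft q m k (h M) w a)"]
        by (simp add: norm_mult mult_right_mono)
    qed
    also have "\<dots> \<le> L2_set (\<lambda>a. cmod (msg_ft q m k (h M) w a)) (H M) * L2_set (\<lambda>a. cmod (ftX u (minus_adj s M a))) (H M)"
      by (rule L2_set_mult_ineq)
    also have "\<dots> \<le> 1 * B M"
    proof (rule mult_mono)
      have "(\<Sum>a\<in>H M. (cmod (msg_ft q m k (h M) w a))\<^sup>2) \<le> (\<Sum>a\<in>Zq_mat q m k. (cmod (msg_ft q m k (h M) w a))\<^sup>2)"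
        by (intro sum_mono2) (auto simp: H_def)
      also have "\<dots> = (\<Sum>Z\<in>Zq_mat q m k. (cmod (if h M Z = w then 1 else 0))\<^sup>2) / real (q ^ (m * k))"
        unfolding msg_ft_def using q by (rule parseval)
      also have "\<dots> \<le> (\<Sum>Z\<in>Zq_mat q m k. 1) / real (q ^ (m * k))"
        by (intro divide_right_mono sum_mono) auto
      also have "\<dots> = 1" using q by (simp add: card_Zq_mat)
      finally show "L2_set (\<lambda>a. cmod (msg_ft q m k (h M) w a)) (H M) \<le> 1"
        by (simp add: L2_set_def)
    qed (auto simp: L2_set_def B_def intro: sum_nonneg)
    finally show ?thesis by simp
  qed
  have "(\<Sum>M\<in>PM. (B M)\<^sup>2) = (\<Sum>M\<in>PM. \<Sum>a\<in>H M. (cmod (ftX u (minus_adj s M a)))\<^sup>2)"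
    by (simp add: B_def sum_nonneg)
  also have "\<dots> \<le> (\<Sum>s'\<in>{s' \<in> VX. S < real (wt s')}. (cmod (ftX u s'))\<^sup>2 *
      real (card {M \<in> PM. paired m k \<phi> M (supp n k' (Zq_mat_diff q n k' s s'))}))"
    unfolding H_def by (rule sum_minus_adj_le) (use s in auto)
  also have "\<dots> \<le> (\<Sum>s'\<in>{s' \<in> VX. S < real (wt s')}. (cmod (ftX u s'))\<^sup>2 * (real (card PM) * \<eta>\<^sup>2))"
  proof (intro sum_mono mult_left_mono)
    fix s' assume s': "s' \<in> {s' \<in> VX. S < real (wt s')}"
    define D where "D = supp n k' (Zq_mat_diff q n k' s s')"
    have "wt s' \<le> card (supp n k' s \<union> D)"
      unfolding D_def using s' by (intro card_mono supp_subset_diff) auto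
    also have "\<dots> \<le> wt s + card D" by (rule card_Un_le)
    finally have big: "S - real (wt s) < real (card D)" using s' by simp
    show "real (card {M \<in> PM. paired m k \<phi> M D}) \<le> real (card PM) * \<eta>\<^sup>2"
    proof (cases "card D \<le> k * m")
      case True
      have "real (card {M \<in> PM. paired m k \<phi> M D}) \<le> real (card PM) * (4 * sqrt (real (card D) / real n)) ^ card D"
        by (rule card_paired_le[OF _ inj mn n]) (simp add: D_def)
      also have "\<dots> \<le> real (card PM) * \<eta>\<^sup>2"
        by (intro mult_left_mono cov big True) auto
      finally show ?thesis .
    next
      case False
      then have empty: "{M \<in> PM. paired m k \<phi> M D} = {}" using paired_card_le by blast
      show ?thesis unfolding empty by simp
    qed
  qed auto
  also have "\<dots> = (\<Sum>s'\<in>{s' \<in> VX. S < real (wt s')}. (cmod (ftX u s'))\<^sup>2) * (real (card PM) * \<eta>\<^sup>2)"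
    by (simp add: sum_distrib_right)
  also have "\<dots> \<le> 1 * (real (card PM) * \<eta>\<^sup>2)"
  proof (rule mult_right_mono)
    have "(\<Sum>s'\<in>{s' \<in> VX. S < real (wt s')}. (cmod (ftX u s'))\<^sup>2) \<le> (\<Sum>s'\<in>VX. (cmod (ftX u s'))\<^sup>2)"
      by (intro sum_mono2) auto
    then show "(\<Sum>s'\<in>{s' \<in> VX. S < real (wt s')}. (cmod (ftX u s'))\<^sup>2) \<le> 1"
      using sum_sq_ftX_le_1[of u] u by (meson order_trans)
  qed simp
  finally have B2: "(\<Sum>M\<in>PM. (B M)\<^sup>2) \<le> real (card PM) * \<eta>\<^sup>2" by simp
  have PM0: "0 < real (card PM)"
    using PHM_nonempty[of m n k] mn by (simp add: card_gt_0_iff)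
  have "((\<Sum>M\<in>PM. B M) / real (card PM))\<^sup>2 \<le> (\<Sum>M\<in>PM. (B M)\<^sup>2) / real (card PM)"
    by (rule power_sum_le) auto
  also have "\<dots> \<le> \<eta>\<^sup>2"
    using B2 PM0 by (simp add: field_simps)
  finally have "(\<Sum>M\<in>PM. B M) / real (card PM) \<le> \<eta>"
    using \<eta> by (rule power2_le_imp_le)
  then have BM: "(\<Sum>M\<in>PM. B M) \<le> real (card PM) * \<eta>"
    using PM0 by (simp add: field_simps)
  have "(\<Sum>M\<in>PM. \<Sum>w\<in>W. cmod (\<Sum>a\<in>H M. msg_ft q m k (h M) w a * noise_ft a * ftX u (minus_adj s M a))) \<le>
      (\<Sum>M\<in>PM. \<Sum>w\<in>W. B M)"
    by (intro sum_mono cs)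
  also have "\<dots> = real (card W) * (\<Sum>M\<in>PM. B M)" by (simp add: sum_distrib_left)
  also have "\<dots> \<le> real (card W) * (real (card PM) * \<eta>)" by (intro mult_left_mono BM) auto
  finally show ?thesis unfolding H_def by (simp add: mult_ac)
qed

lemma ftX_next_state_split:
  assumes "M \<in> PM"
  shows "ftX (next_state M w u) s =
    (\<Sum>a\<in>{a \<in> VZ. real (wt (minus_adj s M a)) \<le> S}. msg_ft q m k (h M) w a * noise_ft a * ftX u (minus_adj s M a)) +
    (\<Sum>a\<in>{a \<in> VZ. S < real (wt (minus_adj s M a))}. msg_ft q m k (h M) w a * noise_ft a * ftX u (minus_adj s M a))"
proof -
  have "VZ = {a \<in> VZ. real (wt (minus_adj s M a)) \<le> S} \<union> {a \<in> VZ. S < real (wt (minus_adj s M a))}" by auto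
  then show ?thesis
    unfolding next_state_def ft_mult_msg_prob[OF assms]
    by (subst (1) \<open>VZ = _\<close>) (rule sum.union_disjoint, auto)
qed

lemma low_term_le:
  "cmod (\<Sum>a\<in>A. msg_ft q m k (h M) w a * noise_ft a * ftX u (minus_adj s M a)) \<le>
    (\<Sum>a\<in>A. cmod (msg_ft q m k (h M) w a) * cmod (ftX u (minus_adj s M a)))"
proof (rule sum_norm_le)
  fix a
  show "cmod (msg_ft q m k (h M) w a * noise_ft a * ftX u (minus_adj s M a)) \<le>
      cmod (msg_ft q m k (h M) w a) * cmod (ftX u (minus_adj s M a))"
    using mult_left_mono[OF norm_noise_ft_le_1[of a], of "cmod (msg_ft q m k (h M) w a)"]
    by (simp add: norm_mult mult_right_mono)
qed

text \<open>Low terms are regrouped by their source frequency, where the average over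
  \<open>M\<close> of the message weight leading to level \<omega> is known. High terms are bounded
  target by target, hence the number of frequencies of weight \<omega>; from a source above
  \<open>S\<close> to a target of weight \<omega> the difference has more than S - \<omega>
  vertices.\<close>

lemma level_norm_step:
  assumes \<omega>: "\<omega> \<le> c" and u: "\<And>X. X \<in> VX \<Longrightarrow> cmod (u X) \<le> 1" and \<eta>: "0 \<le> \<eta>"
    and cov: "\<And>d. S - real \<omega> < real d \<Longrightarrow> d \<le> k * m \<Longrightarrow> (4 * sqrt (real d / real n)) ^ d \<le> \<eta>\<^sup>2"
    and small: "4 * sqrt (S / real n) \<le> 1"
  shows "(\<Sum>M\<in>PM. \<Sum>w\<in>W. level_norm \<omega> (next_state M w u)) \<le>
    real (card PM) * ((\<Sum>s\<in>{s \<in> VX. real (wt s) \<le> S}. cmod (ftX u s) * ((2 * real (q ^ k)) ^ wt s *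
      (\<Sum>v\<le>\<omega>. envelope x v * (4 * sqrt (real (wt s) / real n)) ^ (wt s - (\<omega> - v)))))
      + real (card {s \<in> VX. wt s = \<omega>}) * (real (card W) * \<eta>))"
proof -
  define V\<omega> where "V\<omega> = {s \<in> VX. wt s = \<omega>}"
  define Lo where "Lo s M = {a \<in> VZ. real (wt (minus_adj s M a)) \<le> S}" for s M
  define Hi where "Hi s M = {a \<in> VZ. S < real (wt (minus_adj s M a))}" for s M
  let ?t = "\<lambda>M w s a. msg_ft q m k (h M) w a * noise_ft a * ftX u (minus_adj s M a)"
  have "(\<Sum>M\<in>PM. \<Sum>w\<in>W. level_norm \<omega> (next_state M w u)) \<le>
     (\<Sum>M\<in>PM. \<Sum>w\<in>W. \<Sum>s\<in>V\<omega>. (\<Sum>a\<in>Lo s M. cmod (msg_ft q m k (h M) w a) * cmod (ftX u (minus_adj s M a)))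
        + cmod (\<Sum>a\<in>Hi s M. ?t M w s a))"
    unfolding level_norm_def V\<omega>_def[symmetric]
  proof (intro sum_mono)
    fix M w s assume "M \<in> PM"
    show "cmod (ftX (next_state M w u) s) \<le>
       (\<Sum>a\<in>Lo s M. cmod (msg_ft q m k (h M) w a) * cmod (ftX u (minus_adj s M a)))
        + cmod (\<Sum>a\<in>Hi s M. ?t M w s a)"
      unfolding ftX_next_state_split[OF \<open>M \<in> PM\<close>, of w u s S] Lo_def[symmetric] Hi_def[symmetric]
      by (rule order_trans[OF norm_triangle_ineq]) (intro add_right_mono low_term_le)
  qed
  also have "\<dots> = (\<Sum>M\<in>PM. \<Sum>w\<in>W. \<Sum>s\<in>V\<omega>. \<Sum>a\<in>Lo s M. cmod (msg_ft q m k (h M) w a) * cmod (ftX u (minus_adj s M a)))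
     + (\<Sum>s\<in>V\<omega>. \<Sum>M\<in>PM. \<Sum>w\<in>W. cmod (\<Sum>a\<in>Hi s M. ?t M w s a))"
    by (simp only: sum.distrib sum.swap[where B = V\<omega> and A = W] sum.swap[where B = V\<omega> and A = PM])
  also have "(\<Sum>s\<in>V\<omega>. \<Sum>M\<in>PM. \<Sum>w\<in>W. cmod (\<Sum>a\<in>Hi s M. ?t M w s a)) \<le>
      (\<Sum>s\<in>V\<omega>. real (card PM) * (real (card W) * \<eta>))"
    unfolding Hi_def using u \<eta> cov
    by (intro sum_mono high_frequencies_le) (auto simp: V\<omega>_def)
  also have "\<dots> = real (card PM) * (real (card V\<omega>) * (real (card W) * \<eta>))" by simp
  also have "(\<Sum>M\<in>PM. \<Sum>w\<in>W. \<Sum>s\<in>V\<omega>. \<Sum>a\<in>Lo s M. cmod (msg_ft q m k (h M) w a) * cmod (ftX u (minus_adj s M a))) =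
      (\<Sum>M\<in>PM. \<Sum>s\<in>V\<omega>. \<Sum>a\<in>Lo s M. msg_weight M a * cmod (ftX u (minus_adj s M a)))"
  proof (rule sum.cong[OF refl])
    fix M
    have "(\<Sum>w\<in>W. \<Sum>s\<in>V\<omega>. \<Sum>a\<in>Lo s M. cmod (msg_ft q m k (h M) w a) * cmod (ftX u (minus_adj s M a))) =
        (\<Sum>s\<in>V\<omega>. \<Sum>a\<in>Lo s M. \<Sum>w\<in>W. cmod (msg_ft q m k (h M) w a) * cmod (ftX u (minus_adj s M a)))"
      by (subst sum.swap, rule sum.cong[OF refl], rule sum.swap)
    then show "(\<Sum>w\<in>W. \<Sum>s\<in>V\<omega>. \<Sum>a\<in>Lo s M. cmod (msg_ft q m k (h M) w a) * cmod (ftX u (minus_adj s M a))) =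
        (\<Sum>s\<in>V\<omega>. \<Sum>a\<in>Lo s M. msg_weight M a * cmod (ftX u (minus_adj s M a)))"
      by (simp add: msg_weight_def sum_distrib_right)
  qed
  also have "\<dots> = (\<Sum>M\<in>PM. \<Sum>s\<in>{s \<in> VX. real (wt s) \<le> S}. cmod (ftX u s) *
      (\<Sum>a\<in>{a \<in> VZ. wt (plus_adj s M a) = \<omega>}. msg_weight M a))"
  proof (rule sum.cong[OF refl])
    fix M
    have "(\<Sum>s\<in>V\<omega>. \<Sum>a\<in>Lo s M. msg_weight M a * cmod (ftX u (minus_adj s M a))) =
        (\<Sum>(s, a)\<in>(SIGMA s:V\<omega>. Lo s M). msg_weight M a * cmod (ftX u (minus_adj s M a)))"
      by (rule sum.Sigma) (auto simp: V\<omega>_def Lo_def)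
    \<comment> \<open>Change of variables from the target frequency to the source, for fixed
      \<open>a\<close>.\<close>
    also have "\<dots> = (\<Sum>(s, a)\<in>(SIGMA s:{s \<in> VX. real (wt s) \<le> S}. {a \<in> VZ. wt (plus_adj s M a) = \<omega>}).
        msg_weight M a * cmod (ftX u s))"
      by (rule sum.reindex_bij_witness[where i = "\<lambda>(s, a). (plus_adj s M a, a)" and j = "\<lambda>(s, a). (minus_adj s M a, a)"])
        (use q in \<open>auto simp: V\<omega>_def Lo_def Zq_mat_diff_add_cancel\<close>)
    also have "\<dots> = (\<Sum>s\<in>{s \<in> VX. real (wt s) \<le> S}. \<Sum>a\<in>{a \<in> VZ. wt (plus_adj s M a) = \<omega>}.
        msg_weight M a * cmod (ftX u s))"
      by (rule sum.Sigma[symmetric]) auto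
    finally show "(\<Sum>s\<in>V\<omega>. \<Sum>a\<in>Lo s M. msg_weight M a * cmod (ftX u (minus_adj s M a))) =
       (\<Sum>s\<in>{s \<in> VX. real (wt s) \<le> S}. cmod (ftX u s) * (\<Sum>a\<in>{a \<in> VZ. wt (plus_adj s M a) = \<omega>}. msg_weight M a))"
      by (simp add: sum_distrib_left mult.commute)
  qed
  also have "\<dots> = (\<Sum>s\<in>{s \<in> VX. real (wt s) \<le> S}. cmod (ftX u s) *
      (\<Sum>M\<in>PM. \<Sum>a\<in>{a \<in> VZ. wt (plus_adj s M a) = \<omega>}. msg_weight M a))"
    by (subst sum.swap) (simp add: sum_distrib_left)
  also have "\<dots> \<le> (\<Sum>s\<in>{s \<in> VX. real (wt s) \<le> S}. cmod (ftX u s) *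
      (real (card PM) * ((2 * real (q ^ k)) ^ wt s *
      (\<Sum>v\<le>\<omega>. envelope x v * (4 * sqrt (real (wt s) / real n)) ^ (wt s - (\<omega> - v))))))"
  proof (intro sum_mono mult_left_mono average_msg_weight_le)
    fix s assume s: "s \<in> {s \<in> VX. real (wt s) \<le> S}"
    then have "4 * sqrt (real (wt s) / real n) \<le> 4 * sqrt (S / real n)"
      by (intro mult_left_mono real_sqrt_le_mono divide_right_mono) auto
    then show "4 * sqrt (real (wt s) / real n) \<le> 1" using small by linarith
  qed (use \<omega> in auto)
  also have "\<dots> = real (card PM) * (\<Sum>s\<in>{s \<in> VX. real (wt s) \<le> S}. cmod (ftX u s) *
      ((2 * real (q ^ k)) ^ wt s *
      (\<Sum>v\<le>\<omega>. envelope x v * (4 * sqrt (real (wt s) / real n)) ^ (wt s - (\<omega> - v)))))"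
    by (simp add: sum_distrib_left mult_ac)
  finally show ?thesis
    unfolding V\<omega>_def by (simp add: distrib_left)
qed

section \<open>The coefficient at frequency 0\<close>

definition zeroX :: zmat where "zeroX = (\<lambda>v\<in>{..<n}. \<lambda>l\<in>{..<k'}. 0)"
definition zeroZ :: zmat where "zeroZ = (\<lambda>j\<in>{..<m}. \<lambda>l\<in>{..<k}. 0)"

lemma zeroX: "zeroX \<in> VX" and zeroZ: "zeroZ \<in> VZ"
  using q by (auto simp: zeroX_def zeroZ_def Zq_mat_def Zq_def no_singleton_row_def)

lemma supp_zeroX [simp]: "supp n k' zeroX = {}"
  by (auto simp: supp_def zeroX_def)

lemma supp_empty_iff:
  assumes "s \<in> VX"
  shows "supp n k' s = {} \<longleftrightarrow> s = zeroX"
proof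
  assume *: "supp n k' s = {}"
  show "s = zeroX"
  proof (rule Zq_mat_eqI[OF assms zeroX])
    fix v l assume vl: "v < n" "l < k'"
    then have "s v l = 0" using * by (auto simp: supp_def)
    then show "int q dvd s v l - zeroX v l" using vl by (simp add: zeroX_def)
  qed
qed simp

lemma adj_zeroZ: "adj m k \<phi> M zeroZ = (\<lambda>_ _. 0)"
  by (auto simp: adj_def zeroZ_def fun_eq_iff intro!: sum.neutral)

lemma minus_adj_zeroZ:
  assumes "s \<in> VX"
  shows "minus_adj s M zeroZ = s"
  by (rule Zq_mat_eqI[OF Zq_mat_diff_in[OF q] assms])
    (auto simp: adj_zeroZ Zq_mat_diff_def mod_eq_dvd_iff[symmetric])

lemma noise_ft_zeroZ: "noise_ft zeroZ = 1"
proof -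
  have "chr q m k zeroZ Y = 1" for Y
    unfolding chr_def zeroZ_def by (intro prod.neutral ballI) auto
  then show ?thesis by (simp add: noise_ft_def)
qed

lemma supp_diff_zeroX:
  assumes "s \<in> VX"
  shows "supp n k' (Zq_mat_diff q n k' zeroX s) = supp n k' s"
  using Zq_mat_dvd_iff[OF assms]
  by (auto simp: supp_def Zq_mat_diff_def zeroX_def dvd_eq_mod_eq_0[symmetric])

text \<open>The term of \<open>zeroZ\<close> is subtracted because \<open>msg_ft\<close> at 0 is the
  message probability for uniform \<open>Z\<close>, that is the NO case. In every other low term a
  source of positive weight is moved to 0, so its whole support has to be covered by the
  hypermatching.\<close>

lemma drift_step:
  assumes u: "\<And>X. X \<in> VX \<Longrightarrow> cmod (u X) \<le> 1" and \<eta>: "0 \<le> \<eta>" and S: "0 \<le> S"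
    and cov: "\<And>d. S < real d \<Longrightarrow> d \<le> k * m \<Longrightarrow> (4 * sqrt (real d / real n)) ^ d \<le> \<eta>\<^sup>2"
  shows "(\<Sum>M\<in>PM. \<Sum>w\<in>W. cmod (ftX (next_state M w u) zeroX - msg_ft q m k (h M) w zeroZ * ftX u zeroX)) \<le>
    real (card PM) * ((\<Sum>s\<in>{s \<in> VX. real (wt s) \<le> S \<and> 0 < wt s}.
      cmod (ftX u s) * (4 * sqrt (real (wt s) / real n)) ^ wt s) + real (card W) * \<eta>)"
proof -
  let ?t = "\<lambda>M w a. msg_ft q m k (h M) w a * noise_ft a * ftX u (minus_adj zeroX M a)"
  define Lo where "Lo M = {a \<in> VZ. real (wt (minus_adj zeroX M a)) \<le> S \<and> 0 < wt (minus_adj zeroX M a)}" for M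
  define Hi where "Hi M = {a \<in> VZ. S < real (wt (minus_adj zeroX M a))}" for M
  have "(\<Sum>M\<in>PM. \<Sum>w\<in>W. cmod (ftX (next_state M w u) zeroX - msg_ft q m k (h M) w zeroZ * ftX u zeroX)) \<le>
     (\<Sum>M\<in>PM. \<Sum>w\<in>W. (\<Sum>a\<in>Lo M. cmod (msg_ft q m k (h M) w a) * cmod (ftX u (minus_adj zeroX M a)))
        + cmod (\<Sum>a\<in>Hi M. ?t M w a))"
  proof (intro sum_mono)
    fix M w assume M: "M \<in> PM"
    \<comment> \<open>By injectivity of \<open>minus_adj\<close>, only \<open>zeroZ\<close> has the
      zero frequency as its source.\<close>
    have "{a \<in> VZ. real (wt (minus_adj zeroX M a)) \<le> S} = insert zeroZ (Lo M)"
    proof (intro equalityI subsetI)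
      fix a assume a: "a \<in> {a \<in> VZ. real (wt (minus_adj zeroX M a)) \<le> S}"
      show "a \<in> insert zeroZ (Lo M)"
      proof (cases "supp n k' (minus_adj zeroX M a) = {}")
        case True
        then have "minus_adj zeroX M a = minus_adj zeroX M zeroZ"
          using supp_empty_iff[of "minus_adj zeroX M a"] q by (simp add: minus_adj_zeroZ zeroX)
        then have "a = zeroZ" using inj_onD[OF inj_on_minus_adj[OF M]] a zeroZ by blast
        then show ?thesis by simp
      next
        case False
        then show ?thesis using a by (auto simp: Lo_def card_gt_0_iff)
      qed
    qed (use zeroZ S in \<open>auto simp: Lo_def minus_adj_zeroZ zeroX\<close>)
    moreover have "zeroZ \<notin> Lo M" by (simp add: Lo_def minus_adj_zeroZ zeroX)
    moreover have "finite (Lo M)" by (simp add: Lo_def)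
    ultimately have "ftX (next_state M w u) zeroX - msg_ft q m k (h M) w zeroZ * ftX u zeroX =
        (\<Sum>a\<in>Lo M. ?t M w a) + (\<Sum>a\<in>Hi M. ?t M w a)"
      unfolding ftX_next_state_split[OF M, of w u zeroX S] Hi_def
      by (simp add: minus_adj_zeroZ zeroX noise_ft_zeroZ)
    then show "cmod (ftX (next_state M w u) zeroX - msg_ft q m k (h M) w zeroZ * ftX u zeroX) \<le>
      (\<Sum>a\<in>Lo M. cmod (msg_ft q m k (h M) w a) * cmod (ftX u (minus_adj zeroX M a)))
        + cmod (\<Sum>a\<in>Hi M. ?t M w a)"
      by (simp only:) (rule order_trans[OF norm_triangle_ineq], intro add_right_mono low_term_le)
  qed
  also have "\<dots> = (\<Sum>M\<in>PM. \<Sum>w\<in>W. \<Sum>a\<in>Lo M. cmod (msg_ft q m k (h M) w a) * cmod (ftX u (minus_adj zeroX M a)))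
     + (\<Sum>M\<in>PM. \<Sum>w\<in>W. cmod (\<Sum>a\<in>Hi M. ?t M w a))"
    by (simp only: sum.distrib)
  also have "(\<Sum>M\<in>PM. \<Sum>w\<in>W. cmod (\<Sum>a\<in>Hi M. ?t M w a)) \<le> real (card PM) * (real (card W) * \<eta>)"
    unfolding Hi_def using u \<eta> cov zeroX
    by (intro high_frequencies_le) auto
  also have "(\<Sum>M\<in>PM. \<Sum>w\<in>W. \<Sum>a\<in>Lo M. cmod (msg_ft q m k (h M) w a) * cmod (ftX u (minus_adj zeroX M a))) =
      (\<Sum>M\<in>PM. \<Sum>a\<in>Lo M. msg_weight M a * cmod (ftX u (minus_adj zeroX M a)))"
    by (rule sum.cong[OF refl], subst sum.swap) (simp add: msg_weight_def sum_distrib_right)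
  also have "\<dots> \<le> (\<Sum>M\<in>PM. \<Sum>a\<in>Lo M. cmod (ftX u (minus_adj zeroX M a)))"
    using msg_weight_le_1 by (intro sum_mono mult_left_le_one_le) auto
  also have "\<dots> \<le> (\<Sum>s\<in>{s \<in> VX. real (wt s) \<le> S \<and> 0 < wt s}. cmod (ftX u s) *
      real (card {M \<in> PM. paired m k \<phi> M (supp n k' (Zq_mat_diff q n k' zeroX s))}))"
    unfolding Lo_def by (rule sum_minus_adj_le) (use zeroX in auto)
  also have "\<dots> \<le> (\<Sum>s\<in>{s \<in> VX. real (wt s) \<le> S \<and> 0 < wt s}. cmod (ftX u s) *
      (real (card PM) * (4 * sqrt (real (wt s) / real n)) ^ wt s))"
  proof (intro sum_mono mult_left_mono)
    fix s assume "s \<in> {s \<in> VX. real (wt s) \<le> S \<and> 0 < wt s}"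
    then show "real (card {M \<in> PM. paired m k \<phi> M (supp n k' (Zq_mat_diff q n k' zeroX s))}) \<le>
        real (card PM) * (4 * sqrt (real (wt s) / real n)) ^ wt s"
      using card_paired_le[OF finite_supp inj mn n] by (simp only: mem_Collect_eq supp_diff_zeroX)
  qed simp
  also have "\<dots> = real (card PM) * (\<Sum>s\<in>{s \<in> VX. real (wt s) \<le> S \<and> 0 < wt s}.
      cmod (ftX u s) * (4 * sqrt (real (wt s) / real n)) ^ wt s)"
    by (simp add: sum_distrib_left mult_ac)
  finally show ?thesis by (simp add: distrib_left)
qed

end

subsection \<open>Propagation of the envelope\<close>

lemma finite_real_le [simp]: "finite {w::nat. real w \<le> S}"
  by (rule finite_subset[of _ "{..nat \<lfloor>S\<rfloor>}"]) (auto simp: le_nat_floor)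

lemma sum_power_tail_le:
  fixes g :: real
  assumes g: "0 \<le> g" "g \<le> 1 / 2" and A: "finite A" "A \<subseteq> {Suc y..}"
  shows "(\<Sum>w\<in>A. g ^ w) \<le> 2 * g ^ Suc y"
proof -
  \<comment> \<open>Twice the next term pays for the rest of the series, since g \<le> 1 /
    2.\<close>
  have *: "(\<Sum>w\<in>{Suc y..<Suc y + j}. g ^ w) + 2 * g ^ (Suc y + j) \<le> 2 * g ^ Suc y" for j
  proof (induction j)
    case (Suc j)
    have "2 * g * g ^ (Suc y + j) \<le> 1 * g ^ (Suc y + j)"
      using g by (intro mult_right_mono) auto
    then have "(\<Sum>w\<in>{Suc y..<Suc y + Suc j}. g ^ w) + 2 * g ^ (Suc y + Suc j) \<le>
      (\<Sum>w\<in>{Suc y..<Suc y + j}. g ^ w) + 2 * g ^ (Suc y + j)"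
      by (simp add: mult.assoc)
    with Suc.IH show ?case by linarith
  qed simp
  from A(1) obtain N where "A \<subseteq> {..<N}" by (metis finite_nat_iff_bounded)
  then have "A \<subseteq> {Suc y..<Suc y + N}" using A(2) by force
  then have "(\<Sum>w\<in>A. g ^ w) \<le> (\<Sum>w\<in>{Suc y..<Suc y + N}. g ^ w)"
    using g by (intro sum_mono2) auto
  also have "\<dots> \<le> 2 * g ^ Suc y"
    using *[of N] zero_le_power[OF g(1), of "Suc y + N"] by linarith
  finally show ?thesis .
qed

lemma envelope_0 [simp]: "envelope x 0 = 1"
  by (simp add: envelope_def)

lemma envelope_ge_0 [simp]: "0 \<le> x \<Longrightarrow> 0 \<le> envelope x w"
  by (simp add: envelope_def)

lemma envelope_mono: "0 \<le> x \<Longrightarrow> x \<le> y \<Longrightarrow> envelope x w \<le> envelope y w"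
  unfolding envelope_def by (intro real_sqrt_le_mono divide_right_mono power_mono) auto

lemma envelope_mono_level:
  assumes "v \<le> w" "real w \<le> x"
  shows "envelope x v \<le> envelope x w"
  unfolding envelope_def by (intro real_sqrt_le_mono power_div_fact_mono assms)

text \<open>Because of the square root, a loss of \<open>b\<close> per unit of weight is a factor
  \<open>b\<^sup>2\<close> in the argument. All losses of the form constant^w enter \<theta> in this
  way.\<close>

lemma envelope_scale:
  assumes "0 \<le> b"
  shows "b ^ w * envelope x w = envelope (b\<^sup>2 * x) w"
proof -
  have eq: "(b\<^sup>2 * x) ^ w / fact w = (b ^ w)\<^sup>2 * (x ^ w / fact w)"
    by (simp add: power_mult_distrib power_mult[symmetric] mult.commute)
  show ?thesis unfolding envelope_def eq real_sqrt_mult using assms by simp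
qed

text \<open>The covering probability (w / n)^((w - y) / 2) cancels the surplus of n^(w / 2) /
  sqrt(w!) over n^(y / 2) / sqrt(y!) and leaves a small base to the power w. In 48 = 16 * 3 the 16
  is the square of the 4 of the covering bound, and the 3 comes from w^w \<le> 3^w w!.\<close>

lemma envelope_mult_cover:
  assumes n: "0 < n" and \<theta>: "0 \<le> \<theta>" and B: "0 \<le> B" and yw: "y \<le> w"
  shows "envelope (\<theta> * n) w * (B ^ w * (4 * sqrt (real w / n)) ^ (w - y)) \<le>
    sqrt (48 * B\<^sup>2 * \<theta>) ^ w * sqrt (n ^ y / fact y)"
proof -
  have f: "real w ^ (w - y) / fact w \<le> 3 ^ w / fact y"
  proof (cases "w = 0")
    case False
    have "(fact y :: real) \<le> real w ^ y"
    proof -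
      have "(fact y :: real) \<le> real y ^ y" using fact_le_power[of y, where ?'a = real] by simp
      also have "\<dots> \<le> real w ^ y" using yw by (intro power_mono) auto
      finally show ?thesis .
    qed
    then have "real w ^ (w - y) * fact y \<le> real w ^ (w - y) * real w ^ y"
      by (intro mult_left_mono) auto
    also have "\<dots> = real w ^ w" using yw by (simp flip: power_add)
    also have "\<dots> \<le> 3 ^ w * fact w" by (rule power_self_le_fact)
    finally show ?thesis by (simp add: field_simps)
  qed (use yw in auto)
  have "(4 * sqrt (real w / n)) ^ (w - y) = sqrt ((16 * real w / n) ^ (w - y))"
  proof -
    have "4 * sqrt (real w / n) = sqrt (16 * real w / n)"
      using n by (simp add: real_sqrt_mult real_sqrt_divide)
    then show ?thesis using n by (simp add: real_sqrt_power)
  qed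
  moreover have "B ^ w = sqrt ((B\<^sup>2) ^ w)"
    using B by (simp add: real_sqrt_power)
  ultimately have "envelope (\<theta> * n) w * (B ^ w * (4 * sqrt (real w / n)) ^ (w - y)) =
      sqrt ((\<theta> * n) ^ w / fact w * ((B\<^sup>2) ^ w * (16 * real w / n) ^ (w - y)))"
    by (simp only: envelope_def real_sqrt_mult)
  also have "\<dots> \<le> sqrt ((48 * B\<^sup>2 * \<theta>) ^ w * (n ^ y / fact y))"
  proof (rule real_sqrt_le_mono)
    have nn: "n ^ w = n ^ y * n ^ (w - y)" using yw by (simp flip: power_add)
    have "(\<theta> * n) ^ w / fact w * ((B\<^sup>2) ^ w * (16 * real w / n) ^ (w - y)) =
        (B\<^sup>2 * \<theta>) ^ w * 16 ^ (w - y) * n ^ y * (real w ^ (w - y) / fact w)"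
      using n by (simp add: power_mult_distrib power_divide nn)
    also have "\<dots> \<le> (B\<^sup>2 * \<theta>) ^ w * 16 ^ w * n ^ y * (3 ^ w / fact y)"
      using n \<theta> by (intro mult_mono[OF mult_mono[OF mult_mono[OF order_refl power_increasing] order_refl] f]) auto
    also have "\<dots> = ((3::real) * 16) ^ w * (B\<^sup>2 * \<theta>) ^ w * (n ^ y / fact y)"
      by (simp only: power_mult_distrib) simp
    also have "\<dots> = (48 * B\<^sup>2 * \<theta>) ^ w * (n ^ y / fact y)"
      by (simp add: power_mult_distrib)
    finally show "(\<theta> * n) ^ w / fact w * ((B\<^sup>2) ^ w * (16 * real w / n) ^ (w - y)) \<le>
       (48 * B\<^sup>2 * \<theta>) ^ w * (n ^ y / fact y)" .
  qed
  also have "\<dots> = sqrt (48 * B\<^sup>2 * \<theta>) ^ w * sqrt (n ^ y / fact y)"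
    unfolding real_sqrt_mult[of "(48 * B\<^sup>2 * \<theta>) ^ w"] real_sqrt_power[of "48 * B\<^sup>2 * \<theta>"] ..
  finally show ?thesis .
qed

lemma Suc_le_two_power: "real (Suc y) \<le> 2 ^ y"
  by (induction y) auto

text \<open>The sum is split at \<open>y\<close>. Up to \<open>y\<close> no vertex need be covered;
  the terms are monotone and their number is at most 2^y. Beyond \<open>y\<close> they are dominated
  by a geometric series, whose ratio is at most 1 / 2 by the assumption on \<theta>. Each part is at
  most one envelope.\<close>

lemma cover_sum_le:
  assumes n: "0 < n" and \<theta>: "0 \<le> \<theta>" "48 * B\<^sup>2 * \<theta> \<le> 1 / 4" and B: "1 \<le> B"
    and y: "real y \<le> \<theta> * n"
  shows "(\<Sum>w\<in>{w. real w \<le> S}. envelope (\<theta> * n) w * (B ^ w * (4 * sqrt (real w / n)) ^ (w - y))) \<le>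
    2 * envelope (48 * B\<^sup>2 * \<theta> * n) y"
proof -
  define f where "f w = envelope (\<theta> * n) w * (B ^ w * (4 * sqrt (real w / n)) ^ (w - y))" for w
  define g where "g = sqrt (48 * B\<^sup>2 * \<theta>)"
  have B2: "1 \<le> B\<^sup>2" using B by simp
  have g: "0 \<le> g" "g \<le> 1 / 2"
  proof -
    show "g \<le> 1 / 2" unfolding g_def using \<theta>(2) by (intro real_le_lsqrt) (auto simp: power2_eq_square)
  qed (use \<theta> in \<open>simp add: g_def\<close>)
  have nonneg: "0 \<le> f w" for w using n \<theta> B by (auto simp: f_def)
  have y2: "real y \<le> B\<^sup>2 * (\<theta> * n)"
    using mult_right_mono[OF B2, of "\<theta> * n"] n \<theta> y by (simp add: less_imp_le)
  have small: "f w \<le> envelope (B\<^sup>2 * (\<theta> * n)) y" if "w \<le> y" for w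
  proof -
    have "f w = B ^ w * envelope (\<theta> * n) w" using that by (simp add: f_def)
    also have "\<dots> = envelope (B\<^sup>2 * (\<theta> * n)) w" using B by (intro envelope_scale) auto
    also have "\<dots> \<le> envelope (B\<^sup>2 * (\<theta> * n)) y" by (intro envelope_mono_level that y2)
    finally show ?thesis .
  qed
  have "(\<Sum>w\<in>{..y}. f w) \<le> (\<Sum>w\<in>{..y}. envelope (B\<^sup>2 * (\<theta> * n)) y)"
    by (rule sum_mono) (use small in auto)
  also have "\<dots> = real (Suc y) * envelope (B\<^sup>2 * (\<theta> * n)) y" by simp
  also have "\<dots> \<le> 2 ^ y * envelope (B\<^sup>2 * (\<theta> * n)) y"
    using n \<theta> by (intro mult_right_mono Suc_le_two_power) auto
  also have "\<dots> = envelope (2\<^sup>2 * (B\<^sup>2 * (\<theta> * n))) y" by (rule envelope_scale) simp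
  also have "\<dots> \<le> envelope (48 * B\<^sup>2 * \<theta> * n) y"
    using n \<theta> by (intro envelope_mono) (auto simp: mult.assoc)
  finally have 1: "(\<Sum>w\<in>{..y}. f w) \<le> envelope (48 * B\<^sup>2 * \<theta> * n) y" .
  have "(\<Sum>w\<in>{w. real w \<le> S \<and> y < w}. f w) \<le> (\<Sum>w\<in>{w. real w \<le> S \<and> y < w}. g ^ w * sqrt (n ^ y / fact y))"
    unfolding f_def g_def using B \<theta> n by (intro sum_mono envelope_mult_cover) auto
  also have "\<dots> = (\<Sum>w\<in>{w. real w \<le> S \<and> y < w}. g ^ w) * sqrt (n ^ y / fact y)"
    by (simp only: sum_distrib_right)
  also have "\<dots> \<le> (2 * g ^ Suc y) * sqrt (n ^ y / fact y)"
    using n by (intro mult_right_mono sum_power_tail_le g) auto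
  also have "\<dots> \<le> g ^ y * sqrt (n ^ y / fact y)"
  proof (rule mult_right_mono)
    show "2 * g ^ Suc y \<le> g ^ y"
      using mult_right_mono[of "2 * g" 1 "g ^ y"] g by simp
  qed (use n in simp)
  also have "\<dots> = envelope (48 * B\<^sup>2 * \<theta> * n) y"
  proof -
    have eq: "(48 * B\<^sup>2 * \<theta> * n) ^ y / fact y = (48 * B\<^sup>2 * \<theta>) ^ y * (n ^ y / fact y)"
      by (simp add: power_mult_distrib)
    show ?thesis
      unfolding envelope_def eq g_def real_sqrt_mult[of "(48 * B\<^sup>2 * \<theta>) ^ y"]
        real_sqrt_power[of "48 * B\<^sup>2 * \<theta>"] ..
  qed
  finally have 2: "(\<Sum>w\<in>{w. real w \<le> S \<and> y < w}. f w) \<le> envelope (48 * B\<^sup>2 * \<theta> * n) y" .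
  have "(\<Sum>w\<in>{w. real w \<le> S}. f w) \<le> (\<Sum>w\<in>{..y} \<union> {w. real w \<le> S \<and> y < w}. f w)"
    using nonneg by (intro sum_mono2) (auto intro: finite_subset[OF _ finite_real_le[of S]])
  also have "\<dots> = (\<Sum>w\<in>{..y}. f w) + (\<Sum>w\<in>{w. real w \<le> S \<and> y < w}. f w)"
    by (rule sum.union_disjoint) (auto intro: finite_subset[OF _ finite_real_le[of S]])
  finally show ?thesis using 1 2 unfolding f_def by linarith
qed

text \<open>The product of two envelopes is an envelope times the root of a binomial coefficient, at
  most 2^(\<omega> / 2). With \<omega> + 1 \<le> 2^\<omega> summands and 2 \<le> 2^\<omega>, the
  loss per level is 4 sqrt 2, whose square is 32.\<close>

lemma envelope_convolution_le:
  assumes x: "0 \<le> x" and \<omega>: "1 \<le> \<omega>"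
  shows "(\<Sum>v\<le>\<omega>. envelope x v * (2 * envelope x (\<omega> - v))) \<le> envelope (32 * x) \<omega>"
proof -
  have "envelope x v * envelope x (\<omega> - v) \<le> sqrt 2 ^ \<omega> * envelope x \<omega>" if "v \<le> \<omega>" for v
  proof -
    have "envelope x v * envelope x (\<omega> - v) = sqrt (x ^ \<omega> * (1 / (fact v * fact (\<omega> - v))))"
      using that by (simp add: envelope_def real_sqrt_mult[symmetric] power_add[symmetric])
    also have "1 / (fact v * fact (\<omega> - v)) = real (\<omega> choose v) / (fact \<omega> :: real)"
      using that by (simp add: binomial_fact)
    also have "sqrt (x ^ \<omega> * (real (\<omega> choose v) / fact \<omega>)) \<le> sqrt (x ^ \<omega> * (2 ^ \<omega> / fact \<omega>))"
    proof (intro real_sqrt_le_mono mult_left_mono divide_right_mono)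
      show "real (\<omega> choose v) \<le> 2 ^ \<omega>"
        by (metis binomial_le_pow2 of_nat_le_iff of_nat_numeral of_nat_power)
    qed (use x in auto)
    also have "\<dots> = sqrt 2 ^ \<omega> * envelope x \<omega>"
    proof -
      have eq: "x ^ \<omega> * (2 ^ \<omega> / fact \<omega>) = 2 ^ \<omega> * (x ^ \<omega> / fact \<omega>)" by simp
      show ?thesis unfolding envelope_def eq real_sqrt_mult[of "2 ^ \<omega>"] real_sqrt_power[of 2] ..
    qed
    finally show ?thesis .
  qed
  then have "(\<Sum>v\<le>\<omega>. envelope x v * (2 * envelope x (\<omega> - v))) \<le> (\<Sum>v\<le>\<omega>. 2 * (sqrt 2 ^ \<omega> * envelope x \<omega>))"
    by (intro sum_mono) (auto simp: mult.left_commute)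
  also have "\<dots> = 2 * real (Suc \<omega>) * (sqrt 2 ^ \<omega> * envelope x \<omega>)" by simp
  also have "\<dots> \<le> (2 ^ \<omega> * 2 ^ \<omega>) * (sqrt 2 ^ \<omega> * envelope x \<omega>)"
  proof (intro mult_right_mono mult_mono Suc_le_two_power)
    show "(2::real) \<le> 2 ^ \<omega>" using \<omega> self_le_power[of "2::real" \<omega>] by simp
  qed (use x in auto)
  also have "\<dots> = (2 * 2 * sqrt 2) ^ \<omega> * envelope x \<omega>" by (simp only: power_mult_distrib mult.assoc)
  also have "\<dots> = envelope ((2 * 2 * sqrt 2)\<^sup>2 * x) \<omega>" by (rule envelope_scale) simp
  also have "(2 * 2 * sqrt 2)\<^sup>2 * x = 32 * x" by (simp add: power_mult_distrib)
  finally show ?thesis .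
qed

text \<open>The constant is 6144 = 48 * 32 * 4: from \<open>cover_sum_le\<close>, from
  \<open>envelope_convolution_le\<close>, and from doubling the result. The doubling absorbs
  \<open>H\<close>, since an envelope is at least 1 on the levels in question, and 2 \<le>
  2^\<omega> needs a positive level.\<close>

lemma numeric_step:
  assumes n: "0 < n" and \<theta>: "0 \<le> \<theta>" "48 * B\<^sup>2 * \<theta> \<le> 1 / 4" and B: "1 \<le> B"
    and \<omega>: "1 \<le> \<omega>" "real \<omega> \<le> \<theta> * n" and x: "0 \<le> x" "x \<le> \<theta> * n"
    and lam: "\<And>w. real w \<le> S \<Longrightarrow> lam w \<le> envelope (\<theta> * n) w"
    and high: "H \<le> 1"
  shows "(\<Sum>w\<in>{w. real w \<le> S}. lam w * (B ^ w *
      (\<Sum>v\<le>\<omega>. envelope x v * (4 * sqrt (real w / n)) ^ (w - (\<omega> - v))))) + H \<le>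
    envelope (6144 * B\<^sup>2 * \<theta> * n) \<omega>"
proof -
  define X where "X = 48 * B\<^sup>2 * \<theta> * n"
  have B2: "1 \<le> B\<^sup>2" using B by simp
  have "\<theta> * n \<le> 48 * B\<^sup>2 * (\<theta> * n)"
    using mult_right_mono[of 1 "48 * B\<^sup>2" "\<theta> * n"] B2 \<theta> n by simp
  then have xX: "x \<le> X" "real \<omega> \<le> X" using x \<omega> by (auto simp: X_def mult.assoc)
  have X0: "0 \<le> X" using x xX by linarith
  have "(\<Sum>w\<in>{w. real w \<le> S}. lam w * (B ^ w *
      (\<Sum>v\<le>\<omega>. envelope x v * (4 * sqrt (real w / n)) ^ (w - (\<omega> - v))))) \<le>
     (\<Sum>w\<in>{w. real w \<le> S}. envelope (\<theta> * n) w * (B ^ w *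
      (\<Sum>v\<le>\<omega>. envelope x v * (4 * sqrt (real w / n)) ^ (w - (\<omega> - v)))))"
    using lam B x n by (intro sum_mono mult_right_mono mult_nonneg_nonneg sum_nonneg) auto
  also have "\<dots> = (\<Sum>v\<le>\<omega>. envelope x v * (\<Sum>w\<in>{w. real w \<le> S}. envelope (\<theta> * n) w *
      (B ^ w * (4 * sqrt (real w / n)) ^ (w - (\<omega> - v)))))"
    unfolding sum_distrib_left by (subst sum.swap) (simp add: mult_ac)
  also have "\<dots> \<le> (\<Sum>v\<le>\<omega>. envelope x v * (2 * envelope X (\<omega> - v)))"
    unfolding X_def using \<theta> n B x \<omega>
    by (intro sum_mono mult_left_mono cover_sum_le) auto
  also have "\<dots> \<le> (\<Sum>v\<le>\<omega>. envelope X v * (2 * envelope X (\<omega> - v)))"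
    using x xX X0 by (intro sum_mono mult_right_mono envelope_mono) auto
  also have "\<dots> \<le> envelope (32 * X) \<omega>"
    using X0 \<omega>(1) by (rule envelope_convolution_le)
  finally have 1: "(\<Sum>w\<in>{w. real w \<le> S}. lam w * (B ^ w *
      (\<Sum>v\<le>\<omega>. envelope x v * (4 * sqrt (real w / n)) ^ (w - (\<omega> - v))))) \<le> envelope (32 * X) \<omega>" .
  have "1 \<le> envelope (32 * X) \<omega>"
    using envelope_mono_level[of 0 \<omega> "32 * X"] xX by simp
  with 1 high have "(\<Sum>w\<in>{w. real w \<le> S}. lam w * (B ^ w *
      (\<Sum>v\<le>\<omega>. envelope x v * (4 * sqrt (real w / n)) ^ (w - (\<omega> - v))))) + H \<le> 2 * envelope (32 * X) \<omega>"
    by linarith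
  also have "\<dots> \<le> 2 ^ \<omega> * envelope (32 * X) \<omega>"
    using \<omega> self_le_power[of "2::real" \<omega>] X0 by (intro mult_right_mono) auto
  also have "\<dots> = envelope (2\<^sup>2 * (32 * X)) \<omega>" by (rule envelope_scale) simp
  also have "2\<^sup>2 * (32 * X) = 6144 * B\<^sup>2 * \<theta> * n" by (simp add: X_def)
  finally show ?thesis .
qed

text \<open>With target level 0 and B = 1 the covering estimate leaves a geometric series. It starts
  at w = 1, so the sum is of order sqrt \<theta> and not of order 1.\<close>

lemma numeric_drift:
  assumes n: "0 < n" and \<theta>: "0 \<le> \<theta>" "48 * \<theta> \<le> 1 / 4"
    and lam: "\<And>w. real w \<le> S \<Longrightarrow> lam w \<le> envelope (\<theta> * n) w"
  shows "(\<Sum>w\<in>{w. real w \<le> S \<and> 0 < w}. lam w * (4 * sqrt (real w / n)) ^ w) \<le> 2 * sqrt (48 * \<theta>)"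
proof -
  have "(\<Sum>w\<in>{w. real w \<le> S \<and> 0 < w}. lam w * (4 * sqrt (real w / n)) ^ w) \<le>
     (\<Sum>w\<in>{w. real w \<le> S \<and> 0 < w}. sqrt (48 * \<theta>) ^ w)"
  proof (rule sum_mono)
    fix w assume "w \<in> {w. real w \<le> S \<and> 0 < w}"
    then have "lam w * (4 * sqrt (real w / n)) ^ w \<le> envelope (\<theta> * n) w * (4 * sqrt (real w / n)) ^ w"
      using lam n by (intro mult_right_mono) auto
    also have "\<dots> \<le> sqrt (48 * \<theta>) ^ w"
      using envelope_mult_cover[OF n \<theta>(1), of 1 0 w] by simp
    finally show "lam w * (4 * sqrt (real w / n)) ^ w \<le> sqrt (48 * \<theta>) ^ w" .
  qed
  also have "\<dots> \<le> 2 * sqrt (48 * \<theta>) ^ Suc 0"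
  proof (rule sum_power_tail_le)
    show "sqrt (48 * \<theta>) \<le> 1 / 2" using \<theta>(2) by (intro real_le_lsqrt) (auto simp: power2_eq_square)
  qed (use \<theta> in \<open>auto intro: finite_subset[OF _ finite_real_le[of S]]\<close>)
  finally show ?thesis by simp
qed

section \<open>Counting frequencies of small weight by their generating function\<close>

lemma sum_power_supp:
  fixes z :: real
  assumes "q > 0"
  shows "(\<Sum>s\<in>Zq_mat q n k. z ^ card (supp n k s)) = (1 + real (q - 1) * z) ^ (n * k)"
proof -
  have "z ^ card (supp n k s) = (\<Prod>v<n. \<Prod>l<k. if s v l \<noteq> 0 then z else 1)" for s
  proof -
    have "(\<Prod>v<n. \<Prod>l<k. if s v l \<noteq> 0 then z else 1) =
        (\<Prod>(v, l)\<in>{..<n} \<times> {..<k}. if s v l \<noteq> 0 then z else 1)"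
      by (rule prod.cartesian_product)
    also have "\<dots> = (\<Prod>(v, l)\<in>supp n k s. z)"
      by (rule prod.mono_neutral_cong_right) (auto simp: supp_def)
    finally show ?thesis by (simp add: case_prod_beta')
  qed
  then have "(\<Sum>s\<in>Zq_mat q n k. z ^ card (supp n k s)) =
     (\<Prod>v<n. \<Sum>r\<in>{..<k} \<rightarrow>\<^sub>E Zq q. \<Prod>l<k. if r l \<noteq> 0 then z else 1)"
    unfolding Zq_mat_def by (subst prod_sum_PiE) (auto intro!: finite_PiE)
  also have "\<dots> = (\<Prod>v<n. \<Prod>l<k. \<Sum>c\<in>Zq q. if c \<noteq> 0 then z else 1)"
    by (subst prod_sum_PiE) auto
  also have "(\<Sum>c\<in>Zq q. if c \<noteq> 0 then z else 1) = 1 + real (q - 1) * z"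
  proof -
    have "Zq q = insert 0 {1..<int q}" using assms by (auto simp: Zq_def)
    then have "(\<Sum>c\<in>Zq q. if c \<noteq> 0 then z else 1) = 1 + (\<Sum>c\<in>{1..<int q}. z)"
      by (simp add: sum.cong[of "{1..<int q}" _ "\<lambda>c. if c \<noteq> 0 then z else 1" "\<lambda>_. z"])
    then show ?thesis using assms by (simp add: of_nat_diff nat_diff_distrib)
  qed
  finally show ?thesis by (simp add: power_mult mult.commute)
qed

text \<open>An exponential moment bound: the number is at most z^(-\<omega>) times the generating
  function at \<open>z\<close>. Replacing 1 / z by exp(1 / z) avoids logarithms; a good
  \<open>z\<close> is proportional to the present window, and then the next window is proportional
  to its square.\<close>

lemma card_weight_le:
  assumes "q > 0" "0 < z" and \<omega>: "real \<omega> \<le> r"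
  shows "real (card {s \<in> Zq_mat q n k. card (supp n k s) = \<omega>}) \<le>
    exp (r / z + real q * z * real (n * k))"
proof -
  have "real (card {s \<in> Zq_mat q n k. card (supp n k s) = \<omega>}) * z ^ \<omega> =
      (\<Sum>s\<in>{s \<in> Zq_mat q n k. card (supp n k s) = \<omega>}. z ^ card (supp n k s))"
    by simp
  also have "\<dots> \<le> (\<Sum>s\<in>Zq_mat q n k. z ^ card (supp n k s))"
    using assms by (intro sum_mono2) auto
  also have "\<dots> = (1 + real (q - 1) * z) ^ (n * k)" by (rule sum_power_supp) fact
  also have "\<dots> \<le> exp (real q * z) ^ (n * k)"
  proof (rule power_mono)
    have "1 + real (q - 1) * z \<le> 1 + real q * z" using assms by (intro add_left_mono mult_right_mono) auto
    also have "\<dots> \<le> exp (real q * z)" by (rule exp_ge_add_one_self)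
    finally show "1 + real (q - 1) * z \<le> exp (real q * z)" .
  qed (use assms in simp)
  also have "\<dots> = exp (real q * z * real (n * k))" by (simp add: exp_of_nat_mult[symmetric] mult.commute)
  finally have 1: "real (card {s \<in> Zq_mat q n k. card (supp n k s) = \<omega>}) * z ^ \<omega> \<le> exp (real q * z * real (n * k))" .
  have "1 \<le> exp (r / z) * z ^ \<omega>"
  proof -
    have "1 / z \<le> exp (1 / z)" using exp_ge_add_one_self[of "1 / z"] by linarith
    then have "1 \<le> exp (1 / z) * z" using assms by (simp add: field_simps)
    then have "1 \<le> (exp (1 / z) * z) ^ \<omega>" by (rule one_le_power)
    also have "\<dots> = exp (real \<omega> / z) * z ^ \<omega>" by (simp add: power_mult_distrib exp_of_nat_mult[symmetric])
    also have "\<dots> \<le> exp (r / z) * z ^ \<omega>"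
      using assms by (intro mult_right_mono) (auto intro!: divide_right_mono)
    finally show ?thesis .
  qed
  then have "real (card {s \<in> Zq_mat q n k. card (supp n k s) = \<omega>}) * 1 \<le>
      real (card {s \<in> Zq_mat q n k. card (supp n k s) = \<omega>}) * (exp (r / z) * z ^ \<omega>)"
    by (rule mult_left_mono) simp
  also have "\<dots> \<le> exp (r / z) * exp (real q * z * real (n * k))"
    using mult_left_mono[OF 1, of "exp (r / z)"] by (simp add: mult_ac)
  finally show ?thesis by (simp add: exp_add)
qed

subsection \<open>Iteration over the rounds\<close>

locale dihp_transcripts =
  fixes q k k' n m T :: nat and \<phi> :: "nat \<Rightarrow> nat \<Rightarrow> nat" and \<Y> :: "nat \<Rightarrow> (nat \<Rightarrow> int) pmf"
    and W :: "'w set" and g :: "nat \<Rightarrow> (hypermatching \<times> 'w) list \<Rightarrow> player_input \<Rightarrow> 'w" and c :: nat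
  assumes q: "q > 0" and mn: "2 * m \<le> n" and n: "0 < n"
    and \<phi>: "\<And>t. t < T \<Longrightarrow> \<phi> t \<in> {..<k} \<rightarrow> {..<k'}" and inj: "\<And>t. t < T \<Longrightarrow> inj_on (\<phi> t) {..<k}"
    and \<Y>: "\<And>t. t < T \<Longrightarrow> one_wise_uniform q k (\<Y> t)"
    and finW: "finite W" and gW: "\<And>t R I. g t R I \<in> W"
    and cardW: "card W \<le> 2 ^ c" and cm: "2 * c \<le> m"
begin

abbreviation "VX \<equiv> Zq_mat q n k'"
abbreviation "PM \<equiv> PHM m k n"
abbreviation "np \<equiv> real (card (PHM m k n))"

definition xi :: real where "xi = 4 * sqrt (108 * real (q ^ k) ^ 2 * real m * real c)"

lemma step_locale:
  "t < T \<Longrightarrow> message_step q k k' n m (\<phi> t) (\<Y> t) W (\<lambda>M Z. g t R (M, Z)) c xi"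
  by unfold_locales (use q mn n \<phi> inj \<Y> finW gW cardW cm in \<open>auto simp: xi_def\<close>)

section \<open>Likelihoods of transcripts\<close>

definition msgp :: "nat \<Rightarrow> (hypermatching \<times> 'w) list \<Rightarrow> hypermatching \<Rightarrow> 'w \<Rightarrow> zmat \<Rightarrow> real" where
  "msgp t R M w X = measure_pmf.prob
     (map_pmf (\<lambda>Y. Zq_mat_diff q m k (hm_proj m k (\<phi> t) M X) Y) (iid_rows m (\<Y> t)))
     {Z. g t R (M, Z) = w}"

definition null_msgp :: "nat \<Rightarrow> (hypermatching \<times> 'w) list \<Rightarrow> hypermatching \<Rightarrow> 'w \<Rightarrow> real" where
  "null_msgp t R M w = real (card {Z \<in> Zq_mat q m k. g t R (M, Z) = w}) / real (q ^ (m * k))"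

text \<open>Conditional likelihood of the messages, given \<open>X\<close> and the hypermatchings
  listed in \<open>R\<close>. The factor 1 / np for each hypermatching is left out here and restored
  in \<open>lam\<close> and \<open>drift\<close>.\<close>

definition state :: "(hypermatching \<times> 'w) list \<Rightarrow> zmat \<Rightarrow> real" where
  "state R X = (\<Prod>i<length R. msgp i (take i R) (fst (R ! i)) (snd (R ! i)) X)"

definition null_prob :: "(hypermatching \<times> 'w) list \<Rightarrow> real" where
  "null_prob R = (\<Prod>i<length R. null_msgp i (take i R) (fst (R ! i)) (snd (R ! i)))"

definition transcripts :: "nat \<Rightarrow> (hypermatching \<times> 'w) list set" where
  "transcripts t = {R. set R \<subseteq> PM \<times> W \<and> length R = t}"

definition mean :: "(hypermatching \<times> 'w) list \<Rightarrow> real" where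
  "mean R = (\<Sum>X\<in>VX. state R X) / real (q ^ (n * k'))"

lemma state_snoc: "state (R @ [(M, w)]) X = state R X * msgp (length R) R M w X"
  unfolding state_def by (simp add: nth_append)

lemma null_prob_snoc: "null_prob (R @ [(M, w)]) = null_prob R * null_msgp (length R) R M w"
  unfolding null_prob_def by (simp add: nth_append)

lemma msgp_bounds: "0 \<le> msgp t R M w X" "msgp t R M w X \<le> 1"
  by (auto simp: msgp_def)

lemma state_bounds: "0 \<le> state R X" "state R X \<le> 1"
  unfolding state_def using msgp_bounds by (auto intro!: prod_nonneg prod_le_1)

lemma np_pos: "0 < np"
  using PHM_nonempty[of m n k] mn by (simp add: card_gt_0_iff)

lemma PM_nonempty: "PM \<noteq> {}"
  using PHM_nonempty[of m n k] mn by simp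

lemma finite_transcripts [simp]: "finite (transcripts t)"
proof -
  have "transcripts t = {R. set R \<subseteq> PM \<times> W \<and> length R = t}" by (simp add: transcripts_def)
  also have "finite \<dots>" by (rule finite_lists_length_eq) (simp add: finW)
  finally show ?thesis .
qed

lemma card_transcripts: "real (card (transcripts t)) = np ^ t * real (card W) ^ t"
  unfolding transcripts_def
  by (subst card_lists_length_eq) (simp_all add: finW card_cartesian_product power_mult_distrib)

lemma sum_transcripts_Suc:
  "(\<Sum>R\<in>transcripts (Suc t). F R) = (\<Sum>R\<in>transcripts t. \<Sum>M\<in>PM. \<Sum>w\<in>W. F (R @ [(M, w)]))"
proof -
  have "(\<Sum>R\<in>transcripts t. \<Sum>M\<in>PM. \<Sum>w\<in>W. F (R @ [(M, w)])) =
      (\<Sum>R\<in>transcripts t. \<Sum>e\<in>PM \<times> W. F (R @ [e]))"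
    by (simp add: sum.cartesian_product')
  also have "\<dots> = (\<Sum>(R, e)\<in>transcripts t \<times> (PM \<times> W). F (R @ [e]))"
    by (rule sum.cartesian_product)
  also have "\<dots> = (\<Sum>R\<in>transcripts (Suc t). F R)"
  proof (rule sum.reindex_bij_witness[where i = "\<lambda>R. (butlast R, last R)" and j = "\<lambda>(R, e). R @ [e]"])
    fix R assume R: "R \<in> transcripts (Suc t)"
    then have "R \<noteq> []" by (auto simp: transcripts_def)
    then show "(butlast R, last R) \<in> transcripts t \<times> (PM \<times> W)"
      "(case (butlast R, last R) of (R, e) \<Rightarrow> R @ [e]) = R"
      using R last_in_set[of R] by (auto simp: transcripts_def dest: in_set_butlastD)
  qed (auto simp: transcripts_def)
  finally show ?thesis by simp
qed

lemma length_transcripts: "R \<in> transcripts t \<Longrightarrow> length R = t"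
  by (simp add: transcripts_def)

lemma sum_msgp:
  assumes "t < T"
  shows "(\<Sum>w\<in>W. msgp t R M w X) = 1"
proof -
  interpret S: message_step q k k' n m "\<phi> t" "\<Y> t" W "\<lambda>M Z. g t R (M, Z)" c xi
    using assms by (rule step_locale)
  have "(\<Sum>w\<in>W. S.msg_prob M (\<lambda>Z. g t R (M, Z)) w X) = 1"
    by (rule S.sum_msg_prob) (auto simp: finW gW)
  then show ?thesis by (simp add: msgp_def S.msg_prob_def S.transition_def)
qed

lemma sum_state:
  assumes "t \<le> T"
  shows "(\<Sum>R\<in>transcripts t. state R X) = np ^ t"
  using assms
proof (induction t)
  case 0
  have "transcripts 0 = {[]}" by (auto simp: transcripts_def)
  then show ?case by (simp add: state_def)
next
  case (Suc t)
  have "(\<Sum>R\<in>transcripts (Suc t). state R X) =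
      (\<Sum>R\<in>transcripts t. \<Sum>M\<in>PM. state R X * (\<Sum>w\<in>W. msgp t R M w X))"
    unfolding sum_transcripts_Suc sum_distrib_left
    by (intro sum.cong refl) (simp add: state_snoc length_transcripts)
  also have "\<dots> = (\<Sum>R\<in>transcripts t. state R X) * np"
    using Suc.prems by (simp add: sum_msgp sum_distrib_left mult.commute)
  finally show ?case using Suc by simp
qed

definition cstate :: "(hypermatching \<times> 'w) list \<Rightarrow> zmat \<Rightarrow> complex" where
  "cstate R X = complex_of_real (state R X)"

definition level :: "nat \<Rightarrow> (hypermatching \<times> 'w) list \<Rightarrow> real" where
  "level \<omega> R = (\<Sum>s\<in>{s \<in> VX. card (supp n k' s) = \<omega>}. cmod (ft q n k' (cstate R) s))"

text \<open>An average over hypermatchings but a sum over messages, so level 0 has total weight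
  1.\<close>

definition lam :: "nat \<Rightarrow> nat \<Rightarrow> real" where
  "lam t \<omega> = (\<Sum>R\<in>transcripts t. level \<omega> R) / np ^ t"

text \<open>For t = T this is the L1 distance between the transcript laws of the YES and NO
  cases.\<close>

definition drift :: "nat \<Rightarrow> real" where
  "drift t = (\<Sum>R\<in>transcripts t. \<bar>mean R - null_prob R\<bar>) / np ^ t"

definition zX :: zmat where "zX = (\<lambda>v\<in>{..<n}. \<lambda>l\<in>{..<k'}. 0)"

lemma chr_zX: "chr q n k' zX X = 1"
  unfolding chr_def zX_def by (intro prod.neutral ballI) auto

lemma ft_cstate_zX: "ft q n k' (cstate R) zX = complex_of_real (mean R)"
  by (simp add: ft_def chr_zX cstate_def mean_def)

lemma zX: "zX \<in> VX"
  using q by (auto simp: zX_def Zq_mat_def Zq_def)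

lemma level_0_set: "{s \<in> VX. card (supp n k' s) = 0} = {zX}"
proof (intro equalityI subsetI)
  fix s assume s: "s \<in> {s \<in> VX. card (supp n k' s) = 0}"
  then have "s v l = 0" if "v < n" "l < k'" for v l
    using that finite_supp[of n k' s] by (auto simp: supp_def card_eq_0_iff)
  then have "s = zX" using s zX by (intro Zq_mat_eqI[of _ q n k']) (auto simp: zX_def)
  then show "s \<in> {zX}" by simp
qed (use zX in \<open>auto simp: supp_def zX_def card_eq_0_iff\<close>)

lemma mean_nonneg: "0 \<le> mean R"
  unfolding mean_def using state_bounds by (auto intro!: divide_nonneg_nonneg sum_nonneg)

lemma sum_mean:
  assumes "t \<le> T"
  shows "(\<Sum>R\<in>transcripts t. mean R) = np ^ t"
proof -
  have "(\<Sum>R\<in>transcripts t. mean R) = (\<Sum>X\<in>VX. \<Sum>R\<in>transcripts t. state R X) / real (q ^ (n * k'))"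
    unfolding mean_def by (subst sum.swap) (simp add: sum_divide_distrib)
  then show ?thesis using assms q by (simp add: sum_state card_Zq_mat)
qed

lemma lam_level_0:
  assumes "t \<le> T"
  shows "lam t 0 = 1"
proof -
  have "level 0 R = mean R" for R
    using mean_nonneg[of R] by (simp only: level_def level_0_set) (simp add: ft_cstate_zX)
  then have "lam t 0 = np ^ t / np ^ t" using assms by (simp only: lam_def sum_mean)
  then show ?thesis using PM_nonempty by simp
qed

lemma lam_0_le: "lam 0 \<omega> \<le> (if \<omega> = 0 then 1 else 0)"
proof (cases "\<omega> = 0")
  case False
  have "transcripts 0 = {[]}" by (auto simp: transcripts_def)
  moreover have "ft q n k' (cstate []) s = 0" if s: "s \<in> VX" "card (supp n k' s) = \<omega>" for s
  proof -
    have "supp n k' s \<noteq> {}" using s False by auto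
    then obtain v l where "v < n" "l < k'" "s v l \<noteq> 0" by (auto simp: supp_def)
    then have "\<not> (\<forall>v<n. \<forall>l<k'. int q dvd s v l)"
      using Zq_mat_dvd_iff[OF s(1)] by blast
    then have "(\<Sum>X\<in>VX. chr q n k' X s) = 0"
      by (simp only: sum_chr[OF q] if_False)
    then have "cnj (\<Sum>X\<in>VX. chr q n k' s X) = 0"
      by (simp add: chr_commute)
    then show ?thesis by (simp add: ft_def cstate_def state_def)
  qed
  ultimately show ?thesis using False by (simp add: lam_def level_def)
qed (simp add: lam_level_0)

section \<open>Recursions for the levels and for the drift\<close>

lemma next_state_eq:
  assumes "t < T" "R \<in> transcripts t"
  shows "message_step.next_state q k m (\<phi> t) (\<Y> t) (\<lambda>M Z. g t R (M, Z)) M w (cstate R) = cstate (R @ [(M, w)])"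
proof -
  interpret S: message_step q k k' n m "\<phi> t" "\<Y> t" W "\<lambda>M Z. g t R (M, Z)" c xi
    using assms(1) by (rule step_locale)
  show ?thesis
    using assms(2) by (simp add: S.next_state_def cstate_def state_snoc msgp_def S.msg_prob_def
        S.transition_def length_transcripts fun_eq_iff)
qed

text \<open>Here smallness of \<alpha> acts: d \<le> k m \<le> n / 256 gives 4 sqrt(d / n) \<le> 1 /
  4 \<le> 1 / e, so covering d vertices has probability at most e^(-d). The square anticipates the
  root in Cauchy--Schwarz.\<close>

lemma cover_exp:
  assumes km: "256 * k * m \<le> n" and d: "d \<le> k * m" "r \<le> real d"
  shows "(4 * sqrt (real d / real n)) ^ d \<le> (exp (- r / 2))\<^sup>2"
proof -
  have "real d / real n \<le> 1 / 256"
  proof -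
    have "256 * d \<le> n" using d km by linarith
    then have "256 * real d \<le> real n" by (metis of_nat_le_iff of_nat_mult of_nat_numeral)
    then show ?thesis using n by (simp add: field_simps)
  qed
  then have "sqrt (real d / real n) \<le> 1 / 16"
    by (intro real_le_lsqrt) (auto simp: power2_eq_square)
  moreover have "1 / 4 \<le> exp (- 1 :: real)"
    using exp_le by (simp add: exp_minus field_simps)
  ultimately have "4 * sqrt (real d / real n) \<le> exp (- 1)" by linarith
  then have "(4 * sqrt (real d / real n)) ^ d \<le> exp (- 1) ^ d"
    by (intro power_mono) auto
  also have "\<dots> = exp (- real d)" by (simp add: exp_of_nat_mult[symmetric])
  also have "\<dots> \<le> exp (- r)" using d by simp
  also have "\<dots> = (exp (- r / 2))\<^sup>2" by (simp add: power2_eq_square exp_add[symmetric])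
  finally show ?thesis .
qed

lemma sum_level_group:
  "(\<Sum>s\<in>{s \<in> VX. real (card (supp n k' s)) \<le> S \<and> Q (card (supp n k' s))}.
      cmod (ft q n k' (cstate R) s) * \<Phi> (card (supp n k' s))) =
    (\<Sum>w\<in>{w. real w \<le> S \<and> Q w}. level w R * \<Phi> w)"
proof -
  let ?A = "{s \<in> VX. real (card (supp n k' s)) \<le> S \<and> Q (card (supp n k' s))}"
  have "(\<Sum>s\<in>?A. cmod (ft q n k' (cstate R) s) * \<Phi> (card (supp n k' s))) =
     (\<Sum>w\<in>{w. real w \<le> S \<and> Q w}. \<Sum>s\<in>{s \<in> ?A. card (supp n k' s) = w}.
        cmod (ft q n k' (cstate R) s) * \<Phi> (card (supp n k' s)))"
    by (rule sum.group[symmetric]) (auto intro: finite_subset[OF _ finite_real_le[of S]])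
  also have "\<dots> = (\<Sum>w\<in>{w. real w \<le> S \<and> Q w}. level w R * \<Phi> w)"
    unfolding level_def sum_distrib_right by (intro sum.cong) auto
  finally show ?thesis .
qed

text \<open>The high term is paid once per sequence of messages, whence the power t + 1 of
  \<open>card W\<close>. As 2 \<omega> \<le> S, a difference of more than S / 2 vertices must be
  covered, and the root of exp(- S / 2) is the stated factor.\<close>

lemma lam_step:
  assumes t: "t < T" and km: "256 * k * m \<le> n" and S: "16 * S \<le> real n"
    and \<omega>: "\<omega> \<le> c" "2 * real \<omega> \<le> S"
  shows "lam (Suc t) \<omega> \<le>
    (\<Sum>w\<in>{w. real w \<le> S}. lam t w * ((2 * real (q ^ k)) ^ w *
      (\<Sum>v\<le>\<omega>. envelope xi v * (4 * sqrt (real w / real n)) ^ (w - (\<omega> - v)))))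
    + real (card {s \<in> VX. card (supp n k' s) = \<omega>}) * (real (card W) ^ Suc t * exp (- S / 4))"
proof -
  define \<Phi> where "\<Phi> w = (2 * real (q ^ k)) ^ w *
      (\<Sum>v\<le>\<omega>. envelope xi v * (4 * sqrt (real w / real n)) ^ (w - (\<omega> - v)))" for w
  define K where "K = real (card {s \<in> VX. card (supp n k' s) = \<omega>})"
  define \<eta> where "\<eta> = exp (- (S - real \<omega>) / 2)"
  have \<eta>: "\<eta> \<le> exp (- S / 4)" unfolding \<eta>_def using \<omega>(2) by simp
  have "(\<Sum>R\<in>transcripts (Suc t). level \<omega> R) = (\<Sum>R\<in>transcripts t. \<Sum>M\<in>PM. \<Sum>w\<in>W. level \<omega> (R @ [(M, w)]))"
    by (rule sum_transcripts_Suc)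
  also have "\<dots> \<le> (\<Sum>R\<in>transcripts t. np * ((\<Sum>w\<in>{w. real w \<le> S}. level w R * \<Phi> w) + K * (real (card W) * \<eta>)))"
  proof (rule sum_mono)
    fix R assume R: "R \<in> transcripts t"
    interpret S: message_step q k k' n m "\<phi> t" "\<Y> t" W "\<lambda>M Z. g t R (M, Z)" c xi
      using t by (rule step_locale)
    have lev: "level \<omega> (R @ [(M, w)]) = S.level_norm \<omega> (S.next_state M w (cstate R))" for M w
      by (simp add: next_state_eq[OF t R] level_def S.level_norm_def)
    have "(\<Sum>M\<in>PM. \<Sum>w\<in>W. level \<omega> (R @ [(M, w)])) \<le>
       np * ((\<Sum>s\<in>{s \<in> VX. real (card (supp n k' s)) \<le> S}. cmod (ft q n k' (cstate R) s) * \<Phi> (card (supp n k' s)))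
         + K * (real (card W) * \<eta>))"
      unfolding lev K_def \<Phi>_def
    proof (rule S.level_norm_step)
      show "4 * sqrt (S / real n) \<le> 1"
      proof -
        have "S / real n \<le> 1 / 16" using S n by (simp add: field_simps)
        then have "sqrt (S / real n) \<le> 1 / 4" by (intro real_le_lsqrt) (auto simp: power2_eq_square)
        then show ?thesis by simp
      qed
      show "(4 * sqrt (real d / real n)) ^ d \<le> \<eta>\<^sup>2" if "S - real \<omega> < real d" "d \<le> k * m" for d
        unfolding \<eta>_def using that by (intro cover_exp km) auto
    qed (use \<omega> state_bounds in \<open>auto simp: cstate_def \<eta>_def abs_le_iff\<close>)
    also have "(\<Sum>s\<in>{s \<in> VX. real (card (supp n k' s)) \<le> S}. cmod (ft q n k' (cstate R) s) * \<Phi> (card (supp n k' s))) =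
        (\<Sum>w\<in>{w. real w \<le> S}. level w R * \<Phi> w)"
      using sum_level_group[where Q = "\<lambda>_. True" and \<Phi> = \<Phi>] by simp
    finally show "(\<Sum>M\<in>PM. \<Sum>w\<in>W. level \<omega> (R @ [(M, w)])) \<le>
      np * ((\<Sum>w\<in>{w. real w \<le> S}. level w R * \<Phi> w) + K * (real (card W) * \<eta>))" .
  qed
  also have "\<dots> = np * ((\<Sum>w\<in>{w. real w \<le> S}. (\<Sum>R\<in>transcripts t. level w R) * \<Phi> w) +
      real (card (transcripts t)) * (K * (real (card W) * \<eta>)))"
    unfolding sum_distrib_left[symmetric] sum.distrib sum_distrib_right
    by (subst sum.swap) simp
  finally have "lam (Suc t) \<omega> \<le> np * ((\<Sum>w\<in>{w. real w \<le> S}. (\<Sum>R\<in>transcripts t. level w R) * \<Phi> w) +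
      real (card (transcripts t)) * (K * (real (card W) * \<eta>))) / np ^ Suc t"
    unfolding lam_def using np_pos by (intro divide_right_mono) auto
  also have "\<dots> = ((\<Sum>w\<in>{w. real w \<le> S}. (\<Sum>R\<in>transcripts t. level w R) * \<Phi> w) +
      real (card (transcripts t)) * (K * (real (card W) * \<eta>))) / np ^ t"
    using PM_nonempty by simp
  also have "\<dots> = (\<Sum>w\<in>{w. real w \<le> S}. lam t w * \<Phi> w) + K * (real (card W) ^ Suc t * \<eta>)"
  proof -
    have L: "(\<Sum>R\<in>transcripts t. level w R) = np ^ t * lam t w" for w
      using PM_nonempty by (simp add: lam_def)
    have "(\<Sum>w\<in>{w. real w \<le> S}. (\<Sum>R\<in>transcripts t. level w R) * \<Phi> w) =
        np ^ t * (\<Sum>w\<in>{w. real w \<le> S}. lam t w * \<Phi> w)"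
      unfolding L sum_distrib_left mult.assoc ..
    then show ?thesis
      unfolding card_transcripts using PM_nonempty by (simp add: field_simps)
  qed
  also have "\<dots> \<le> (\<Sum>w\<in>{w. real w \<le> S}. lam t w * \<Phi> w) + K * (real (card W) ^ Suc t * exp (- S / 4))"
    using \<eta> by (intro add_left_mono mult_left_mono) (auto simp: K_def)
  finally show ?thesis unfolding K_def \<Phi>_def .
qed

lemma sum_null_msgp: "(\<Sum>w\<in>W. null_msgp t R M w) = 1"
proof -
  have "(\<Sum>w\<in>W. card {Z \<in> Zq_mat q m k. g t R (M, Z) = w}) = card (Zq_mat q m k)"
    using sum.group[of "Zq_mat q m k" W "\<lambda>Z. g t R (M, Z)" "\<lambda>_. 1::nat"] finW gW by auto
  then show ?thesis
    using q by (simp add: null_msgp_def sum_divide_distrib[symmetric] of_nat_sum[symmetric] card_Zq_mat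
        del: of_nat_sum of_nat_power)
qed

text \<open>By the triangle inequality the old gap is multiplied by \<open>null_msgp\<close>, which
  sums to 1 over messages. Gaps are therefore not amplified, and the errors of the rounds simply
  add.\<close>

lemma drift_step:
  assumes t: "t < T" and km: "256 * k * m \<le> n" and S: "0 \<le> S"
  shows "drift (Suc t) \<le> drift t +
    ((\<Sum>w\<in>{w. real w \<le> S \<and> 0 < w}. lam t w * (4 * sqrt (real w / real n)) ^ w)
    + real (card W) ^ Suc t * exp (- S / 2))"
proof -
  define \<Phi> where "\<Phi> w = (4 * sqrt (real w / real n)) ^ w" for w
  define \<eta> where "\<eta> = exp (- S / 2)"
  have "(\<Sum>R\<in>transcripts (Suc t). \<bar>mean R - null_prob R\<bar>) =
      (\<Sum>R\<in>transcripts t. \<Sum>M\<in>PM. \<Sum>w\<in>W. \<bar>mean (R @ [(M, w)]) - null_prob (R @ [(M, w)])\<bar>)"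
    by (rule sum_transcripts_Suc)
  also have "\<dots> \<le> (\<Sum>R\<in>transcripts t. np * \<bar>mean R - null_prob R\<bar> +
      np * ((\<Sum>w\<in>{w. real w \<le> S \<and> 0 < w}. level w R * \<Phi> w) + real (card W) * \<eta>))"
  proof (rule sum_mono)
    fix R assume R: "R \<in> transcripts t"
    interpret S: message_step q k k' n m "\<phi> t" "\<Y> t" W "\<lambda>M Z. g t R (M, Z)" c xi
      using t by (rule step_locale)
    have nul: "msg_ft q m k (\<lambda>Z. g t R (M, Z)) w S.zeroZ = complex_of_real (null_msgp t R M w)" for M w
    proof -
      have "chr q m k S.zeroZ Z = 1" for Z
        unfolding chr_def S.zeroZ_def by (intro prod.neutral ballI) auto
      moreover have "(\<Sum>Z\<in>Zq_mat q m k. if g t R (M, Z) = w then 1 else (0::complex)) =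
          of_nat (card {Z \<in> Zq_mat q m k. g t R (M, Z) = w})"
        by (simp add: sum.inter_filter[symmetric])
      ultimately show ?thesis by (simp add: msg_ft_def ft_def null_msgp_def)
    qed
    have zz: "S.zeroX = zX" by (simp add: S.zeroX_def zX_def)
    have "(\<Sum>M\<in>PM. \<Sum>w\<in>W. \<bar>mean (R @ [(M, w)]) - null_prob (R @ [(M, w)])\<bar>) \<le>
      (\<Sum>M\<in>PM. \<Sum>w\<in>W. cmod (ft q n k' (S.next_state M w (cstate R)) S.zeroX -
          msg_ft q m k (\<lambda>Z. g t R (M, Z)) w S.zeroZ * ft q n k' (cstate R) S.zeroX)
        + null_msgp t R M w * \<bar>mean R - null_prob R\<bar>)"
    proof (intro sum_mono)
      fix M w
      have "cmod (ft q n k' (S.next_state M w (cstate R)) S.zeroX -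
          msg_ft q m k (\<lambda>Z. g t R (M, Z)) w S.zeroZ * ft q n k' (cstate R) S.zeroX) =
          \<bar>mean (R @ [(M, w)]) - null_msgp t R M w * mean R\<bar>"
        unfolding next_state_eq[OF t R] zz nul ft_cstate_zX
        by (simp only: of_real_mult[symmetric] of_real_diff[symmetric] norm_of_real)
      moreover have "null_prob (R @ [(M, w)]) = null_msgp t R M w * null_prob R"
        using length_transcripts[OF R] by (simp add: null_prob_snoc)
      moreover have "null_msgp t R M w * \<bar>mean R - null_prob R\<bar> = \<bar>null_msgp t R M w * mean R - null_msgp t R M w * null_prob R\<bar>"
        unfolding right_diff_distrib[symmetric] abs_mult by (simp add: null_msgp_def)
      ultimately show "\<bar>mean (R @ [(M, w)]) - null_prob (R @ [(M, w)])\<bar> \<le>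
        cmod (ft q n k' (S.next_state M w (cstate R)) S.zeroX -
          msg_ft q m k (\<lambda>Z. g t R (M, Z)) w S.zeroZ * ft q n k' (cstate R) S.zeroX)
        + null_msgp t R M w * \<bar>mean R - null_prob R\<bar>"
        by linarith
    qed
    also have "\<dots> = (\<Sum>M\<in>PM. \<Sum>w\<in>W. cmod (ft q n k' (S.next_state M w (cstate R)) S.zeroX -
          msg_ft q m k (\<lambda>Z. g t R (M, Z)) w S.zeroZ * ft q n k' (cstate R) S.zeroX))
        + np * \<bar>mean R - null_prob R\<bar>"
      by (simp add: sum.distrib sum_distrib_right[symmetric] sum_null_msgp)
    also have "(\<Sum>M\<in>PM. \<Sum>w\<in>W. cmod (ft q n k' (S.next_state M w (cstate R)) S.zeroX -
          msg_ft q m k (\<lambda>Z. g t R (M, Z)) w S.zeroZ * ft q n k' (cstate R) S.zeroX)) \<le>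
        np * ((\<Sum>s\<in>{s \<in> VX. real (card (supp n k' s)) \<le> S \<and> 0 < card (supp n k' s)}.
           cmod (ft q n k' (cstate R) s) * \<Phi> (card (supp n k' s))) + real (card W) * \<eta>)"
      unfolding \<Phi>_def
    proof (rule S.drift_step)
      show "(4 * sqrt (real d / real n)) ^ d \<le> \<eta>\<^sup>2" if "S < real d" "d \<le> k * m" for d
        unfolding \<eta>_def using that by (intro cover_exp km) auto
    qed (use S state_bounds in \<open>auto simp: cstate_def \<eta>_def abs_le_iff\<close>)
    also have "(\<Sum>s\<in>{s \<in> VX. real (card (supp n k' s)) \<le> S \<and> 0 < card (supp n k' s)}.
           cmod (ft q n k' (cstate R) s) * \<Phi> (card (supp n k' s))) =
        (\<Sum>w\<in>{w. real w \<le> S \<and> 0 < w}. level w R * \<Phi> w)"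
      by (rule sum_level_group)
    finally show "(\<Sum>M\<in>PM. \<Sum>w\<in>W. \<bar>mean (R @ [(M, w)]) - null_prob (R @ [(M, w)])\<bar>) \<le>
      np * \<bar>mean R - null_prob R\<bar> +
      np * ((\<Sum>w\<in>{w. real w \<le> S \<and> 0 < w}. level w R * \<Phi> w) + real (card W) * \<eta>)" by simp
  qed
  also have "\<dots> = np * ((\<Sum>R\<in>transcripts t. \<bar>mean R - null_prob R\<bar>) +
      ((\<Sum>w\<in>{w. real w \<le> S \<and> 0 < w}. (\<Sum>R\<in>transcripts t. level w R) * \<Phi> w) +
      real (card (transcripts t)) * (real (card W) * \<eta>)))"
    unfolding distrib_left[symmetric] sum_distrib_left[symmetric] sum.distrib sum_distrib_right
    by (subst (2) sum.swap) simp
  finally have "drift (Suc t) \<le> np * ((\<Sum>R\<in>transcripts t. \<bar>mean R - null_prob R\<bar>) +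
      ((\<Sum>w\<in>{w. real w \<le> S \<and> 0 < w}. (\<Sum>R\<in>transcripts t. level w R) * \<Phi> w) +
      real (card (transcripts t)) * (real (card W) * \<eta>))) / np ^ Suc t"
    unfolding drift_def using np_pos by (intro divide_right_mono) auto
  also have "\<dots> = ((\<Sum>R\<in>transcripts t. \<bar>mean R - null_prob R\<bar>) +
      ((\<Sum>w\<in>{w. real w \<le> S \<and> 0 < w}. (\<Sum>R\<in>transcripts t. level w R) * \<Phi> w) +
      real (card (transcripts t)) * (real (card W) * \<eta>))) / np ^ t"
    using PM_nonempty by simp
  also have "\<dots> = drift t + ((\<Sum>w\<in>{w. real w \<le> S \<and> 0 < w}. lam t w * \<Phi> w) + real (card W) ^ Suc t * \<eta>)"
  proof -
    have L: "(\<Sum>R\<in>transcripts t. level w R) = np ^ t * lam t w" for w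
      using PM_nonempty by (simp add: lam_def)
    have D: "(\<Sum>R\<in>transcripts t. \<bar>mean R - null_prob R\<bar>) = np ^ t * drift t"
      using PM_nonempty by (simp add: drift_def)
    have "(\<Sum>w\<in>{w. real w \<le> S \<and> 0 < w}. (\<Sum>R\<in>transcripts t. level w R) * \<Phi> w) =
        np ^ t * (\<Sum>w\<in>{w. real w \<le> S \<and> 0 < w}. lam t w * \<Phi> w)"
      unfolding L sum_distrib_left mult.assoc ..
    then show ?thesis
      unfolding card_transcripts D using PM_nonempty by (simp add: field_simps)
  qed
  finally show ?thesis unfolding \<Phi>_def \<eta>_def .
qed

lemma drift_0: "drift 0 = 0"
proof -
  have "transcripts 0 = {[]}" by (auto simp: transcripts_def)
  then show ?thesis
    using q by (simp add: drift_def mean_def state_def null_prob_def card_Zq_mat)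
qed

text \<open>
  Per round \<open>\<theta>\<close> grows by a constant factor, while the window of weights \<open>\<sigma> n\<close> in which the envelope is
  maintained shrinks so much that the number of frequencies in the next window is negligible
  against the covering probability of a set larger than the present one.
\<close>

context
  fixes \<theta> \<sigma> :: "nat \<Rightarrow> real" and B :: real
  assumes B: "B = 2 * real (q ^ k)"
    and \<theta>_0: "xi \<le> \<theta> 0 * real n" and \<theta>_Suc: "\<And>t. \<theta> (Suc t) = 6144 * B\<^sup>2 * \<theta> t"
    and \<theta>_small: "\<And>t. t \<le> T \<Longrightarrow> 48 * B\<^sup>2 * \<theta> t \<le> 1 / 4"
    and \<sigma>_pos: "\<And>t. 0 < \<sigma> t" and \<sigma>_Suc: "\<And>t. 2 * \<sigma> (Suc t) \<le> \<sigma> t"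
    and \<sigma>_\<theta>: "\<sigma> 0 \<le> \<theta> 0" and \<sigma>_c: "\<sigma> 0 * real n \<le> real c" and \<sigma>_1: "16 * \<sigma> 0 \<le> 1"
    and km: "256 * k * m \<le> n"
    and high: "\<And>t \<omega>. t < T \<Longrightarrow> real \<omega> \<le> \<sigma> (Suc t) * real n \<Longrightarrow>
      real (card {s \<in> VX. card (supp n k' s) = \<omega>}) * (real (card W) ^ Suc t * exp (- (\<sigma> t * real n) / 4)) \<le> 1"
begin

lemma B1: "1 \<le> B"
proof -
  have "1 \<le> real (q ^ k)" using q by (simp add: Suc_le_eq)
  then show ?thesis unfolding B by linarith
qed

lemma \<sigma>_le: "\<sigma> t \<le> \<sigma> 0"
proof (induction t)
  case (Suc t)
  then show ?case using \<sigma>_Suc[of t] \<sigma>_pos[of "Suc t"] by linarith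
qed simp

lemma \<theta>_ge: "\<theta> 0 \<le> \<theta> t" and \<theta>_nonneg: "0 \<le> \<theta> t"
proof -
  have \<theta>0: "0 \<le> \<theta> 0" using \<sigma>_\<theta> \<sigma>_pos[of 0] by linarith
  have "\<theta> 0 \<le> \<theta> t \<and> 0 \<le> \<theta> t"
  proof (induction t)
    case (Suc t)
    have "1 \<le> 6144 * B\<^sup>2" using B1 one_le_power[of B 2] by linarith
    then have "\<theta> t \<le> \<theta> (Suc t)" using mult_right_mono[of 1 "6144 * B\<^sup>2" "\<theta> t"] Suc by (simp add: \<theta>_Suc)
    then show ?case using Suc by linarith
  qed (use \<theta>0 in simp)
  then show "\<theta> 0 \<le> \<theta> t" "0 \<le> \<theta> t" by auto
qed

text \<open>Level 0 is treated apart, by the exact value 1, since \<open>numeric_step\<close>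
  requires a positive level to absorb constant factors. The shrinking window supplies 2 \<omega>
  \<le> \<sigma> t n in each step.\<close>

lemma lam_le_envelope:
  assumes "t \<le> T" "real \<omega> \<le> \<sigma> t * real n"
  shows "lam t \<omega> \<le> envelope (\<theta> t * real n) \<omega>"
  using assms
proof (induction t arbitrary: \<omega>)
  case 0
  show ?case
    using lam_0_le[of \<omega>] \<theta>_nonneg[of 0] by (auto split: if_splits intro: order_trans)
next
  case (Suc t)
  have n0: "0 < real n" using n by simp
  have t: "t < T" "t \<le> T" using Suc.prems by auto
  show ?case
  proof (cases "\<omega> = 0")
    case True
    then show ?thesis using Suc.prems by (simp add: lam_level_0)
  next
    case False
    have "real \<omega> \<le> \<sigma> 0 * real n"
      using Suc.prems(2) mult_right_mono[OF \<sigma>_le[of "Suc t"], of "real n"] by linarith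
    then have \<omega>c: "\<omega> \<le> c" using \<sigma>_c by linarith
    have \<omega>2: "2 * real \<omega> \<le> \<sigma> t * real n"
      using Suc.prems(2) mult_right_mono[OF \<sigma>_Suc[of t], of "real n"] by (simp add: mult.assoc)
    have S: "16 * (\<sigma> t * real n) \<le> real n"
      using mult_right_mono[of "16 * \<sigma> t" 1 "real n"] \<sigma>_le[of t] \<sigma>_1 by (simp add: mult.assoc)
    have \<theta>n: "\<theta> 0 * real n \<le> \<theta> t * real n" by (intro mult_right_mono \<theta>_ge) auto
    have "lam (Suc t) \<omega> \<le> (\<Sum>w\<in>{w. real w \<le> \<sigma> t * real n}. lam t w * (B ^ w *
       (\<Sum>v\<le>\<omega>. envelope xi v * (4 * sqrt (real w / real n)) ^ (w - (\<omega> - v)))))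
      + real (card {s \<in> VX. card (supp n k' s) = \<omega>}) * (real (card W) ^ Suc t * exp (- (\<sigma> t * real n) / 4))"
      unfolding B by (rule lam_step[OF t(1) km S \<omega>c \<omega>2])
    also have "\<dots> \<le> envelope (6144 * B\<^sup>2 * \<theta> t * real n) \<omega>"
    proof (rule numeric_step[OF n0 \<theta>_nonneg \<theta>_small[OF t(2)] B1])
      show "real \<omega> \<le> \<theta> t * real n"
        using \<open>real \<omega> \<le> \<sigma> 0 * real n\<close> mult_right_mono[OF \<sigma>_\<theta>, of "real n"] \<theta>n by simp
      show "xi \<le> \<theta> t * real n" using \<theta>_0 \<theta>n by simp
      show "0 \<le> xi" by (simp add: xi_def)
    qed (use False Suc.IH t high Suc.prems in auto)
    finally show ?thesis by (simp add: \<theta>_Suc)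
  qed
qed

lemma drift_le:
  assumes "t \<le> T"
  shows "drift t \<le> (\<Sum>i<t. 2 * sqrt (48 * \<theta> i) + real (card W) ^ Suc i * exp (- (\<sigma> i * real n) / 2))"
  using assms
proof (induction t)
  case (Suc t)
  have n0: "0 < real n" using n by simp
  have "48 * \<theta> t \<le> 48 * B\<^sup>2 * \<theta> t"
    using mult_right_mono[of 1 "B\<^sup>2" "\<theta> t"] \<theta>_nonneg[of t] one_le_power[OF B1, of 2] by simp
  then have small: "48 * \<theta> t \<le> 1 / 4" using \<theta>_small[of t] Suc.prems by simp
  have "drift (Suc t) \<le> drift t +
    ((\<Sum>w\<in>{w. real w \<le> \<sigma> t * real n \<and> 0 < w}. lam t w * (4 * sqrt (real w / real n)) ^ w)
    + real (card W) ^ Suc t * exp (- (\<sigma> t * real n) / 2))"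
    using Suc.prems \<sigma>_pos[of t] by (intro drift_step km) auto
  moreover have "(\<Sum>w\<in>{w. real w \<le> \<sigma> t * real n \<and> 0 < w}. lam t w * (4 * sqrt (real w / real n)) ^ w)
      \<le> 2 * sqrt (48 * \<theta> t)"
    using Suc.prems by (intro numeric_drift[OF n0 \<theta>_nonneg small] lam_le_envelope) auto
  ultimately show ?case using Suc by simp
qed (simp add: drift_0)

end

end

subsection \<open>Protocols and the choice of parameters\<close>

lemma prob_pair_uniform:
  assumes "finite A" "a \<in> A"
  shows "measure_pmf.prob (pair_pmf (pmf_of_set A) B) {z. fst z = a \<and> P (snd z)} =
    measure_pmf.prob B {y. P y} / real (card A)"
proof -
  have ne: "A \<noteq> {}" using assms by auto
  have "measure_pmf.prob (pair_pmf (pmf_of_set A) B) {z. fst z = a \<and> P (snd z)} =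
      pmf (map_pmf (\<lambda>z. fst z = a \<and> P (snd z)) (pair_pmf (pmf_of_set A) B)) True"
    by (simp add: pmf_map vimage_def)
  also have "map_pmf (\<lambda>z. fst z = a \<and> P (snd z)) (pair_pmf (pmf_of_set A) B) =
      bind_pmf (pmf_of_set A) (\<lambda>x. map_pmf (\<lambda>y. x = a \<and> P y) B)"
    by (simp add: pair_pmf_def map_bind_pmf map_pmf_def bind_assoc_pmf bind_return_pmf)
  also have "pmf \<dots> True = (\<Sum>x\<in>A. pmf (map_pmf (\<lambda>y. x = a \<and> P y) B) True) / real (card A)"
    by (rule pmf_bind_pmf_of_set[OF ne assms(1)])
  also have "(\<Sum>x\<in>A. pmf (map_pmf (\<lambda>y. x = a \<and> P y) B) True) =
      (\<Sum>x\<in>A. if x = a then measure_pmf.prob B {y. P y} else 0)"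
    by (intro sum.cong refl) (auto simp: pmf_map vimage_def)
  finally show ?thesis using assms by simp
qed

section \<open>Law of the transcript in the YES and NO cases\<close>

context dihp_transcripts
begin

primrec tboard :: "(nat \<Rightarrow> player_input) \<Rightarrow> nat \<Rightarrow> (hypermatching \<times> 'w) list" where
  "tboard I 0 = []"
| "tboard I (Suc t) = tboard I t @ [(fst (I t), g t (tboard I t) (I t))]"

text \<open>Once the earlier entries are replaced by those of \<open>R\<close>, the i-th condition
  concerns the input of player i alone. The event is thus a product event, and its probability
  factors for independent inputs.\<close>

lemma tboard_eq_iff:
  assumes "length R = t"
  shows "tboard I t = R \<longleftrightarrow> (\<forall>i<t. fst (I i) = fst (R ! i) \<and> g i (take i R) (I i) = snd (R ! i))"
  using assms
proof (induction t arbitrary: R)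
  case (Suc t)
  from Suc.prems obtain R' e where R: "R = R' @ [e]" "length R' = t"
    by (metis append_butlast_last_id length_0_conv length_append_singleton nat.distinct(1) nat.inject)
  have "tboard I (Suc t) = R \<longleftrightarrow> tboard I t = R' \<and> (fst (I t), g t R' (I t)) = e"
    using R by auto
  also have "\<dots> \<longleftrightarrow> (\<forall>i<t. fst (I i) = fst (R' ! i) \<and> g i (take i R') (I i) = snd (R' ! i)) \<and>
      fst (I t) = fst e \<and> g t R' (I t) = snd e"
    using Suc.IH[OF R(2)] by auto
  also have "\<dots> \<longleftrightarrow> (\<forall>i<Suc t. fst (I i) = fst (R ! i) \<and> g i (take i R) (I i) = snd (R ! i))"
    using R by (auto simp: less_Suc_eq nth_append)
  finally show ?case .
qed simp

lemma pmf_tboard: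
  assumes "length R = T"
  shows "pmf (map_pmf (\<lambda>I. tboard I T) (Pi_pmf {..<T} undefined D)) R =
    (\<Prod>i<T. measure_pmf.prob (D i) {z. fst z = fst (R ! i) \<and> g i (take i R) z = snd (R ! i)})"
proof -
  have "(\<lambda>I. tboard I T) -` {R} =
      Pi {..<T} (\<lambda>i. {z. fst z = fst (R ! i) \<and> g i (take i R) z = snd (R ! i)})"
    using tboard_eq_iff[OF assms] by (auto simp: Pi_def)
  then show ?thesis by (simp add: pmf_map measure_Pi_pmf_Pi)
qed

lemma nth_transcripts:
  assumes "R \<in> transcripts T" "i < T"
  shows "fst (R ! i) \<in> PM"
proof -
  have "R ! i \<in> set R" using assms length_transcripts[OF assms(1)] by (intro nth_mem) simp
  then have "R ! i \<in> PM \<times> W" using assms(1) unfolding transcripts_def by blast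
  then show ?thesis by auto
qed

lemma pmf_tboard_no:
  assumes R: "R \<in> transcripts T"
  shows "pmf (map_pmf (\<lambda>I. tboard I T) (dihp_no q k T m n)) R = null_prob R / np ^ T"
proof -
  have len: "length R = T" using R by (rule length_transcripts)
  have "measure_pmf.prob (pair_pmf (pmf_of_set PM) (pmf_of_set (Zq_mat q m k)))
      {z. fst z = fst (R ! i) \<and> g i (take i R) z = snd (R ! i)} =
      null_msgp i (take i R) (fst (R ! i)) (snd (R ! i)) / np" if i: "i < T" for i
  proof -
    have ne: "Zq_mat q m k \<noteq> {}" using restrict_mod_in_Zq_mat[OF q] by blast
    have "{z. fst z = fst (R ! i) \<and> g i (take i R) z = snd (R ! i)} =
        {z. fst z = fst (R ! i) \<and> g i (take i R) (fst (R ! i), snd z) = snd (R ! i)}"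
      by (auto simp: prod_eq_iff)
    then have "measure_pmf.prob (pair_pmf (pmf_of_set PM) (pmf_of_set (Zq_mat q m k)))
      {z. fst z = fst (R ! i) \<and> g i (take i R) z = snd (R ! i)} =
      measure_pmf.prob (pmf_of_set (Zq_mat q m k)) {Z. g i (take i R) (fst (R ! i), Z) = snd (R ! i)} / np"
      using prob_pair_uniform[OF finite_PHM nth_transcripts[OF R i],
          where P = "\<lambda>Z. g i (take i R) (fst (R ! i), Z) = snd (R ! i)"] by simp
    also have "measure_pmf.prob (pmf_of_set (Zq_mat q m k)) {Z. g i (take i R) (fst (R ! i), Z) = snd (R ! i)} =
        null_msgp i (take i R) (fst (R ! i)) (snd (R ! i))"
      by (simp only: measure_pmf_of_set[OF ne finite_Zq_mat] null_msgp_def card_Zq_mat Collect_conj_eq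
          Collect_mem_eq)
    finally show ?thesis .
  qed
  then show ?thesis
    unfolding dihp_no_def pmf_tboard[OF len] null_prob_def len by (simp add: prod_dividef)
qed

text \<open>The inputs are independent only conditionally on \<open>X\<close>, so the product
  formula is applied for each \<open>X\<close> and then averaged.\<close>

lemma pmf_tboard_yes:
  assumes R: "R \<in> transcripts T"
  shows "pmf (map_pmf (\<lambda>I. tboard I T) (dihp_yes q k k' T m n \<phi> \<Y>)) R = mean R / np ^ T"
proof -
  have len: "length R = T" using R by (rule length_transcripts)
  have ne: "VX \<noteq> {}" using zX by blast
  define D where "D X t = map_pmf (\<lambda>(M, Y). (M, Zq_mat_diff q m k (hm_proj m k (\<phi> t) M X) Y))
      (pair_pmf (pmf_of_set PM) (iid_rows m (\<Y> t)))" for X t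
  have one: "measure_pmf.prob (D X i) {z. fst z = fst (R ! i) \<and> g i (take i R) z = snd (R ! i)} =
      msgp i (take i R) (fst (R ! i)) (snd (R ! i)) X / np" if i: "i < T" for i X
  proof -
    let ?f = "\<lambda>Y. Zq_mat_diff q m k (hm_proj m k (\<phi> i) (fst (R ! i)) X) Y"
    have "measure_pmf.prob (D X i) {z. fst z = fst (R ! i) \<and> g i (take i R) z = snd (R ! i)} =
      measure_pmf.prob (pair_pmf (pmf_of_set PM) (iid_rows m (\<Y> i)))
        {z. fst z = fst (R ! i) \<and> g i (take i R) (fst (R ! i), ?f (snd z)) = snd (R ! i)}"
      unfolding D_def measure_map_pmf by (rule arg_cong[where f = "measure_pmf.prob _"]) auto
    also have "\<dots> = measure_pmf.prob (iid_rows m (\<Y> i)) {Y. g i (take i R) (fst (R ! i), ?f Y) = snd (R ! i)} / np"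
      by (rule prob_pair_uniform[OF finite_PHM nth_transcripts[OF R i]])
    finally show ?thesis by (simp add: msgp_def vimage_def)
  qed
  have "pmf (map_pmf (\<lambda>I. tboard I T) (dihp_yes q k k' T m n \<phi> \<Y>)) R =
      pmf (bind_pmf (pmf_of_set VX) (\<lambda>X. map_pmf (\<lambda>I. tboard I T) (Pi_pmf {..<T} undefined (D X)))) R"
    unfolding dihp_yes_def D_def map_bind_pmf ..
  also have "\<dots> = (\<Sum>X\<in>VX. pmf (map_pmf (\<lambda>I. tboard I T) (Pi_pmf {..<T} undefined (D X))) R) / real (card VX)"
    by (rule pmf_bind_pmf_of_set[OF ne finite_Zq_mat])
  also have "\<dots> = (\<Sum>X\<in>VX. state R X / np ^ T) / real (card VX)"
    unfolding pmf_tboard[OF len] state_def len by (simp add: one prod_dividef)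
  also have "\<dots> = mean R / np ^ T"
    by (simp add: mean_def card_Zq_mat sum_divide_distrib[symmetric])
  finally show ?thesis .
qed

lemma set_dihp_no: "set_pmf (dihp_no q k T m n) \<subseteq> dihp_inputs q k T m n"
proof -
  have ne: "Zq_mat q m k \<noteq> {}" using restrict_mod_in_Zq_mat[OF q] by blast
  have "set_pmf (dihp_no q k T m n) \<subseteq> PiE_dflt {..<T} undefined (\<lambda>_. PM \<times> Zq_mat q m k)"
    unfolding dihp_no_def
    using set_Pi_pmf_subset'[of "{..<T}" undefined "\<lambda>_. pair_pmf (pmf_of_set PM) (pmf_of_set (Zq_mat q m k))"]
    by (simp add: comp_def PM_nonempty ne set_pmf_of_set)
  also have "\<dots> \<subseteq> dihp_inputs q k T m n"
    by (auto simp: dihp_inputs_def PiE_dflt_def PiE_def extensional_def)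
  finally show ?thesis .
qed

lemma set_dihp_yes: "set_pmf (dihp_yes q k k' T m n \<phi> \<Y>) \<subseteq> dihp_inputs q k T m n"
proof -
  define D where "D X t = map_pmf (\<lambda>(M, Y). (M, Zq_mat_diff q m k (hm_proj m k (\<phi> t) M X) Y))
      (pair_pmf (pmf_of_set PM) (iid_rows m (\<Y> t)))" for X t
  have "set_pmf (Pi_pmf {..<T} undefined (D X)) \<subseteq> dihp_inputs q k T m n" for X
  proof -
    have D: "set_pmf (D X t) \<subseteq> PM \<times> Zq_mat q m k" for t
      using q by (auto simp: D_def PM_nonempty set_pmf_of_set)
    have "set_pmf (Pi_pmf {..<T} undefined (D X)) \<subseteq> PiE_dflt {..<T} undefined (set_pmf \<circ> D X)"
      by (rule set_Pi_pmf_subset') simp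
    also have "\<dots> \<subseteq> dihp_inputs q k T m n"
      using D by (auto simp: dihp_inputs_def PiE_dflt_def PiE_def extensional_def Pi_def)
    finally show ?thesis .
  qed
  then show ?thesis unfolding dihp_yes_def D_def set_bind_pmf by blast
qed

lemma tboard_transcripts:
  assumes "I \<in> dihp_inputs q k T m n" "t \<le> T"
  shows "tboard I t \<in> transcripts t"
  using assms(2)
proof (induction t)
  case (Suc t)
  have "I t \<in> PM \<times> Zq_mat q m k"
    using PiE_mem[OF assms(1)[unfolded dihp_inputs_def], of t] Suc.prems by simp
  then have "fst (I t) \<in> PM" by (simp add: mem_Times_iff)
  moreover have "tboard I t \<in> transcripts t" using Suc by simp
  ultimately show ?case
    using gW[of t "tboard I t" "I t"] unfolding transcripts_def tboard.simps mem_Collect_eq by simp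
qed (simp add: transcripts_def)

lemma output_gap_le_drift:
  "\<bar>measure_pmf.prob (dihp_yes q k k' T m n \<phi> \<Y>) {I. A (tboard I T)} -
    measure_pmf.prob (dihp_no q k T m n) {I. A (tboard I T)}\<bar> \<le> drift T"
proof -
  have *: "measure_pmf.prob D {I. A (tboard I T)} =
      (\<Sum>R\<in>{R \<in> transcripts T. A R}. pmf (map_pmf (\<lambda>I. tboard I T) D) R)"
    if "set_pmf D \<subseteq> dihp_inputs q k T m n" for D
  proof -
    have "measure_pmf.prob D {I. A (tboard I T)} = measure_pmf.prob (map_pmf (\<lambda>I. tboard I T) D) {R. A R}"
      by (simp add: vimage_def)
    also have "\<dots> = measure_pmf.prob (map_pmf (\<lambda>I. tboard I T) D) {R \<in> transcripts T. A R}"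
      using that tboard_transcripts by (intro measure_prob_cong_0) (auto simp: pmf_eq_0_set_pmf)
    also have "\<dots> = (\<Sum>R\<in>{R \<in> transcripts T. A R}. pmf (map_pmf (\<lambda>I. tboard I T) D) R)"
      by (rule measure_measure_pmf_finite) simp
    finally show ?thesis .
  qed
  have eq: "measure_pmf.prob (dihp_yes q k k' T m n \<phi> \<Y>) {I. A (tboard I T)} -
      measure_pmf.prob (dihp_no q k T m n) {I. A (tboard I T)} =
      (\<Sum>R\<in>{R \<in> transcripts T. A R}. (mean R - null_prob R) / np ^ T)"
    unfolding *[OF set_dihp_yes] *[OF set_dihp_no] sum_subtractf[symmetric]
    by (intro sum.cong refl) (simp add: pmf_tboard_yes pmf_tboard_no diff_divide_distrib)
  have "\<bar>\<Sum>R\<in>{R \<in> transcripts T. A R}. (mean R - null_prob R) / np ^ T\<bar> \<le>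
      (\<Sum>R\<in>{R \<in> transcripts T. A R}. \<bar>(mean R - null_prob R) / np ^ T\<bar>)"
    by (rule sum_abs)
  also have "\<dots> \<le> (\<Sum>R\<in>transcripts T. \<bar>(mean R - null_prob R) / np ^ T\<bar>)"
    by (rule sum_mono2[OF finite_transcripts]) (blast, rule abs_ge_zero)
  also have "\<dots> = drift T"
    by (simp only: abs_divide drift_def sum_divide_distrib abs_of_pos[OF zero_less_power[OF np_pos]])
  finally show ?thesis unfolding eq .
qed

end

section \<open>Truncated protocols\<close>

definition short_messages :: "nat \<Rightarrow> bool list set" where
  "short_messages b = {w. length w \<le> b}"

lemma finite_short_messages: "finite (short_messages b)"
  using finite_lists_length_le[of "UNIV :: bool set" b] by (simp add: short_messages_def)

lemma card_short_messages: "card (short_messages b) \<le> 2 ^ (b + 1)"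
proof -
  have "card (short_messages b) = (\<Sum>i\<le>b. 2 ^ i)"
    using card_lists_length_le[of "UNIV :: bool set" b] by (simp add: short_messages_def card_UNIV_bool)
  also have "\<dots> \<le> (2::nat) ^ (b + 1)"
    by (induction b) auto
  finally show ?thesis .
qed

text \<open>
  The output bit becomes the message of the last player; truncation makes the message space
  finite and does not change anything on inputs where the protocol is cheap.
\<close>

definition capped :: "det_protocol \<Rightarrow> nat \<Rightarrow> nat \<Rightarrow> nat \<Rightarrow> blackboard \<Rightarrow> player_input \<Rightarrow> bool list" where
  "capped p T b t R I = (if Suc t < T then take b (message p t R I)
     else [decision p (R @ [(fst I, message p t R I)]) I])"

lemma capped_short: "1 \<le> b \<Longrightarrow> capped p T b t R I \<in> short_messages b"
  by (simp add: capped_def short_messages_def)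

lemma message_in_board:
  "t < T \<Longrightarrow> (fst (I t), message p t (board p I t) (I t)) \<in> set (board p I T)"
  by (induction T) (auto simp: less_Suc_eq)

lemma message_length_le:
  assumes "t < T" "total_bits T p I \<le> b"
  shows "length (message p t (board p I t) (I t)) \<le> b"
proof -
  have "length (message p t (board p I t) (I t)) \<in> set (map (\<lambda>(M, w). length w) (board p I T))"
    using message_in_board[OF assms(1), of I p] by force
  then have "length (message p t (board p I t) (I t)) \<le> total_bits T p I"
    unfolding total_bits_def by (rule member_le_sum_list) simp
  then show ?thesis using assms(2) by simp
qed

locale capped_protocol = dihp_transcripts q k k' n m T \<phi> \<Y> W "capped p T b" c
  for q k k' n m T \<phi> \<Y> W p b c
begin

text \<open>The boards agree strictly before the last entry, where \<open>capped\<close> records the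
  output in place of the message.\<close>

lemma tboard_capped:
  assumes bits: "total_bits T p I \<le> b"
  shows "t < T \<Longrightarrow> tboard I t = board p I t"
proof (induction t)
  case (Suc t)
  then have "length (message p t (board p I t) (I t)) \<le> b"
    using message_length_le[of t T p I b] bits by simp
  then have "capped p T b t (board p I t) (I t) = message p t (board p I t) (I t)"
    using Suc.prems by (simp add: capped_def)
  moreover have "tboard I t = board p I t" using Suc by simp
  ultimately show ?case by (simp only: tboard.simps board.simps)
qed simp

lemma last_tboard_capped:
  assumes bits: "total_bits T p I \<le> b" and T: "1 \<le> T"
  shows "snd (last (tboard I T)) = [final_output T p I]"
proof -
  obtain t where t: "T = Suc t" using T by (cases T) auto
  have "tboard I t = board p I t" using t by (intro tboard_capped[OF bits]) simp
  \<comment> \<open>The last player completes the final board with its own untruncated message, so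
    \<open>decision\<close> receives the same arguments as in \<open>final_output\<close>.\<close>
  moreover have "capped p T b t (board p I t) (I t) = [final_output T p I]"
    by (simp add: t capped_def final_output_def)
  moreover have "tboard I T = tboard I t @ [(fst (I t), capped p T b t (tboard I t) (I t))]"
    by (subst (2) t) (rule tboard.simps)
  ultimately show ?thesis by simp
qed

lemma final_output_gap:
  assumes T: "1 \<le> T"
    and bits: "\<And>I. I \<in> dihp_inputs q k T m n \<Longrightarrow> total_bits T p I \<le> b"
  shows "\<bar>measure_pmf.prob (dihp_yes q k k' T m n \<phi> \<Y>) {I. final_output T p I} -
    measure_pmf.prob (dihp_no q k T m n) {I. final_output T p I}\<bar> \<le> drift T"
proof -
  have *: "measure_pmf.prob D {I. final_output T p I} = measure_pmf.prob D {I. snd (last (tboard I T)) = [True]}"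
    if "set_pmf D \<subseteq> dihp_inputs q k T m n" for D
    using that last_tboard_capped[OF bits T]
    by (intro measure_prob_cong_0) (auto simp: pmf_eq_0_set_pmf)
  show ?thesis
    unfolding *[OF set_dihp_yes] *[OF set_dihp_no]
    by (rule output_gap_le_drift[where A = "\<lambda>R. snd (last R) = [True]"])
qed

end

text \<open>Order of choice: \<epsilon> from \<delta> and T, then \<theta> backwards from
  \<epsilon>, then \<xi> from \<theta> 0 and \<alpha>, the windows \<sigma> from both, \<tau> from
  the last window, and n0 at the end. The drift gets \<delta> / 4 from low frequencies and \<delta>
  / 4 from high ones.\<close>

lemma dihp_parameters:
  fixes q k k' T :: nat and \<delta> \<alpha> :: real
  assumes q: "1 \<le> q" and \<delta>: "0 < \<delta>" "\<delta> < 1 / 2"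
    and \<alpha>: "0 < \<alpha>" "\<alpha> \<le> 1 / (256 * (real k + 1))" and T: "1 \<le> T"
  shows "\<exists>(n0::nat) (\<tau>::real). 0 < \<tau> \<and> \<tau> < 1 \<and>
    (\<forall>n m \<phi> \<Y> g. n0 \<le> n \<longrightarrow> m = nat \<lfloor>\<alpha> * real n\<rfloor> \<longrightarrow>
      (\<forall>t<T. \<phi> t \<in> {..<k} \<rightarrow> {..<k'} \<and> inj_on (\<phi> t) {..<k}) \<longrightarrow>
      (\<forall>t<T. one_wise_uniform q k (\<Y> t)) \<longrightarrow>
      (\<forall>t R I. g t R I \<in> short_messages (nat \<lfloor>\<tau> * real n\<rfloor> + 1)) \<longrightarrow>
      (\<exists>c. dihp_transcripts q k k' n m T \<phi> \<Y> (short_messages (nat \<lfloor>\<tau> * real n\<rfloor> + 1)) g c \<and>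
        dihp_transcripts.drift q k k' n m \<phi> \<Y> (short_messages (nat \<lfloor>\<tau> * real n\<rfloor> + 1)) g T \<le> \<delta> / 2))"
proof -
  define B where "B = 2 * real (q ^ k)"
  have Q1: "1 \<le> real (q ^ k)" using q by simp
  have B1: "1 \<le> B" unfolding B_def using Q1 by linarith
  define G where "G = 6144 * B\<^sup>2"
  have G1: "1 \<le> G" using one_le_power[OF B1, of 2] by (simp add: G_def)
  \<comment> \<open>Chosen so that 2 sqrt(48 \<epsilon>) is at most \<delta> / (4 T), the share of
    one round; the factor \<open>B\<^sup>2\<close> also secures the smallness needed for the
    geometric series.\<close>
  define \<epsilon> where "\<epsilon> = \<delta>\<^sup>2 / (48 * B\<^sup>2 * 64 * (real T)\<^sup>2)"
  have \<epsilon>0: "0 < \<epsilon>" using \<delta> B1 T by (simp add: \<epsilon>_def)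
  \<comment> \<open>Geometric growth by \<open>G\<close> per round, normalised to reach \<epsilon>
    exactly at round T.\<close>
  define \<theta> where "\<theta> t = \<epsilon> / G ^ T * G ^ t" for t
  have \<theta>_pos: "0 < \<theta> t" for t using \<epsilon>0 G1 by (simp add: \<theta>_def)
  have \<theta>_Suc: "\<theta> (Suc t) = 6144 * B\<^sup>2 * \<theta> t" for t by (simp add: \<theta>_def G_def[symmetric])
  have \<theta>_le: "\<theta> t \<le> \<epsilon>" if "t \<le> T" for t
  proof -
    have "G ^ t \<le> G ^ T" using that G1 by (rule power_increasing)
    then have "\<epsilon> / G ^ T * G ^ t \<le> \<epsilon> / G ^ T * G ^ T"
      using \<epsilon>0 G1 by (intro mult_left_mono) auto
    then show ?thesis using G1 by (simp add: \<theta>_def)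
  qed
  have \<epsilon>1: "48 * B\<^sup>2 * \<epsilon> \<le> 1 / 4"
  proof -
    have "48 * B\<^sup>2 * \<epsilon> = \<delta>\<^sup>2 / (64 * (real T)\<^sup>2)" using B1 by (simp add: \<epsilon>_def)
    also have "\<dots> \<le> \<delta>\<^sup>2 / 1"
    proof (rule divide_left_mono)
      have "1 \<le> (real T)\<^sup>2" using T by (simp add: one_le_power)
      then show "1 \<le> 64 * (real T)\<^sup>2" by simp
    qed (use T in auto)
    also have "\<dots> \<le> (1 / 2)\<^sup>2" using \<delta> by (simp only: div_by_1) (intro power_mono, auto)
    finally show ?thesis by (simp add: power2_eq_square)
  qed
  have \<epsilon>2: "2 * sqrt (48 * \<epsilon>) \<le> \<delta> / (4 * real T)"
  proof -
    have "48 * \<epsilon> = (\<delta> / (8 * real T))\<^sup>2 / B\<^sup>2"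
      by (simp add: \<epsilon>_def power_divide power_mult_distrib)
    also have "\<dots> \<le> (\<delta> / (8 * real T))\<^sup>2 / 1"
      using B1 by (intro divide_left_mono) (auto simp: one_le_power)
    finally have "48 * \<epsilon> \<le> (\<delta> / (8 * real T))\<^sup>2" by simp
    then have "sqrt (48 * \<epsilon>) \<le> \<delta> / (8 * real T)"
      using \<delta> by (intro real_le_lsqrt) auto
    then show ?thesis by (simp add: field_simps)
  qed
  \<comment> \<open>The first bound gives \<open>xi\<close> \<le> \<theta> 0 n, where 1728 = 16 *
    108; the second gives 2 c \<le> m, because m is at least \<alpha> n / 2.\<close>
  define \<xi> where "\<xi> = min ((\<theta> 0)\<^sup>2 / (1728 * real (q ^ k) ^ 2)) (\<alpha> / 4)"
  have Q0: "0 < real (q ^ k)" using Q1 by linarith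
  have \<xi>0: "0 < \<xi>"
  proof -
    have "0 < (\<theta> 0)\<^sup>2 / (1728 * real (q ^ k) ^ 2)"
      by (intro divide_pos_pos mult_pos_pos zero_less_power \<theta>_pos Q0) simp
    moreover have "0 < \<alpha> / 4" using \<alpha> by simp
    ultimately show ?thesis unfolding \<xi>_def min_less_iff_conj by blast
  qed
  define E where "E = 256 * real q * (real k' + 1)"
  have E1: "1 \<le> E"
  proof -
    have "1 * 1 \<le> (256 * real q) * (real k' + 1)" using q by (intro mult_mono) auto
    then show ?thesis by (simp add: E_def)
  qed
  \<comment> \<open>The windows are squared because of the counting bound for frequencies;
    \<open>E\<close> is adjusted to the value of \<open>z\<close> at which that bound is
    applied.\<close>
  define \<sigma> where "\<sigma> = rec_nat (min (\<xi> / 2) (min (\<theta> 0) (1 / 16))) (\<lambda>_ s. s\<^sup>2 / E)"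
  have \<sigma>_0: "\<sigma> 0 = min (\<xi> / 2) (min (\<theta> 0) (1 / 16))" and \<sigma>_Suc: "\<sigma> (Suc t) = (\<sigma> t)\<^sup>2 / E" for t
    by (simp_all add: \<sigma>_def)
  have \<sigma>_pos: "0 < \<sigma> t" for t
    by (induction t) (use \<xi>0 \<theta>_pos[of 0] E1 in \<open>auto simp: \<sigma>_0 \<sigma>_Suc\<close>)
  have \<sigma>_small: "\<sigma> t \<le> 1 / 16 \<and> 2 * \<sigma> (Suc t) \<le> \<sigma> t" for t
  proof -
    have half: "2 * \<sigma> (Suc t) \<le> \<sigma> t" if "\<sigma> t \<le> 1 / 16" for t
    proof -
      have "(\<sigma> t)\<^sup>2 / E \<le> (\<sigma> t)\<^sup>2 / 1" using E1 by (intro divide_left_mono) auto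
      also have "\<dots> \<le> \<sigma> t * (1 / 16)" unfolding power2_eq_square div_by_1
        using that \<sigma>_pos[of t] by (intro mult_left_mono) auto
      finally have "\<sigma> (Suc t) \<le> \<sigma> t * (1 / 16)" by (simp only: \<sigma>_Suc)
      then show ?thesis using \<sigma>_pos[of t] by linarith
    qed
    have "\<sigma> t \<le> 1 / 16"
    proof (induction t)
      case (Suc t)
      then show ?case using half[of t] \<sigma>_pos[of t] by linarith
    qed (simp add: \<sigma>_0)
    then show ?thesis using half by simp
  qed
  have \<sigma>_antimono: "\<sigma> T \<le> \<sigma> t" if "t \<le> T" for t
    using that
  proof (induction rule: dec_induct)
    case (step j)
    then show ?case using \<sigma>_small[of j] \<sigma>_pos[of "Suc j"] by linarith
  qed simp
  \<comment> \<open>The number of message sequences over T rounds may be at most exp(\<sigma> T n /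
    16). Half of this exponent pays for the lengths \<tau> n, the other half for the additive
    constants once n is large.\<close>
  define \<tau> where "\<tau> = \<sigma> T / (32 * real T)"
  have \<tau>0: "0 < \<tau>" using \<sigma>_pos[of T] T by (simp add: \<tau>_def)
  have \<tau>_le: "\<tau> \<le> \<sigma> T / 32" unfolding \<tau>_def using \<sigma>_pos[of T] T by (intro divide_left_mono) auto
  have \<tau>1: "\<tau> < 1" using \<tau>_le \<sigma>_small[of T] by linarith
  have \<tau>\<xi>: "\<tau> \<le> \<xi> / 4"
    using \<tau>_le \<sigma>_antimono[of 0] \<sigma>_0 \<xi>0 by linarith
  \<comment> \<open>One summand per demand: m \<ge> \<alpha> n / 2; then c \<ge> \<xi> n / 2 and b +
    1 \<le> c; then the additive constants in the number of transcripts; finally the high-frequency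
    share of the drift.\<close>
  define n0 where "n0 = nat \<lceil>2 / \<alpha> + 8 / \<xi> + 64 * real T / \<sigma> T + 16 * real T / (\<delta> * \<sigma> T)\<rceil> + 1"
  show ?thesis
  proof (rule exI[of _ n0], rule exI[of _ \<tau>], intro conjI \<tau>0 \<tau>1 allI impI)
    fix n m :: nat and \<phi> :: "nat \<Rightarrow> nat \<Rightarrow> nat" and \<Y> :: "nat \<Rightarrow> (nat \<Rightarrow> int) pmf"
      and g :: "nat \<Rightarrow> blackboard \<Rightarrow> player_input \<Rightarrow> bool list"
    define b where "b = nat \<lfloor>\<tau> * real n\<rfloor> + 1"
    define W where "W = short_messages b"
    assume nn: "n0 \<le> n" and m: "m = nat \<lfloor>\<alpha> * real n\<rfloor>"
      and \<phi>: "\<forall>t<T. \<phi> t \<in> {..<k} \<rightarrow> {..<k'} \<and> inj_on (\<phi> t) {..<k}"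
      and \<Y>: "\<forall>t<T. one_wise_uniform q k (\<Y> t)"
      and g: "\<forall>t R I. g t R I \<in> short_messages (nat \<lfloor>\<tau> * real n\<rfloor> + 1)"
    have pos: "0 \<le> 2 / \<alpha>" "0 \<le> 8 / \<xi>" "0 \<le> 64 * real T / \<sigma> T" "0 \<le> 16 * real T / (\<delta> * \<sigma> T)"
      using \<alpha> \<xi>0 \<sigma>_pos[of T] \<delta> by (auto intro!: divide_nonneg_nonneg)
    have "2 / \<alpha> + 8 / \<xi> + 64 * real T / \<sigma> T + 16 * real T / (\<delta> * \<sigma> T) < real n"
    proof -
      have "2 / \<alpha> + 8 / \<xi> + 64 * real T / \<sigma> T + 16 * real T / (\<delta> * \<sigma> T) \<le>
          real (nat \<lceil>2 / \<alpha> + 8 / \<xi> + 64 * real T / \<sigma> T + 16 * real T / (\<delta> * \<sigma> T)\<rceil>)"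
        by (rule real_nat_ceiling_ge)
      also have "\<dots> < real n" using nn by (simp add: n0_def)
      finally show ?thesis .
    qed
    with pos have big: "2 / \<alpha> < real n" "8 / \<xi> < real n" "64 * real T / \<sigma> T < real n"
      "16 * real T / (\<delta> * \<sigma> T) < real n" by linarith+
    have n: "0 < n" using big(1) pos(1) by (intro gr0I) auto
    have big1: "2 < \<alpha> * real n" using big(1) \<alpha> by (simp add: divide_less_eq mult.commute)
    have big2: "8 < \<xi> * real n" using big(2) \<xi>0 by (simp add: divide_less_eq mult.commute)
    have big3: "64 * real T < \<sigma> T * real n" using big(3) \<sigma>_pos[of T] by (simp add: divide_less_eq mult.commute)
    have big4: "16 * real T < \<delta> * (\<sigma> T * real n)"
      using big(4) \<sigma>_pos[of T] \<delta> by (simp add: divide_less_eq mult_ac)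
    have m_le: "real m \<le> \<alpha> * real n" using m \<alpha> by simp
    have m_ge: "\<alpha> * real n / 2 \<le> real m" using m big1 by linarith
    have km: "256 * k * m \<le> n"
    proof -
      have "256 * real k * real m \<le> 256 * real k * (1 / (256 * (real k + 1)) * real n)"
        using m_le \<alpha> by (intro mult_left_mono order_trans[OF m_le] mult_right_mono) auto
      also have "\<dots> = real k / (real k + 1) * real n" by (simp add: field_simps)
      also have "\<dots> \<le> 1 * real n" by (intro mult_right_mono) (auto simp: field_simps)
      finally have "real (256 * k * m) \<le> real n" by simp
      then show ?thesis by (simp only: of_nat_le_iff)
    qed
    have mn: "2 * m \<le> n"
    proof -
      have "\<alpha> \<le> 1 / 256" using \<alpha>(2) by (rule order_trans) (auto simp: field_simps)
      then have "\<alpha> * real n \<le> 1 / 256 * real n" by (intro mult_right_mono) auto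
      then have "2 * real m \<le> real n" using m_le by linarith
      then show ?thesis by linarith
    qed
    \<comment> \<open>Larger than the message length: it must dominate every level of the first
      window, while the number of messages has to stay small compared with the last window.\<close>
    define c where "c = nat \<lfloor>\<xi> * real n\<rfloor>"
    have c_le: "real c \<le> \<xi> * real n" using \<xi>0 by (simp add: c_def)
    have c_ge: "\<xi> * real n / 2 \<le> real c" unfolding c_def using big2 by linarith
    have cm: "2 * c \<le> m"
    proof -
      have "\<xi> * real n \<le> \<alpha> / 4 * real n" by (intro mult_right_mono) (auto simp: \<xi>_def)
      then have "2 * real c \<le> real m" using c_le m_ge by linarith
      then show ?thesis by linarith
    qed
    have b_le: "real b \<le> \<tau> * real n + 1" unfolding b_def using \<tau>0 by simp
    have bc: "b + 1 \<le> c"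
    proof -
      have "\<tau> * real n \<le> \<xi> / 4 * real n" using \<tau>\<xi> by (intro mult_right_mono) auto
      then have "real (b + 1) \<le> real c" using b_le c_ge big2 by simp
      then show ?thesis by (simp only: of_nat_le_iff)
    qed
    have cardW: "card W \<le> 2 ^ (b + 1)" unfolding W_def by (rule card_short_messages)
    then have cardWc: "card W \<le> 2 ^ c"
      using power_increasing[OF bc, of "2::nat"] by linarith
    have W1: "1 \<le> real (card W)"
    proof -
      have "[] \<in> W" by (simp add: W_def short_messages_def)
      then have "0 < card W" using finite_short_messages by (auto simp: card_gt_0_iff W_def)
      then show ?thesis by simp
    qed
    have WT: "real (card W) ^ Suc i \<le> exp (\<sigma> T * real n / 16)" if "i < T" for i
    proof -
      have "real (card W) \<le> 2 ^ (b + 1)" using cardW by (metis of_nat_le_iff of_nat_numeral of_nat_power)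
      also have "\<dots> \<le> exp 1 ^ (b + 1)" using exp_ge_add_one_self[of 1] by (intro power_mono) auto
      also have "\<dots> = exp (real (b + 1))" by (simp only: exp_of_nat_mult[symmetric] mult_1_right)
      also have "\<dots> \<le> exp (\<tau> * real n + 2)" using b_le by simp
      finally have "real (card W) \<le> exp (\<tau> * real n + 2)" .
      then have "real (card W) ^ T \<le> exp (\<tau> * real n + 2) ^ T" by (intro power_mono) auto
      also have "\<dots> = exp (real T * (\<tau> * real n + 2))" by (simp add: exp_of_nat_mult)
      also have "\<dots> \<le> exp (\<sigma> T * real n / 16)"
      proof -
        have "real T * (\<tau> * real n) = \<sigma> T * real n / 32" using T by (simp add: \<tau>_def)
        then have "real T * (\<tau> * real n + 2) \<le> \<sigma> T * real n / 16"
          using big3 unfolding distrib_left by linarith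
        then show ?thesis by simp
      qed
      finally have "real (card W) ^ T \<le> exp (\<sigma> T * real n / 16)" .
      moreover have "real (card W) ^ Suc i \<le> real (card W) ^ T"
        using that W1 by (intro power_increasing) auto
      ultimately show ?thesis by linarith
    qed
    interpret D: dihp_transcripts q k k' n m T \<phi> \<Y> W g c
      by unfold_locales
        (use q mn n \<phi> \<Y> g cardWc cm in \<open>auto simp: W_def b_def finite_short_messages\<close>)
    have xi: "D.xi \<le> \<theta> 0 * real n"
    proof -
      have "108 * real (q ^ k) ^ 2 * real m * real c \<le> 108 * real (q ^ k) ^ 2 * real n * (\<xi> * real n)"
        using mn c_le by (intro mult_mono) auto
      also have "\<dots> \<le> 108 * real (q ^ k) ^ 2 * real n * ((\<theta> 0)\<^sup>2 / (1728 * real (q ^ k) ^ 2) * real n)"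
        by (intro mult_left_mono mult_right_mono) (auto simp: \<xi>_def)
      also have "\<dots> = (\<theta> 0 * real n / 4)\<^sup>2"
        using q by (simp add: field_simps power2_eq_square)
      finally have "sqrt (108 * real (q ^ k) ^ 2 * real m * real c) \<le> \<theta> 0 * real n / 4"
        using \<theta>_pos[of 0] by (intro real_le_lsqrt) auto
      then show ?thesis unfolding D.xi_def by linarith
    qed
    have high: "real (card {s \<in> Zq_mat q n k'. card (supp n k' s) = \<omega>}) *
        (real (card W) ^ Suc t * exp (- (\<sigma> t * real n) / 4)) \<le> 1"
      if t: "t < T" and \<omega>: "real \<omega> \<le> \<sigma> (Suc t) * real n" for t \<omega>
    proof -
      \<comment> \<open>At this point both exponents in \<open>card_weight_le\<close> are at most
        \<sigma> t n / 16, so half of the gain exp(- \<sigma> t n / 4) remains to pay for the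
        messages.\<close>
      define z where "z = \<sigma> t / (16 * real q * (real k' + 1))"
      have z: "0 < z" using \<sigma>_pos[of t] q by (simp add: z_def)
      have "real (card {s \<in> Zq_mat q n k'. card (supp n k' s) = \<omega>}) \<le>
          exp (\<sigma> (Suc t) * real n / z + real q * z * real (n * k'))"
        using q by (intro card_weight_le z \<omega>) auto
      also have "\<dots> \<le> exp (\<sigma> t * real n / 8)"
      proof -
        have e: "E * z = 16 * \<sigma> t"
        proof -
          have D: "0 < 16 * real q * (real k' + 1)" using q by (intro mult_pos_pos) auto
          have E: "E = 16 * (16 * real q * (real k' + 1))" by (simp add: E_def)
          have "16 * d * (r / d) = 16 * r" if "0 < d" for d r :: real using that by simp
          from this[OF D] show ?thesis unfolding z_def E .
        qed
        have "\<sigma> (Suc t) / z = (\<sigma> t)\<^sup>2 / (E * z)" by (simp add: \<sigma>_Suc)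
        also have "\<dots> = \<sigma> t / 16" unfolding e using \<sigma>_pos[of t] by (simp add: power2_eq_square)
        finally have "\<sigma> (Suc t) / z * real n = \<sigma> t / 16 * real n" by (rule arg_cong)
        then have 1: "\<sigma> (Suc t) * real n / z = \<sigma> t * real n / 16"
          by (simp only: times_divide_eq_left)
        have "real q * z * real k' = \<sigma> t / 16 * (real k' / (real k' + 1))"
        proof -
          have "a * (r / (16 * a * d)) * e = r / 16 * (e / d)" if "0 < a" for a r d e :: real
            using that by simp
          from this[of "real q"] show ?thesis unfolding z_def using q by simp
        qed
        also have "\<dots> \<le> \<sigma> t / 16 * 1"
          using \<sigma>_pos[of t] by (intro mult_left_mono) (auto simp: field_simps)
        finally have "real q * z * real k' * real n \<le> \<sigma> t / 16 * real n"
          by (intro mult_right_mono) auto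
        then have "real q * z * real (n * k') \<le> \<sigma> t * real n / 16" by (simp add: mult_ac)
        with 1 show ?thesis by simp
      qed
      finally have "real (card {s \<in> Zq_mat q n k'. card (supp n k' s) = \<omega>}) *
          (real (card W) ^ Suc t * exp (- (\<sigma> t * real n) / 4)) \<le>
          exp (\<sigma> t * real n / 8) * (exp (\<sigma> T * real n / 16) * exp (- (\<sigma> t * real n) / 4))"
        using WT[OF t] by (intro mult_mono) auto
      also have "\<dots> = exp (\<sigma> T * real n / 16 - \<sigma> t * real n / 8)"
        by (simp add: exp_add[symmetric])
      also have "\<dots> \<le> 1"
      proof -
        have "\<sigma> T * real n \<le> \<sigma> t * real n" "0 \<le> \<sigma> t * real n"
          using t \<sigma>_pos[of t] by (auto intro!: mult_right_mono \<sigma>_antimono)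
        then have "\<sigma> T * real n / 16 - \<sigma> t * real n / 8 \<le> 0" by linarith
        then show ?thesis by simp
      qed
      finally show ?thesis .
    qed
    have "D.drift T \<le> (\<Sum>i<T. 2 * sqrt (48 * \<theta> i) + real (card W) ^ Suc i * exp (- (\<sigma> i * real n) / 2))"
    proof (rule D.drift_le[OF B_def xi \<theta>_Suc _ \<sigma>_pos _ _ _ _ km high order_refl])
      show "48 * B\<^sup>2 * \<theta> t \<le> 1 / 4" if "t \<le> T" for t
        using mult_left_mono[OF \<theta>_le[OF that], of "48 * B\<^sup>2"] \<epsilon>1 by simp
      show "2 * \<sigma> (Suc t) \<le> \<sigma> t" for t using \<sigma>_small by simp
      show "\<sigma> 0 * real n \<le> real c"
      proof -
        have "\<sigma> 0 * real n \<le> \<xi> / 2 * real n" by (intro mult_right_mono) (auto simp: \<sigma>_0)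
        then show ?thesis using c_ge by simp
      qed
    qed (auto simp: \<sigma>_0)
    also have "\<dots> \<le> (\<Sum>i<T. \<delta> / (4 * real T) + \<delta> / (4 * real T))"
    proof (rule sum_mono)
      fix i assume "i \<in> {..<T}"
      then have i: "i < T" by simp
      have "2 * sqrt (48 * \<theta> i) \<le> 2 * sqrt (48 * \<epsilon>)"
        using \<theta>_le[of i] i by (intro mult_left_mono real_sqrt_le_mono) auto
      moreover have "real (card W) ^ Suc i * exp (- (\<sigma> i * real n) / 2) \<le> \<delta> / (4 * real T)"
      proof -
        define y where "y = \<sigma> T * real n / 4"
        have y0: "0 < y" using \<sigma>_pos[of T] n by (simp add: y_def)
        have "real (card W) ^ Suc i * exp (- (\<sigma> i * real n) / 2) \<le>
            exp (\<sigma> T * real n / 16) * exp (- (\<sigma> T * real n) / 2)"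
          using WT[OF i] mult_right_mono[OF \<sigma>_antimono[of i], of "real n"] i
          by (intro mult_mono) auto
        also have "\<dots> \<le> exp (- y)"
          unfolding exp_add[symmetric] exp_le_cancel_iff using y0 unfolding y_def by linarith
        also have "\<dots> \<le> 1 / y"
        proof -
          have "y \<le> exp y" using exp_ge_add_one_self[of y] by linarith
          then show ?thesis using y0 by (simp add: exp_minus field_simps)
        qed
        also have "\<dots> \<le> \<delta> / (4 * real T)"
        proof -
          have "\<delta> * y = \<delta> * (\<sigma> T * real n) / 4" by (simp add: y_def)
          then have "4 * real T \<le> \<delta> * y" using big4 by linarith
          then show ?thesis using y0 T by (simp add: field_simps)
        qed
        finally show ?thesis .
      qed
      ultimately show "2 * sqrt (48 * \<theta> i) + real (card W) ^ Suc i * exp (- (\<sigma> i * real n) / 2) \<le>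
        \<delta> / (4 * real T) + \<delta> / (4 * real T)"
        using \<epsilon>2 by linarith
    qed
    also have "\<dots> = \<delta> / 2" using T by simp
    finally have "D.drift T \<le> \<delta> / 2" .
    then show "\<exists>c. dihp_transcripts q k k' n m T \<phi> \<Y> (short_messages (nat \<lfloor>\<tau> * real n\<rfloor> + 1)) g c \<and>
          dihp_transcripts.drift q k k' n m \<phi> \<Y> (short_messages (nat \<lfloor>\<tau> * real n\<rfloor> + 1)) g T \<le> \<delta> / 2"
      using D.dihp_transcripts_axioms unfolding W_def b_def by blast
  qed
qed

section \<open>Shared randomness and the lower bound\<close>

lemma prob_yes_expectation:
  "prob_yes T P D = measure_pmf.expectation P (\<lambda>p. measure_pmf.prob D {I. final_output T p I})"
  unfolding prob_yes_def pmf_bind by (simp add: pmf_map vimage_def)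

text \<open>The coins are independent of the input, so the signed gap of a randomised protocol is a
  mean of gaps of deterministic ones.\<close>

lemma prob_yes_gap:
  assumes "\<And>p. p \<in> set_pmf P \<Longrightarrow>
    \<bar>measure_pmf.prob D {I. final_output T p I} - measure_pmf.prob D' {I. final_output T p I}\<bar> \<le> r"
  shows "\<bar>prob_yes T P D - prob_yes T P D'\<bar> \<le> r"
proof -
  have int: "integrable (measure_pmf P) (\<lambda>p. measure_pmf.prob D {I. final_output T p I})" for D
    by (rule measure_pmf.integrable_const_bound[where B = 1]) auto
  have "\<bar>prob_yes T P D - prob_yes T P D'\<bar> = \<bar>measure_pmf.expectation P
      (\<lambda>p. measure_pmf.prob D {I. final_output T p I} - measure_pmf.prob D' {I. final_output T p I})\<bar>"
    unfolding prob_yes_expectation by (subst Bochner_Integration.integral_diff[OF int int]) simp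
  also have "\<dots> \<le> measure_pmf.expectation P
      (\<lambda>p. \<bar>measure_pmf.prob D {I. final_output T p I} - measure_pmf.prob D' {I. final_output T p I}\<bar>)"
    by (rule integral_abs_bound)
  also have "\<dots> \<le> measure_pmf.expectation P (\<lambda>_. r)"
    by (intro integral_mono_AE integrable_abs Bochner_Integration.integrable_diff int)
      (auto simp: AE_measure_pmf_iff assms)
  finally show ?thesis by simp
qed

text \<open>A protocol of cost below \<tau> n has finite cost, and then every deterministic protocol
  in its support is short on all legal inputs. Truncation leaves its output unchanged there, so its
  gap is at most the drift, and \<delta> / 2 contradicts advantage \<delta>.\<close>

theorem theorem3p5:
  fixes q k k' :: nat
  assumes "1 \<le> q" and "k \<le> k'"
  shows "\<forall>\<delta>::real. 0 < \<delta> \<and> \<delta> < 1 / 2 \<longrightarrow>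
    (\<exists>\<alpha>0::real. 0 < \<alpha>0 \<and>
      (\<forall>(\<alpha>::real) (T::nat). 0 < \<alpha> \<and> \<alpha> \<le> \<alpha>0 \<and> 1 \<le> T \<longrightarrow>
        (\<exists>(n0::nat) (\<tau>::real). 0 < \<tau> \<and> \<tau> < 1 \<and>
          (\<forall>(\<phi> :: nat \<Rightarrow> nat \<Rightarrow> nat) (\<Y> :: nat \<Rightarrow> (nat \<Rightarrow> int) pmf) (n::nat) (m::nat) (P::protocol).
            (\<forall>t<T. \<phi> t \<in> {..<k} \<rightarrow> {..<k'} \<and> inj_on (\<phi> t) {..<k}) \<and>
            (\<forall>t<T. one_wise_uniform q k (\<Y> t)) \<and>
            n0 \<le> n \<and> m = nat \<lfloor>\<alpha> * real n\<rfloor> \<and>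
            succeeds_with_advantage q k k' T m n \<phi> \<Y> P \<delta>
            \<longrightarrow> ereal (\<tau> * real n) \<le> ereal_of_enat (comm_cost q k T m n P)))))"
proof (intro allI impI exI[of _ "1 / (256 * (real k + 1))"] conjI)
  \<comment> \<open>The witness for \<open>\<alpha>0\<close> ensures 256 k m \<le> n and 2 m \<le>
    n; adding 1 to \<open>k\<close> keeps both available when k = 0.\<close>
  fix \<delta> \<alpha> :: real and T :: nat
  assume \<delta>: "0 < \<delta> \<and> \<delta> < 1 / 2" and \<alpha>T: "0 < \<alpha> \<and> \<alpha> \<le> 1 / (256 * (real k + 1)) \<and> 1 \<le> T"
  then have T: "1 \<le> T" by simp
  obtain n0 \<tau> where \<tau>: "0 < \<tau>" "\<tau> < 1" and
    main: "\<forall>n m \<phi> \<Y> g. n0 \<le> n \<longrightarrow> m = nat \<lfloor>\<alpha> * real n\<rfloor> \<longrightarrow>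
      (\<forall>t<T. \<phi> t \<in> {..<k} \<rightarrow> {..<k'} \<and> inj_on (\<phi> t) {..<k}) \<longrightarrow>
      (\<forall>t<T. one_wise_uniform q k (\<Y> t)) \<longrightarrow>
      (\<forall>t R I. g t R I \<in> short_messages (nat \<lfloor>\<tau> * real n\<rfloor> + 1)) \<longrightarrow>
      (\<exists>c. dihp_transcripts q k k' n m T \<phi> \<Y> (short_messages (nat \<lfloor>\<tau> * real n\<rfloor> + 1)) g c \<and>
        dihp_transcripts.drift q k k' n m \<phi> \<Y> (short_messages (nat \<lfloor>\<tau> * real n\<rfloor> + 1)) g T \<le> \<delta> / 2)"
    using dihp_parameters[where k' = k', OF assms(1) conjunct1[OF \<delta>] conjunct2[OF \<delta>]
      conjunct1[OF \<alpha>T] conjunct1[OF conjunct2[OF \<alpha>T]] T] by (elim exE conjE)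
  show "\<exists>n0 \<tau>. 0 < \<tau> \<and> \<tau> < 1 \<and>
          (\<forall>(\<phi> :: nat \<Rightarrow> nat \<Rightarrow> nat) (\<Y> :: nat \<Rightarrow> (nat \<Rightarrow> int) pmf) (n::nat) (m::nat) (P::protocol).
            (\<forall>t<T. \<phi> t \<in> {..<k} \<rightarrow> {..<k'} \<and> inj_on (\<phi> t) {..<k}) \<and>
            (\<forall>t<T. one_wise_uniform q k (\<Y> t)) \<and>
            n0 \<le> n \<and> m = nat \<lfloor>\<alpha> * real n\<rfloor> \<and>
            succeeds_with_advantage q k k' T m n \<phi> \<Y> P \<delta>
            \<longrightarrow> ereal (\<tau> * real n) \<le> ereal_of_enat (comm_cost q k T m n P))"
  proof (intro exI[of _ n0] exI[of _ \<tau>] conjI \<tau> allI impI, elim conjE)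
    fix \<phi> :: "nat \<Rightarrow> nat \<Rightarrow> nat" and \<Y> :: "nat \<Rightarrow> (nat \<Rightarrow> int) pmf" and n m :: nat and P :: protocol
    assume \<phi>: "\<forall>t<T. \<phi> t \<in> {..<k} \<rightarrow> {..<k'} \<and> inj_on (\<phi> t) {..<k}"
      and \<Y>: "\<forall>t<T. one_wise_uniform q k (\<Y> t)"
      and n: "n0 \<le> n" and m: "m = nat \<lfloor>\<alpha> * real n\<rfloor>"
      and adv: "succeeds_with_advantage q k k' T m n \<phi> \<Y> P \<delta>"
    \<comment> \<open>The added 1 keeps \<open>b\<close> positive, so that the one-bit output also
      counts as a short message.\<close>
    define b where "b = nat \<lfloor>\<tau> * real n\<rfloor> + 1"
    define gap where "gap p = \<bar>measure_pmf.prob (dihp_yes q k k' T m n \<phi> \<Y>) {I. final_output T p I} -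
        measure_pmf.prob (dihp_no q k T m n) {I. final_output T p I}\<bar>" for p
    show "ereal (\<tau> * real n) \<le> ereal_of_enat (comm_cost q k T m n P)"
    proof (rule ccontr)
      assume "\<not> ereal (\<tau> * real n) \<le> ereal_of_enat (comm_cost q k T m n P)"
      then obtain C where C: "comm_cost q k T m n P = enat C" "real C < \<tau> * real n"
        by (cases "comm_cost q k T m n P") auto
      have gap: "gap p \<le> \<delta> / 2" if p: "p \<in> set_pmf P" for p
      proof -
        have bits: "total_bits T p I \<le> b" if "I \<in> dihp_inputs q k T m n" for I
        proof -
          have "enat (total_bits T p I) \<le> comm_cost q k T m n P"
            unfolding comm_cost_def using p that by (meson SUP_upper SUP_upper2)
          then have "total_bits T p I \<le> C" using C by simp
          also have "C \<le> b" using C(2) unfolding b_def by linarith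
          finally show ?thesis .
        qed
        have "\<exists>c. dihp_transcripts q k k' n m T \<phi> \<Y> (short_messages b) (capped p T b) c \<and>
          dihp_transcripts.drift q k k' n m \<phi> \<Y> (short_messages b) (capped p T b) T \<le> \<delta> / 2"
          unfolding b_def by (rule main[rule_format]) (use n m \<phi> \<Y> capped_short in auto)
        then obtain c where "dihp_transcripts q k k' n m T \<phi> \<Y> (short_messages b) (capped p T b) c"
          and small: "dihp_transcripts.drift q k k' n m \<phi> \<Y> (short_messages b) (capped p T b) T \<le> \<delta> / 2"
          by blast
        then interpret D: capped_protocol q k k' n m T \<phi> \<Y> "short_messages b" p b c
          by (simp add: capped_protocol_def)
        show ?thesis
          using D.final_output_gap[OF T bits] small unfolding gap_def by linarith
      qed
      have "\<bar>prob_yes T P (dihp_yes q k k' T m n \<phi> \<Y>) - prob_yes T P (dihp_no q k T m n)\<bar> \<le> \<delta> / 2"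
        using gap unfolding gap_def by (rule prob_yes_gap)
      then show False using adv \<delta> unfolding succeeds_with_advantage_def by linarith
    qed
  qed
qed (auto simp: add_pos_nonneg)

end
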